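(* Let $A \in \mathbb{R}^{m\times n}$ with $\operatorname{rank}A = n$, $b\in\mathbb{R}^m$, and let $\mathcal{P}=\{x\in\mathbb{R}^n\colon Ax\le b\}$ be a pointed $n$-dimensional polyhedron whose inequalities are all facet-defining. Let $\Delta=\Delta(A)$ and $\Delta_{\min}=\Delta_{\min}(\mathcal{P},A)$. Then the graph $\mathcal{G}(\mathcal{P})$ satisfies $$\operatorname{diam}\bigl(\mathcal{G}(\mathcal{P})\bigr) = O\!\left(n^3\cdot\frac{\Delta}{\Delta_{\min}}\cdot\ln\Bigl(n\frac{\Delta}{\Delta_{\min}}\Bigr)\right),$$ with an absolute constant in the $O(\cdot)$.
   Context: $\mathcal{G}(\mathcal{P})$ is the graph formed by the vertices and edges ($1$-skeleton) of $\mathcal{P}$. $\Delta(A)$ is the maximum of $|\det A_{\mathcal{B}}|$ over $n$-element row index sets $\mathcal{B}$. For a vertex $v$, its normal cone is $\operatorname{cone}(A_{i*}^\top\colon A_{i*}v=b_i)$; the normal fan consists of these cones and their faces. A triangulation $\mathcal{T}$ of the normal fan partitions each $n$-dimensional normal cone into $n$-dimensional simplicial cones generated by $n$ of the vectors $A_{i*}^\top$ with $A_{i*}v=b_i$, forming a fan; each is identified with its row index set $\mathcal{B}$. $\Delta_{\min}(\mathcal{P},A)=\max_{\mathcal{T}}\min_{\mathcal{B}\in\mathcal{T}}|\det A_{\mathcal{B}}|$ over all triangulations $\mathcal{T}$.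
   Formalization: The formal theorem assumes n ≥ 2; for n = 1 the claim fails, e.g. P = [0,1] given by rows 1 and −1 has Δ = Δ_min = 1, so the bound is a multiple of ln 1 = 0 while the diameter is 1. *)

theory Defs
  imports Complex_Main "Jordan_Normal_Form.Determinant" "Jordan_Normal_Form.DL_Submatrix"
begin

definition polyhedron :: "real mat \<Rightarrow> real vec \<Rightarrow> real vec set" where
  "polyhedron A b = {x \<in> carrier_vec (dim_col A). \<forall>i<dim_row A. row A i \<bullet> x \<le> b $ i}"

definition lin_indep_fam :: "nat \<Rightarrow> nat \<Rightarrow> (nat \<Rightarrow> real vec) \<Rightarrow> bool" where
  "lin_indep_fam n k w \<longleftrightarrow>
     (\<forall>c :: nat \<Rightarrow> real. (\<forall>j<n. (\<Sum>l<k. c l * (w l $ j)) = 0) \<longrightarrow> (\<forall>l<k. c l = 0))"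

definition full_column_rank :: "real mat \<Rightarrow> bool" where
  "full_column_rank A \<longleftrightarrow> lin_indep_fam (dim_row A) (dim_col A) (col A)"

definition aff_indep_pts :: "nat \<Rightarrow> nat \<Rightarrow> (nat \<Rightarrow> real vec) \<Rightarrow> bool" where
  "aff_indep_pts n d p \<longleftrightarrow> lin_indep_fam n d (\<lambda>l. p (Suc l) - p 0)"

definition has_aff_dim :: "nat \<Rightarrow> real vec set \<Rightarrow> nat \<Rightarrow> bool" where
  "has_aff_dim n S d \<longleftrightarrow> S \<subseteq> carrier_vec n \<and>
     (\<exists>p. (\<forall>l\<le>d. p l \<in> S) \<and> aff_indep_pts n d p) \<and>
     \<not> (\<exists>p. (\<forall>l\<le>Suc d. p l \<in> S) \<and> aff_indep_pts n (Suc d) p)"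

definition is_face :: "real mat \<Rightarrow> real vec \<Rightarrow> real vec set \<Rightarrow> bool" where
  "is_face A b F \<longleftrightarrow> (\<exists>c \<in> carrier_vec (dim_col A). \<exists>\<delta>.
      (\<forall>x \<in> polyhedron A b. c \<bullet> x \<le> \<delta>) \<and> F = {x \<in> polyhedron A b. c \<bullet> x = \<delta>})"

definition is_vertex :: "real mat \<Rightarrow> real vec \<Rightarrow> real vec \<Rightarrow> bool" where
  "is_vertex A b v \<longleftrightarrow> is_face A b {v}"

definition segment_vec :: "real vec \<Rightarrow> real vec \<Rightarrow> real vec set" where
  "segment_vec u v = {(1 - t) \<cdot>\<^sub>v u + t \<cdot>\<^sub>v v | t. 0 \<le> t \<and> t \<le> 1}"

definition adjacent :: "real mat \<Rightarrow> real vec \<Rightarrow> real vec \<Rightarrow> real vec \<Rightarrow> bool" where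
  "adjacent A b u v \<longleftrightarrow> is_vertex A b u \<and> is_vertex A b v \<and> u \<noteq> v \<and>
     is_face A b (segment_vec u v)"

definition graph_path_le :: "real mat \<Rightarrow> real vec \<Rightarrow> real vec \<Rightarrow> real vec \<Rightarrow> real \<Rightarrow> bool" where
  "graph_path_le A b u v k \<longleftrightarrow> (\<exists>ps. ps \<noteq> [] \<and> hd ps = u \<and> last ps = v \<and>
     (\<forall>i < length ps. is_vertex A b (ps ! i)) \<and>
     (\<forall>i. Suc i < length ps \<longrightarrow> adjacent A b (ps ! i) (ps ! Suc i)) \<and>
     real (length ps - 1) \<le> k)"

definition pointed :: "real mat \<Rightarrow> real vec \<Rightarrow> bool" where
  "pointed A b \<longleftrightarrow> \<not> (\<exists>x \<in> polyhedron A b. \<exists>d \<in> carrier_vec (dim_col A).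
      d \<noteq> 0\<^sub>v (dim_col A) \<and> (\<forall>t::real. x + t \<cdot>\<^sub>v d \<in> polyhedron A b))"

definition facet_defining :: "real mat \<Rightarrow> real vec \<Rightarrow> nat \<Rightarrow> bool" where
  "facet_defining A b i \<longleftrightarrow>
     has_aff_dim (dim_col A) {x \<in> polyhedron A b. row A i \<bullet> x = b $ i} (dim_col A - 1)"

definition absdet :: "real mat \<Rightarrow> nat set \<Rightarrow> real" where
  "absdet A B = \<bar>det (submatrix A B UNIV)\<bar>"

definition Delta :: "real mat \<Rightarrow> real" where
  "Delta A = Max {absdet A B | B. B \<subseteq> {0..<dim_row A} \<and> card B = dim_col A}"

definition tight :: "real mat \<Rightarrow> real vec \<Rightarrow> real vec \<Rightarrow> nat set" where
  "tight A b v = {i. i < dim_row A \<and> row A i \<bullet> v = b $ i}"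

definition row_cone :: "real mat \<Rightarrow> nat set \<Rightarrow> real vec set" where
  "row_cone A I = {y \<in> carrier_vec (dim_col A). \<exists>lam::nat \<Rightarrow> real. (\<forall>i\<in>I. 0 \<le> lam i) \<and>
      (\<forall>j < dim_col A. y $ j = (\<Sum>i\<in>I. lam i * A $$ (i, j)))}"

definition normal_cone :: "real mat \<Rightarrow> real vec \<Rightarrow> real vec \<Rightarrow> real vec set" where
  "normal_cone A b v = row_cone A (tight A b v)"

definition cone_face :: "nat \<Rightarrow> real vec set \<Rightarrow> real vec set \<Rightarrow> bool" where
  "cone_face n C F \<longleftrightarrow> (\<exists>c \<in> carrier_vec n. (\<forall>y\<in>C. c \<bullet> y \<le> 0) \<and> F = {y \<in> C. c \<bullet> y = 0})"

text \<open>A triangulation of the normal fan: a set of n-element row index sets B, each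
 generating an n-dimensional simplicial cone inside the normal cone of some vertex,
 such that for every vertex these cones cover its normal cone, and such that the cones
 form a fan (pairwise intersections are common faces).\<close>
definition triangulation :: "real mat \<Rightarrow> real vec \<Rightarrow> nat set set \<Rightarrow> bool" where
  "triangulation A b T \<longleftrightarrow>
     (\<forall>B\<in>T. B \<subseteq> {0..<dim_row A} \<and> card B = dim_col A \<and>
         lin_indep_fam (dim_col A) (dim_col A) (row (submatrix A B UNIV)) \<and>
         (\<exists>v. is_vertex A b v \<and> B \<subseteq> tight A b v)) \<and>
     (\<forall>v. is_vertex A b v \<longrightarrow>
         \<Union>{row_cone A B | B. B \<in> T \<and> B \<subseteq> tight A b v} = normal_cone A b v) \<and>
     (\<forall>B\<in>T. \<forall>B'\<in>T.
         cone_face (dim_col A) (row_cone A B) (row_cone A B \<inter> row_cone A B') \<and>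
         cone_face (dim_col A) (row_cone A B') (row_cone A B \<inter> row_cone A B'))"

definition Delta_min :: "real mat \<Rightarrow> real vec \<Rightarrow> real" where
  "Delta_min A b = Max {Min (absdet A ` T) | T. triangulation A b T}"

end

theory Submission
  imports Defs "HOL-Computational_Algebra.Polynomial" "HOL-Library.FuncSet"
begin

text \<open>The proof is a discrete version of the shadow simplex argument. Objective functions are
  written in coordinates with respect to \<open>n\<close> rows of maximal determinant \<open>\<Delta>\<close>, so that every row
  has coordinates in \<open>[-1, 1]\<close>. By Cramer's rule a simplicial cone with determinant at least
  \<open>\<Delta>\<^sub>m\<^sub>i\<^sub>n\<close>, and hence every normal cone of a vertex, contains a unit ball of the maximum norm around
  some lattice point of norm at most \<open>H = O(n\<^sup>2 \<Delta> / \<Delta>\<^sub>m\<^sub>i\<^sub>n)\<close>. Take objectives \<open>h(u)\<close>, \<open>h(v)\<close> deep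
  inside the normal cones of \<open>u\<close> and \<open>v\<close>, perturb them by a random point of a grid in the cone of
  the coordinate rows, and follow the maximizing vertices along a path from the first to the second
  perturbed objective. A step of unit length crosses the boundary of a cone only if the current
  point lies within distance \<open>H\<close> of that boundary in the direction of its centre; as the cones are
  closed under addition of their centres, the expected number of crossings telescopes to a count
  of lattice points near the boundary of the grid box. Summed over the path this gives
  \<open>O(n H ln H)\<close> visited cones. The vertices visited on the way induce a connected subgraph, because the
  vertices maximizing a fixed objective do.\<close>

section \<open>Linear algebra\<close>

text \<open>Two obstacles shape the proof. \<open>Delta_min\<close> is a maximum over
  triangulations, hence says nothing until one is known to exist; for degenerate vertices this takes
  a generic lifting. What it then yields is one simplicial subcone per vertex with determinant at
  least \<open>Delta_min A b\<close>. The second obstacle is unboundedness: a vertex that is best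
  among the vertices need not maximize over the polyhedron. Therefore every objective on the path is
  a nonnegative combination of two centres and of coordinate rows, each of them bounded on the
  polyhedron; this is why the perturbation stays in the cone of the coordinate rows. Averaging over
  a finite grid replaces integration: geometry enters only through translations by lattice vectors,
  and one generic shift of the grid removes all ties. The box has side \<open>M = 2 * n * H\<close>,
  so that enlarging it by \<open>H\<close> on every side multiplies the number of lattice points by
  at most \<open>(1 + 1 / n) ^ n \<le> 3\<close>, which leaves three crossings per step on average.
  In \<open>H\<close>, one factor \<open>n\<close> is the size of a sum of \<open>n\<close> rows in
  the chosen coordinates, the other the loss in Cramer's rule.\<close>

lemma det_replace_row:
  fixes y :: "real vec"
  assumes k: "k < n"
  shows "det (mat\<^sub>r n n (c(k := y))) = (\<Sum>j<n. y $ j * cofactor (mat\<^sub>r n n c) k j)"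
proof -
  have "det (mat\<^sub>r n n (c(k := y))) =
      (\<Sum>j<n. mat\<^sub>r n n (c(k := y)) $$ (k, j) * cofactor (mat\<^sub>r n n (c(k := y))) k j)"
    by (rule laplace_expansion_row[OF _ k]) simp
  also have "\<dots> = (\<Sum>j<n. y $ j * cofactor (mat\<^sub>r n n c) k j)"
  proof (rule sum.cong[OF refl])
    fix j assume j: "j \<in> {..<n}"
    have "mat_delete (mat\<^sub>r n n (c(k := y))) k j = mat_delete (mat\<^sub>r n n c) k j"
      by (rule eq_matI) (auto simp: mat_delete_def)
    then show "mat\<^sub>r n n (c(k := y)) $$ (k, j) * cofactor (mat\<^sub>r n n (c(k := y))) k j
        = y $ j * cofactor (mat\<^sub>r n n c) k j"
      using j k by (simp add: cofactor_def)
  qed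
  finally show ?thesis .
qed

text \<open>Linearity in one row turns bounds for determinants of rows of a matrix into bounds for
  arbitrary combinations of these rows.\<close>

lemma det_replace_row_sum:
  fixes y :: "real vec"
  assumes k: "k < n" and y: "\<And>j. j < n \<Longrightarrow> y $ j = (\<Sum>r\<in>R. g r * w r $ j)"
  shows "det (mat\<^sub>r n n (c(k := y))) = (\<Sum>r\<in>R. g r * det (mat\<^sub>r n n (c(k := w r))))"
proof -
  have "det (mat\<^sub>r n n (c(k := y))) =
      (\<Sum>j<n. \<Sum>r\<in>R. g r * (w r $ j * cofactor (mat\<^sub>r n n c) k j))"
    unfolding det_replace_row[OF k]
    by (rule sum.cong) (simp_all add: y sum_distrib_right mult.assoc)
  also have "\<dots> = (\<Sum>r\<in>R. \<Sum>j<n. g r * (w r $ j * cofactor (mat\<^sub>r n n c) k j))"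
    by (rule sum.swap)
  finally show ?thesis
    by (simp add: det_replace_row[OF k] sum_distrib_left)
qed

lemma det_replace_row_combination:
  fixes y :: "real vec"
  assumes k: "k < n" and y: "\<And>j. j < n \<Longrightarrow> y $ j = (\<Sum>r<n. \<mu> r * c r $ j)"
  shows "det (mat\<^sub>r n n (c(k := y))) = \<mu> k * det (mat\<^sub>r n n c)"
proof -
  have "det (mat\<^sub>r n n (c(k := c r))) = (if r = k then det (mat\<^sub>r n n c) else 0)" if r: "r < n" for r
  proof (cases "r = k")
    case False
    have "det (mat\<^sub>r n n (c(k := c r))) = 0"
      by (rule det_identical_rows[OF _ False r k]) (use r k False in \<open>auto intro!: eq_vecI\<close>)
    then show ?thesis using False by simp
  qed simp
  then have "(\<Sum>r<n. \<mu> r * det (mat\<^sub>r n n (c(k := c r)))) =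
      (\<Sum>r<n. \<mu> r * (if r = k then det (mat\<^sub>r n n c) else 0))"
    by (intro sum.cong) auto
  then have "det (mat\<^sub>r n n (c(k := y))) = (\<Sum>r<n. \<mu> r * (if r = k then det (mat\<^sub>r n n c) else 0))"
    using det_replace_row_sum[OF k, where c = c and w = c and R = "{..<n}", OF y] by simp
  then show ?thesis using k by (simp add: if_distrib cong: if_cong)
qed

text \<open>Expanding the replaced row by cofactors reduces the claim to the adjugate identity. The
  product form lets determinants with one row replaced control the coefficients directly.\<close>

lemma cramer_rows:
  fixes y :: "real vec"
  assumes d: "det (mat\<^sub>r n n c) \<noteq> 0"
  shows "\<exists>\<mu>. (\<forall>j<n. y $ j = (\<Sum>r<n. \<mu> r * c r $ j)) \<and>
    (\<forall>r<n. \<mu> r * det (mat\<^sub>r n n c) = det (mat\<^sub>r n n (c(r := y))))"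
proof -
  let ?M = "mat\<^sub>r n n c"
  define \<mu> where "\<mu> = (\<lambda>r. det (mat\<^sub>r n n (c(r := y))) / det ?M)"
  have "y $ j = (\<Sum>r<n. \<mu> r * c r $ j)" if j: "j < n" for j
  proof -
    have e: "(\<Sum>r<n. cofactor ?M r k * c r $ j) = (if k = j then det ?M else 0)" if k: "k < n" for k
    proof -
      have "(adj_mat ?M * ?M) $$ (k, j) = (det ?M \<cdot>\<^sub>m 1\<^sub>m n) $$ (k, j)"
        by (simp add: adj_mat(3)[of _ n])
      moreover have "(adj_mat ?M * ?M) $$ (k, j) = (\<Sum>r<n. cofactor ?M r k * c r $ j)"
        using j k by (simp add: adj_mat_def scalar_prod_def lessThan_atLeast0)
      ultimately show ?thesis using j k by auto
    qed
    have "(\<Sum>r<n. \<mu> r * c r $ j) = (\<Sum>r<n. \<Sum>k<n. y $ k * (cofactor ?M r k * c r $ j)) / det ?M"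
      unfolding sum_divide_distrib
      by (rule sum.cong) (simp_all add: \<mu>_def det_replace_row sum_distrib_right sum_divide_distrib mult.assoc)
    also have "\<dots> = (\<Sum>k<n. y $ k * (\<Sum>r<n. cofactor ?M r k * c r $ j)) / det ?M"
      by (subst sum.swap) (simp add: sum_distrib_left)
    also have "\<dots> = (\<Sum>k<n. y $ k * (if k = j then det ?M else 0)) / det ?M"
      using e by (intro arg_cong[where f = "\<lambda>x. x / _"] sum.cong) auto
    also have "\<dots> = y $ j" using j d by (simp add: if_distrib cong: if_cong)
    finally show ?thesis by simp
  qed
  moreover have "\<mu> r * det ?M = det (mat\<^sub>r n n (c(r := y)))" for r
    using d by (simp add: \<mu>_def)
  ultimately show ?thesis by blast
qed

lemma det_rows_eq_0_iff:
  fixes c :: "nat \<Rightarrow> real vec"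
  assumes c: "\<And>r. r < n \<Longrightarrow> c r \<in> carrier_vec n"
  shows "det (mat\<^sub>r n n c) = 0 \<longleftrightarrow> (\<exists>x\<in>carrier_vec n. x \<noteq> 0\<^sub>v n \<and> (\<forall>r<n. c r \<bullet> x = 0))"
proof -
  have "mat\<^sub>r n n c *\<^sub>v x = 0\<^sub>v n \<longleftrightarrow> (\<forall>r<n. c r \<bullet> x = 0)" if x: "x \<in> carrier_vec n" for x
  proof -
    have "(mat\<^sub>r n n c *\<^sub>v x) $ r = c r \<bullet> x" if "r < n" for r
      using that c[OF that] x by (simp add: scalar_prod_def)
    then show ?thesis by (auto simp: vec_eq_iff)
  qed
  then show ?thesis using det_0_iff_vec_prod_zero[of "mat\<^sub>r n n c" n] by auto
qed

text \<open>Missing equations are filled up with zero rows; since \<open>card S < n\<close>, row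
  \<open>card S\<close> is one of them, and the square matrix is singular.\<close>

lemma underdetermined_kernel:
  fixes a :: "nat \<Rightarrow> real vec"
  assumes S: "finite S" "card S < n" and a: "\<And>i. i \<in> S \<Longrightarrow> a i \<in> carrier_vec n"
  obtains x where "x \<in> carrier_vec n" "x \<noteq> 0\<^sub>v n" "\<And>i. i \<in> S \<Longrightarrow> a i \<bullet> x = 0"
proof -
  obtain f where f: "bij_betw f {0..<card S} S" using ex_bij_betw_nat_finite[OF S(1)] by auto
  define c where "c = (\<lambda>r. if r < card S then a (f r) else 0\<^sub>v n)"
  have fS: "f r \<in> S" if "r < card S" for r using f that by (auto simp: bij_betw_def)
  have "det (mat\<^sub>r n n (c(card S := 0\<^sub>v n))) = 0"
    using S(2) by (simp add: det_replace_row)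
  moreover have "c(card S := 0\<^sub>v n) = c" by (auto simp: c_def)
  ultimately have "det (mat\<^sub>r n n c) = 0" by simp
  moreover have "c r \<in> carrier_vec n" for r using fS a by (simp add: c_def)
  ultimately obtain x where x: "x \<in> carrier_vec n" "x \<noteq> 0\<^sub>v n" "\<forall>r<n. c r \<bullet> x = 0"
    using det_rows_eq_0_iff by blast
  have "a i \<bullet> x = 0" if "i \<in> S" for i
  proof -
    have "i \<in> f ` {0..<card S}" using f that by (simp add: bij_betw_def)
    then obtain r where "r < card S" "f r = i" by auto
    then show ?thesis using x(3) S(2) by (auto simp: c_def dest: spec[of _ r])
  qed
  with x that show ?thesis by blast
qed

text \<open>The kernel lemma for the transpose: one equation per coordinate, one unknown per index
  in \<open>J\<close>.\<close>

lemma too_many_vectors_dependent: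
  fixes a :: "nat \<Rightarrow> real vec"
  assumes J: "finite J" "card J = Suc n"
  obtains \<mu> i where "i \<in> J" "\<mu> i \<noteq> (0::real)" "\<And>j. j < n \<Longrightarrow> (\<Sum>i\<in>J. \<mu> i * a i $ j) = 0"
proof -
  obtain f where f: "bij_betw f {0..<Suc n} J" using ex_bij_betw_nat_finite[OF J(1)] J(2) by auto
  obtain x where x: "x \<in> carrier_vec (Suc n)" "x \<noteq> 0\<^sub>v (Suc n)"
      "\<And>j. j \<in> {..<n} \<Longrightarrow> vec (Suc n) (\<lambda>k. a (f k) $ j) \<bullet> x = 0"
    by (rule underdetermined_kernel[of "{..<n}" "Suc n" "\<lambda>j. vec (Suc n) (\<lambda>k. a (f k) $ j)"]) auto
  define g where "g = the_inv_into {0..<Suc n} f"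
  have gf: "g (f k) = k" if "k < Suc n" for k
    unfolding g_def using f that by (intro the_inv_into_f_f) (auto simp: bij_betw_def)
  obtain k where k: "k < Suc n" "x $ k \<noteq> 0" using x(1,2) by (auto simp: vec_eq_iff)
  have "(\<Sum>i\<in>J. x $ g i * a i $ j) = 0" if "j < n" for j
  proof -
    have "(\<Sum>i\<in>J. x $ g i * a i $ j) = (\<Sum>k\<in>{0..<Suc n}. x $ g (f k) * a (f k) $ j)"
      using sum.reindex_bij_betw[OF f, of "\<lambda>i. x $ g i * a i $ j"] by simp
    also have "\<dots> = (\<Sum>k\<in>{0..<Suc n}. a (f k) $ j * x $ k)"
      by (rule sum.cong) (simp_all add: gf mult.commute)
    also have "\<dots> = vec (Suc n) (\<lambda>k. a (f k) $ j) \<bullet> x"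
      using x(1) by (simp add: scalar_prod_def)
    finally show ?thesis using x(3) that by simp
  qed
  moreover have "f k \<in> J" "x $ g (f k) \<noteq> 0" using f k gf by (auto simp: bij_betw_def)
  ultimately show ?thesis using that[of "f k" "\<lambda>i. x $ g i"] by blast
qed

section \<open>Row index sets and subdeterminants\<close>

lemma bij_betw_pick:
  assumes "finite B" "card B = n"
  shows "bij_betw (pick B) {..<n} B"
proof -
  have inj: "inj_on (pick B) {..<n}"
  proof (rule inj_onI)
    fix r s assume "r \<in> {..<n}" "s \<in> {..<n}" "pick B r = pick B s"
    then show "r = s" using pick_mono[of s B r] pick_mono[of r B s] assms by (metis lessThan_iff nat_neq_iff)
  qed
  moreover have "pick B ` {..<n} \<subseteq> B" using pick_in_set assms by auto
  moreover have "card (pick B ` {..<n}) = card B" using card_image[OF inj] assms by simp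
  ultimately show ?thesis unfolding bij_betw_def using card_subset_eq[OF assms(1)] by blast
qed

lemma submatrix_rows:
  assumes "B \<subseteq> {0..<dim_row A}" "card B = dim_col A"
  shows "submatrix A B UNIV = mat\<^sub>r (dim_col A) (dim_col A) (\<lambda>r. row A (pick B r))"
proof -
  have B: "{i. i < dim_row A \<and> i \<in> B} = B" using assms(1) by auto
  have p: "pick B r < dim_row A" if "r < dim_col A" for r
    using bij_betwE[OF bij_betw_pick[of B "dim_col A"]] assms that finite_subset[OF assms(1)]
    by (metis atLeastLessThan_iff finite_atLeastLessThan lessThan_iff subsetD)
  show ?thesis
    by (rule eq_matI) (auto simp: submatrix_def B assms(2) pick_UNIV p)
qed

text \<open>A change of order is a permutation and costs only a sign, so the increasing order
  imposed by \<open>pick\<close> can be forgotten.\<close>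

lemma absdet_eq_rows:
  fixes A :: "real mat"
  defines "n \<equiv> dim_col A"
  assumes f: "bij_betw f {..<n} B" and B: "B \<subseteq> {0..<dim_row A}"
  shows "absdet A B = \<bar>det (mat\<^sub>r n n (\<lambda>r. row A (f r)))\<bar>"
proof -
  have fB: "finite B" "card B = n" using f finite_subset[OF B] by (auto dest: bij_betw_same_card)
  note p = bij_betw_pick[OF fB]
  define q where "q = (\<lambda>r. if r < n then the_inv_into {..<n} (pick B) (f r) else r)"
  have pq: "pick B (q r) = f r" if "r < n" for r
    using that p f f_the_inv_into_f_bij_betw[OF p, of "f r"] by (auto simp: q_def bij_betw_def)
  have "bij_betw (the_inv_into {..<n} (pick B) \<circ> f) {..<n} {..<n}"
    by (rule bij_betw_trans[OF f bij_betw_the_inv_into[OF p]])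
  then have "bij_betw q {..<n} {..<n}" by (rule bij_betw_cong[THEN iffD1, rotated]) (simp add: q_def)
  then have perm: "q permutes {0..<n}" unfolding lessThan_atLeast0
    by (rule bij_imp_permutes) (simp add: q_def)
  have qn: "q r < n" if "r < n" for r using permutes_in_image[OF perm, of r] that by simp
  let ?M = "mat\<^sub>r n n (\<lambda>r. row A (pick B r))"
  have "mat\<^sub>r n n (\<lambda>r. row A (f r)) = mat n n (\<lambda>(i,j). ?M $$ (q i, j))"
    by (rule eq_matI) (auto simp: qn pq)
  then have "det (mat\<^sub>r n n (\<lambda>r. row A (f r))) = signof q * det ?M"
    using det_permute_rows[of ?M n q] perm by simp
  then have "\<bar>det (mat\<^sub>r n n (\<lambda>r. row A (f r)))\<bar> = \<bar>det ?M\<bar>"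
    by (simp add: abs_mult sign_def)
  then show ?thesis using submatrix_rows[OF B] fB by (simp add: absdet_def n_def)
qed

lemma absdet_le_Delta:
  assumes "B \<subseteq> {0..<dim_row A}" "card B = dim_col A"
  shows "absdet A B \<le> Delta A"
proof -
  have "finite ((\<lambda>B. absdet A B) ` Pow {0..<dim_row A})" by simp
  then have "finite {absdet A B | B. B \<subseteq> {0..<dim_row A} \<and> card B = dim_col A}"
    by (rule rev_finite_subset) auto
  then show ?thesis unfolding Delta_def using assms by (intro Max_ge) auto
qed

text \<open>Cramer's rule may insert a row that is already present; the determinant is then zero,
  which is why \<open>f\<close> need not be injective and why \<open>0 \<le> Delta A\<close> is
  assumed.\<close>

lemma det_rows_le_Delta:
  fixes A :: "real mat"
  defines "n \<equiv> dim_col A"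
  assumes f: "\<And>r. r < n \<Longrightarrow> f r < dim_row A" and D: "0 \<le> Delta A"
  shows "\<bar>det (mat\<^sub>r n n (\<lambda>r. row A (f r)))\<bar> \<le> Delta A"
proof (cases "inj_on f {..<n}")
  case True
  then have b: "bij_betw f {..<n} (f ` {..<n})" by (simp add: inj_on_imp_bij_betw)
  have B: "f ` {..<n} \<subseteq> {0..<dim_row A}" using f by auto
  have "card (f ` {..<n}) = dim_col A" using True by (simp add: card_image n_def)
  then show ?thesis
    using absdet_eq_rows[OF b[unfolded n_def]] B absdet_le_Delta[OF B] by (simp add: n_def)
next
  case False
  then obtain r s where "r < n" "s < n" "r \<noteq> s" "f r = f s" by (auto simp: inj_on_def)
  then have "det (mat\<^sub>r n n (\<lambda>r. row A (f r))) = 0"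
    by (intro det_identical_rows[of _ n r s]) (auto intro!: eq_vecI)
  then show ?thesis using D by simp
qed

section \<open>Systems of inequalities\<close>

lemma scalar_prod_line:
  fixes z :: "real vec"
  assumes "z \<in> carrier_vec n" "x \<in> carrier_vec n" "e \<in> carrier_vec n"
  shows "z \<bullet> (x + t \<cdot>\<^sub>v e) = z \<bullet> x + t * (z \<bullet> e)"
  using assms by (simp add: scalar_prod_add_distrib[of _ n])

text \<open>Independent of a matrix because three systems occur: the polyhedron, the cone of
  feasible directions at a vertex (right-hand side 0), and the tight rows at a vertex with a lifting
  as right-hand side.\<close>

definition halfspaces :: "nat \<Rightarrow> (nat \<Rightarrow> real vec) \<Rightarrow> nat set \<Rightarrow> (nat \<Rightarrow> real) \<Rightarrow> real vec set" where
  "halfspaces n a I \<beta> = {x \<in> carrier_vec n. \<forall>i\<in>I. a i \<bullet> x \<le> \<beta> i}"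

definition tight_set :: "(nat \<Rightarrow> real vec) \<Rightarrow> nat set \<Rightarrow> (nat \<Rightarrow> real) \<Rightarrow> real vec \<Rightarrow> nat set" where
  "tight_set a I \<beta> x = {i \<in> I. a i \<bullet> x = \<beta> i}"

definition trivial_kernel :: "nat \<Rightarrow> (nat \<Rightarrow> real vec) \<Rightarrow> nat set \<Rightarrow> bool" where
  "trivial_kernel n a J \<longleftrightarrow> (\<forall>e\<in>carrier_vec n. (\<forall>i\<in>J. a i \<bullet> e = 0) \<longrightarrow> e = 0\<^sub>v n)"

text \<open>The algebraic form of a vertex. Asking for a trivial kernel instead of a basis leaves
  room for degenerate vertices.\<close>

definition basic_point :: "nat \<Rightarrow> (nat \<Rightarrow> real vec) \<Rightarrow> nat set \<Rightarrow> (nat \<Rightarrow> real) \<Rightarrow> real vec \<Rightarrow> bool" where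
  "basic_point n a I \<beta> x \<longleftrightarrow> x \<in> halfspaces n a I \<beta> \<and> trivial_kernel n a (tight_set a I \<beta> x)"

definition maximizer :: "real vec set \<Rightarrow> real vec \<Rightarrow> real vec \<Rightarrow> bool" where
  "maximizer Q y v \<longleftrightarrow> v \<in> Q \<and> (\<forall>x\<in>Q. y \<bullet> x \<le> y \<bullet> v)"

definition edge :: "nat \<Rightarrow> real vec set \<Rightarrow> real vec \<Rightarrow> real vec \<Rightarrow> bool" where
  "edge n Q v w \<longleftrightarrow> v \<noteq> w \<and> (\<exists>c\<in>carrier_vec n. \<exists>\<delta>.
     (\<forall>x\<in>Q. c \<bullet> x \<le> \<delta>) \<and> segment_vec v w = {x \<in> Q. c \<bullet> x = \<delta>})"

lemma halfspaces_carrier: "x \<in> halfspaces n a I \<beta> \<Longrightarrow> x \<in> carrier_vec n"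
  by (simp add: halfspaces_def)

lemma trivial_kernelD:
  "trivial_kernel n a J \<Longrightarrow> e \<in> carrier_vec n \<Longrightarrow> (\<And>i. i \<in> J \<Longrightarrow> a i \<bullet> e = 0) \<Longrightarrow> e = 0\<^sub>v n"
  by (auto simp: trivial_kernel_def)

lemma smult_vec_eq_0_iff: "e \<in> carrier_vec n \<Longrightarrow> s \<cdot>\<^sub>v e = 0\<^sub>v n \<longleftrightarrow> s = (0::real) \<or> e = 0\<^sub>v n"
  by (auto simp: vec_eq_iff)

text \<open>The ratio test of the simplex method: the step is the least ratio of slack to growth
  among the rows growing along \<open>e\<close>, and is positive because tight rows do not
  grow.\<close>

lemma blocking_constraint:
  assumes fin: "finite I" and a: "\<And>i. i \<in> I \<Longrightarrow> a i \<in> carrier_vec n"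
    and x: "x \<in> halfspaces n a I \<beta>" and e: "e \<in> carrier_vec n"
    and dir: "\<And>i. i \<in> tight_set a I \<beta> x \<Longrightarrow> a i \<bullet> e \<le> 0"
    and k: "k \<in> I" "a k \<bullet> e > 0"
  obtains t j where "t > 0" "x + t \<cdot>\<^sub>v e \<in> halfspaces n a I \<beta>" "j \<in> I" "a j \<bullet> e > 0"
    "a j \<bullet> (x + t \<cdot>\<^sub>v e) = \<beta> j"
proof -
  define J where "J = {i \<in> I. a i \<bullet> e > 0}"
  define r where "r = (\<lambda>i. (\<beta> i - a i \<bullet> x) / (a i \<bullet> e))"
  have J: "finite (r ` J)" "r ` J \<noteq> {}" using fin k by (auto simp: J_def)
  define t where "t = Min (r ` J)"
  have xc: "x \<in> carrier_vec n" using x by (rule halfspaces_carrier)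
  have line: "a i \<bullet> (x + t \<cdot>\<^sub>v e) = a i \<bullet> x + t * (a i \<bullet> e)" if "i \<in> I" for i
    using scalar_prod_line a that xc e by blast
  have xI: "a i \<bullet> x \<le> \<beta> i" if "i \<in> I" for i using x that by (auto simp: halfspaces_def)
  have pos: "r i > 0" if "i \<in> J" for i
  proof -
    have "i \<notin> tight_set a I \<beta> x" using dir[of i] that by (auto simp: J_def)
    then have "a i \<bullet> x < \<beta> i" using xI[of i] that by (auto simp: J_def tight_set_def less_le)
    then show ?thesis using that by (simp add: r_def J_def)
  qed
  obtain j where j: "j \<in> J" "r j = t" using Min_in[OF J] by (auto simp: t_def)
  have t0: "t > 0" using pos j by auto
  have "a i \<bullet> x + t * (a i \<bullet> e) \<le> \<beta> i" if i: "i \<in> I" for i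
  proof (cases "i \<in> J")
    case True
    then have "t \<le> r i" using J by (auto simp: t_def)
    then have "t * (a i \<bullet> e) \<le> \<beta> i - a i \<bullet> x" using True by (simp add: r_def J_def pos_le_divide_eq)
    then show ?thesis by simp
  next
    case False
    then have "t * (a i \<bullet> e) \<le> 0" using t0 i by (simp add: J_def mult_le_0_iff)
    then show ?thesis using xI[OF i] by linarith
  qed
  then have "x + t \<cdot>\<^sub>v e \<in> halfspaces n a I \<beta>" using xc e line by (auto simp: halfspaces_def)
  moreover have "a j \<bullet> (x + t \<cdot>\<^sub>v e) = \<beta> j"
    using line[of j] j by (auto simp: J_def r_def)
  ultimately show ?thesis using that[of t j] t0 j by (auto simp: J_def)
qed

lemma small_step:
  assumes fin: "finite I" and a: "\<And>i. i \<in> I \<Longrightarrow> a i \<in> carrier_vec n"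
    and x: "x \<in> halfspaces n a I \<beta>" and e: "e \<in> carrier_vec n"
    and dir: "\<And>i. i \<in> tight_set a I \<beta> x \<Longrightarrow> a i \<bullet> e \<le> 0"
  obtains t where "t > 0" "x + t \<cdot>\<^sub>v e \<in> halfspaces n a I \<beta>"
proof (cases "\<exists>k\<in>I. a k \<bullet> e > 0")
  case True
  then show ?thesis using blocking_constraint[OF fin a x e dir] that by metis
next
  case False
  have xc: "x \<in> carrier_vec n" using x by (rule halfspaces_carrier)
  have "a i \<bullet> (x + 1 \<cdot>\<^sub>v e) \<le> \<beta> i" if i: "i \<in> I" for i
  proof -
    have "a i \<bullet> x \<le> \<beta> i" using x i by (auto simp: halfspaces_def)
    moreover have "a i \<bullet> e \<le> 0" using False i by force
    ultimately show ?thesis using scalar_prod_line[OF a[OF i] xc e, of 1] by simp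
  qed
  then have "x + 1 \<cdot>\<^sub>v e \<in> halfspaces n a I \<beta>" using xc e by (auto simp: halfspaces_def)
  then show ?thesis using that[of 1] by simp
qed

lemma unbounded_along_recession_direction:
  assumes a: "\<And>i. i \<in> I \<Longrightarrow> a i \<in> carrier_vec n"
    and x: "x \<in> halfspaces n a I \<beta>" and e: "e \<in> carrier_vec n"
    and rec: "\<And>i. i \<in> I \<Longrightarrow> a i \<bullet> e \<le> 0"
    and y: "y \<in> carrier_vec n" and bd: "\<And>z. z \<in> halfspaces n a I \<beta> \<Longrightarrow> y \<bullet> z \<le> C"
  shows "y \<bullet> e \<le> 0"
proof (rule ccontr)
  assume "\<not> y \<bullet> e \<le> 0"
  then have pos: "y \<bullet> e > 0" by simp
  have xc: "x \<in> carrier_vec n" using x by (rule halfspaces_carrier)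
  \<comment> \<open>With this step the objective would reach \<open>C + y \<bullet> e\<close>,
    beyond its bound.\<close>
  define t where "t = (C - y \<bullet> x) / (y \<bullet> e) + 1"
  have t0: "t \<ge> 0" using bd[OF x] pos by (simp add: t_def)
  have "a i \<bullet> (x + t \<cdot>\<^sub>v e) \<le> \<beta> i" if i: "i \<in> I" for i
  proof -
    have "a i \<bullet> x \<le> \<beta> i" using x i by (auto simp: halfspaces_def)
    moreover have "t * (a i \<bullet> e) \<le> 0" using t0 rec[OF i] by (simp add: mult_le_0_iff)
    ultimately show ?thesis using scalar_prod_line[OF a[OF i] xc e, of t] by simp
  qed
  then have "y \<bullet> (x + t \<cdot>\<^sub>v e) \<le> C" using xc e by (intro bd) (auto simp: halfspaces_def)
  moreover have "y \<bullet> (x + t \<cdot>\<^sub>v e) = y \<bullet> x + t * (y \<bullet> e)" by (rule scalar_prod_line[OF y xc e])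
  moreover have "t * (y \<bullet> e) = C - y \<bullet> x + y \<bullet> e" using pos by (simp add: t_def field_simps)
  ultimately show False using pos by linarith
qed

text \<open>While the tight rows leave a free direction, moving along it without loss in
  \<open>y\<close> makes another row tight; the induction is on the number of slack rows.\<close>

lemma exists_better_basic_point:
  assumes fin: "finite I" and a: "\<And>i. i \<in> I \<Longrightarrow> a i \<in> carrier_vec n" and full: "trivial_kernel n a I"
    and y: "y \<in> carrier_vec n" and bd: "\<And>z. z \<in> halfspaces n a I \<beta> \<Longrightarrow> y \<bullet> z \<le> C"
    and x: "x \<in> halfspaces n a I \<beta>"
  shows "\<exists>w. basic_point n a I \<beta> w \<and> y \<bullet> x \<le> y \<bullet> w"
  using x
proof (induction "card I - card (tight_set a I \<beta> x)" arbitrary: x rule: less_induct)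
  case less
  note x = less.prems
  have xc: "x \<in> carrier_vec n" using x by (rule halfspaces_carrier)
  show ?case
  proof (cases "trivial_kernel n a (tight_set a I \<beta> x)")
    case True
    then show ?thesis using x by (auto simp: basic_point_def)
  next
    case False
    then obtain e0 where e0: "e0 \<in> carrier_vec n" "e0 \<noteq> 0\<^sub>v n" "\<forall>i\<in>tight_set a I \<beta> x. a i \<bullet> e0 = 0"
      by (auto simp: trivial_kernel_def)
    obtain e where e: "e \<in> carrier_vec n" "e \<noteq> 0\<^sub>v n" "\<forall>i\<in>tight_set a I \<beta> x. a i \<bullet> e = 0" "y \<bullet> e \<ge> 0"
    proof (cases "y \<bullet> e0 \<ge> 0")
      case True
      then show ?thesis using that e0 by blast
    next
      case False
      have ca: "a i \<in> carrier_vec n" if "i \<in> tight_set a I \<beta> x" for i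
        using a that by (auto simp: tight_set_def)
      show ?thesis
        using e0 False y by (intro that[of "(-1) \<cdot>\<^sub>v e0"]) (auto simp: smult_vec_eq_0_iff ca)
    qed
    \<comment> \<open>If no row stops \<open>e\<close>, boundedness of \<open>y\<close> forces
      \<open>y \<bullet> e \<le> 0\<close>. The opposite direction then loses nothing either, and
      some row stops it because all rows together have trivial kernel.\<close>
    have "\<exists>e\<in>carrier_vec n. (\<forall>i\<in>tight_set a I \<beta> x. a i \<bullet> e = 0) \<and> y \<bullet> e \<ge> 0 \<and> (\<exists>k\<in>I. a k \<bullet> e > 0)"
    proof (cases "\<exists>k\<in>I. a k \<bullet> e > 0")
      case True
      then show ?thesis using e by blast
    next
      case False
      then have le: "a i \<bullet> e \<le> 0" if "i \<in> I" for i using that by force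
      have "y \<bullet> e \<le> 0" by (rule unbounded_along_recession_direction[OF a x e(1) le y bd])
      obtain k where k: "k \<in> I" "a k \<bullet> e \<noteq> 0" using trivial_kernelD[OF full e(1)] e(2) by blast
      have "a k \<bullet> ((-1) \<cdot>\<^sub>v e) > 0" using k le[of k] a e(1) by simp
      moreover have "a i \<bullet> ((-1) \<cdot>\<^sub>v e) = 0" if "i \<in> tight_set a I \<beta> x" for i
        using that e a[of i] by (simp add: tight_set_def)
      ultimately show ?thesis using e(1) k(1) \<open>y \<bullet> e \<le> 0\<close> y
        by (intro bexI[of _ "(-1) \<cdot>\<^sub>v e"]) auto
    qed
    then obtain e k where e: "e \<in> carrier_vec n" "\<And>i. i \<in> tight_set a I \<beta> x \<Longrightarrow> a i \<bullet> e = 0" "y \<bullet> e \<ge> 0"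
      and k: "k \<in> I" "a k \<bullet> e > 0" by blast
    obtain t j where t: "t > 0" "x + t \<cdot>\<^sub>v e \<in> halfspaces n a I \<beta>" "j \<in> I" "a j \<bullet> e > 0"
      "a j \<bullet> (x + t \<cdot>\<^sub>v e) = \<beta> j"
      using blocking_constraint[OF fin a x e(1) _ k] e(2) by (metis order_refl)
    let ?x = "x + t \<cdot>\<^sub>v e"
    have "tight_set a I \<beta> x \<subset> tight_set a I \<beta> ?x"
    proof -
      have "i \<in> tight_set a I \<beta> ?x" if "i \<in> tight_set a I \<beta> x" for i
        using that e(2)[OF that] scalar_prod_line[OF a xc e(1), of i t] by (auto simp: tight_set_def)
      moreover have "j \<in> tight_set a I \<beta> ?x" "j \<notin> tight_set a I \<beta> x"
        using t e(2) by (auto simp: tight_set_def)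
      ultimately show ?thesis by blast
    qed
    moreover have "tight_set a I \<beta> ?x \<subseteq> I" by (auto simp: tight_set_def)
    ultimately have "card (tight_set a I \<beta> x) < card (tight_set a I \<beta> ?x)" "card (tight_set a I \<beta> ?x) \<le> card I"
      using fin by (auto intro!: psubset_card_mono card_mono intro: finite_subset)
    then have "card I - card (tight_set a I \<beta> ?x) < card I - card (tight_set a I \<beta> x)" by linarith
    from less.hyps[OF this t(2)] obtain w where w: "basic_point n a I \<beta> w" "y \<bullet> ?x \<le> y \<bullet> w" by blast
    have "y \<bullet> x \<le> y \<bullet> ?x" using scalar_prod_line[OF y xc e(1), of t] t(1) e(3) by simp
    then show ?thesis using w by (intro exI[of _ w]) auto
  qed
qed

lemma basic_point_eqI:
  assumes a: "\<And>i. i \<in> I \<Longrightarrow> a i \<in> carrier_vec n"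
    and v: "basic_point n a I \<beta> v" and x: "x \<in> carrier_vec n"
    and eq: "\<And>i. i \<in> tight_set a I \<beta> v \<Longrightarrow> a i \<bullet> x = \<beta> i"
  shows "x = v"
proof -
  have vc: "v \<in> carrier_vec n" using v by (auto simp: basic_point_def dest: halfspaces_carrier)
  have "x - v = 0\<^sub>v n"
  proof (rule trivial_kernelD)
    show "trivial_kernel n a (tight_set a I \<beta> v)" using v by (simp add: basic_point_def)
    show "x - v \<in> carrier_vec n" using x vc by simp
    show "a i \<bullet> (x - v) = 0" if "i \<in> tight_set a I \<beta> v" for i
      using that eq[OF that] a[of i] x vc
      by (auto simp: scalar_prod_minus_distrib[of _ n] tight_set_def)
  qed
  then show ?thesis using x vc by (auto simp: vec_eq_iff)
qed

text \<open>A basic point is the only solution of its tight equations, so its tight set identifies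
  it.\<close>

lemma finite_basic_points:
  assumes "finite I" and a: "\<And>i. i \<in> I \<Longrightarrow> a i \<in> carrier_vec n"
  shows "finite {v. basic_point n a I \<beta> v}"
proof (rule inj_on_finite[where f = "tight_set a I \<beta>"])
  show "inj_on (tight_set a I \<beta>) {v. basic_point n a I \<beta> v}"
  proof (rule inj_onI)
    fix v w assume "v \<in> {v. basic_point n a I \<beta> v}" "w \<in> {v. basic_point n a I \<beta> v}"
      and eq: "tight_set a I \<beta> v = tight_set a I \<beta> w"
    then have vw: "basic_point n a I \<beta> v" "basic_point n a I \<beta> w" by auto
    show "v = w"
      by (rule basic_point_eqI[OF a vw(2)]) 
        (use vw eq in \<open>auto simp: basic_point_def halfspaces_carrier tight_set_def\<close>)
  qed
  show "tight_set a I \<beta> ` {v. basic_point n a I \<beta> v} \<subseteq> Pow I" by (auto simp: tight_set_def)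
qed (use assms in simp)

lemma exists_basic_maximizer:
  assumes fin: "finite I" and a: "\<And>i. i \<in> I \<Longrightarrow> a i \<in> carrier_vec n" and full: "trivial_kernel n a I"
    and y: "y \<in> carrier_vec n" and bd: "\<And>z. z \<in> halfspaces n a I \<beta> \<Longrightarrow> y \<bullet> z \<le> C"
    and ne: "halfspaces n a I \<beta> \<noteq> {}"
  shows "\<exists>w. basic_point n a I \<beta> w \<and> maximizer (halfspaces n a I \<beta>) y w"
proof -
  let ?E = "{v. basic_point n a I \<beta> v}"
  have better: "\<exists>w. basic_point n a I \<beta> w \<and> y \<bullet> x \<le> y \<bullet> w" if "x \<in> halfspaces n a I \<beta>" for x
    by (rule exists_better_basic_point[OF fin a full y bd that])
  have fE: "finite ((\<bullet>) y ` ?E)" by (intro finite_imageI finite_basic_points fin a)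
  obtain x where "x \<in> halfspaces n a I \<beta>" using ne by blast
  then have "?E \<noteq> {}" using better by blast
  then obtain w where w: "w \<in> ?E" "y \<bullet> w = Max ((\<bullet>) y ` ?E)" using Max_in[OF fE] by auto
  have "y \<bullet> x \<le> y \<bullet> w" if x: "x \<in> halfspaces n a I \<beta>" for x
  proof -
    obtain w' where "w' \<in> ?E" "y \<bullet> x \<le> y \<bullet> w'" using better[OF x] by auto
    moreover have "y \<bullet> w' \<le> y \<bullet> w" using w(2) fE \<open>w' \<in> ?E\<close> by auto
    ultimately show ?thesis by linarith
  qed
  then show ?thesis using w(1) by (auto simp: maximizer_def basic_point_def)
qed

section \<open>Edges and connectivity of optimal faces\<close>

lemma sum_rows_scalar_prod:
  fixes a :: "nat \<Rightarrow> real vec"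
  assumes "x \<in> carrier_vec n" "\<And>i. i \<in> K \<Longrightarrow> a i \<in> carrier_vec n"
  shows "vec n (\<lambda>j. \<Sum>i\<in>K. g i * a i $ j) \<bullet> x = (\<Sum>i\<in>K. g i * (a i \<bullet> x))"
proof -
  have "vec n (\<lambda>j. \<Sum>i\<in>K. g i * a i $ j) \<bullet> x = (\<Sum>j<n. \<Sum>i\<in>K. g i * (a i $ j * x $ j))"
    using assms by (simp add: scalar_prod_def lessThan_atLeast0 sum_distrib_right mult.assoc)
  also have "\<dots> = (\<Sum>i\<in>K. \<Sum>j<n. g i * (a i $ j * x $ j))" by (rule sum.swap)
  also have "\<dots> = (\<Sum>i\<in>K. g i * (a i \<bullet> x))"
    using assms by (intro sum.cong) (simp_all add: scalar_prod_def lessThan_atLeast0 sum_distrib_left)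
  finally show ?thesis .
qed

text \<open>The slack of the summed inequality is a sum of nonnegative slacks and vanishes only if
  each does. Thus faces cut out by tight rows are exposed, as \<open>is_face\<close>
  demands.\<close>

lemma sum_tight_rows_face:
  assumes fin: "finite I" and a: "\<And>i. i \<in> I \<Longrightarrow> a i \<in> carrier_vec n" and K: "K \<subseteq> I"
    and x: "x \<in> halfspaces n a I \<beta>"
  defines "c \<equiv> vec n (\<lambda>j. \<Sum>i\<in>K. a i $ j)"
  shows "c \<bullet> x \<le> sum \<beta> K" and "c \<bullet> x = sum \<beta> K \<longleftrightarrow> (\<forall>i\<in>K. a i \<bullet> x = \<beta> i)"
proof -
  have fK: "finite K" using fin K by (rule rev_finite_subset)
  have c: "c \<bullet> x = (\<Sum>i\<in>K. a i \<bullet> x)"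
    using sum_rows_scalar_prod[of x n K a "\<lambda>_. 1"] x a K by (auto simp: c_def halfspaces_carrier)
  have le: "a i \<bullet> x \<le> \<beta> i" if "i \<in> K" for i using that x K by (auto simp: halfspaces_def)
  show "c \<bullet> x \<le> sum \<beta> K" unfolding c by (rule sum_mono) (rule le)
  show "c \<bullet> x = sum \<beta> K \<longleftrightarrow> (\<forall>i\<in>K. a i \<bullet> x = \<beta> i)"
  proof
    assume "c \<bullet> x = sum \<beta> K"
    then have "(\<Sum>i\<in>K. \<beta> i - a i \<bullet> x) = 0" using c by (simp add: sum_subtractf)
    then show "\<forall>i\<in>K. a i \<bullet> x = \<beta> i" using sum_nonneg_eq_0_iff[OF fK, of "\<lambda>i. \<beta> i - a i \<bullet> x"] le by auto
  qed (simp add: c)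
qed

text \<open>One step of the simplex method inside the face of maximizers of \<open>y\<close>: among the
  directions into this face that improve \<open>p\<close>, one with a maximal set of tight rows spans
  an edge.\<close>

lemma improving_edge:
  assumes fin: "finite I" and a: "\<And>i. i \<in> I \<Longrightarrow> a i \<in> carrier_vec n"
    and v: "basic_point n a I \<beta> v" and y: "y \<in> carrier_vec n"
    and maxv: "maximizer (halfspaces n a I \<beta>) y v"
    and p: "p \<in> carrier_vec n" and bd: "\<And>z. z \<in> halfspaces n a I \<beta> \<Longrightarrow> p \<bullet> z \<le> C"
    and u: "maximizer (halfspaces n a I \<beta>) y u" "p \<bullet> v < p \<bullet> u"
  obtains w where "basic_point n a I \<beta> w" "edge n (halfspaces n a I \<beta>) v w"
    "maximizer (halfspaces n a I \<beta>) y w" "p \<bullet> v < p \<bullet> w"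
proof -
  let ?Q = "halfspaces n a I \<beta>" and ?T = "tight_set a I \<beta> v"
  let ?D = "halfspaces n a ?T (\<lambda>_. 0)"
  let ?K = "tight_set a ?T (\<lambda>_. 0)"
  have TI: "?T \<subseteq> I" by (auto simp: tight_set_def)
  have finT: "finite ?T" using fin TI by (rule rev_finite_subset)
  have aT: "a i \<in> carrier_vec n" if "i \<in> ?T" for i using a that TI by auto
  have vQ: "v \<in> ?Q" and tk: "trivial_kernel n a ?T" using v by (auto simp: basic_point_def)
  have vc: "v \<in> carrier_vec n" using vQ by (rule halfspaces_carrier)
  have uQ: "u \<in> ?Q" and uc: "u \<in> carrier_vec n" and yu: "y \<bullet> u = y \<bullet> v"
    using u(1) maxv vQ by (auto simp: maximizer_def halfspaces_carrier intro: antisym)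
  \<comment> \<open>\<open>?D\<close> is the cone of feasible directions at \<open>v\<close>, on
    which optimality of \<open>v\<close> makes \<open>y\<close> nonpositive.\<close>
  have yD: "y \<bullet> f \<le> 0" if f: "f \<in> ?D" for f
  proof -
    have fc: "f \<in> carrier_vec n" using f by (rule halfspaces_carrier)
    obtain t where "t > 0" "v + t \<cdot>\<^sub>v f \<in> ?Q"
      by (rule small_step[OF fin a vQ fc]) (use f in \<open>auto simp: halfspaces_def\<close>)
    then have "y \<bullet> v + t * (y \<bullet> f) \<le> y \<bullet> v"
      using maxv scalar_prod_line[OF y vc fc, of t] by (auto simp: maximizer_def)
    then show ?thesis using \<open>t > 0\<close> by (simp add: mult_le_0_iff)
  qed
  define G where "G = {d \<in> ?D. y \<bullet> d = 0 \<and> p \<bullet> d > 0}"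
  have "u - v \<in> G"
  proof -
    have "a i \<bullet> (u - v) \<le> 0" if "i \<in> ?T" for i
      using that uQ vc uc a[of i] by (auto simp: tight_set_def halfspaces_def scalar_prod_minus_distrib[of _ n])
    then show ?thesis
      using u(2) uc vc y p yu by (auto simp: G_def halfspaces_def scalar_prod_minus_distrib[of _ n])
  qed
  moreover have "\<forall>d. d \<in> G \<longrightarrow> card (?K d) < Suc (card ?T)"
    using finT by (auto intro!: card_mono le_imp_less_Suc simp: tight_set_def[of a ?T])
  ultimately obtain d where d: "d \<in> G" and dmax: "\<And>f. f \<in> G \<Longrightarrow> card (?K f) \<le> card (?K d)"
    using ex_has_greatest_nat[of "\<lambda>d. d \<in> G" "u - v" "\<lambda>d. card (?K d)" "Suc (card ?T)"] by auto
  have dD: "d \<in> ?D" and yd: "y \<bullet> d = 0" and pd: "p \<bullet> d > 0" using d by (auto simp: G_def)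
  have dc: "d \<in> carrier_vec n" using dD by (rule halfspaces_carrier)
  have aK: "a i \<in> carrier_vec n" if "i \<in> ?K d" for i using that aT by (auto simp: tight_set_def[of a ?T])
  \<comment> \<open>Here maximality of \<open>?K d\<close> enters: a nonzero such \<open>e\<close>
    would allow moving \<open>d\<close> inside \<open>G\<close> until another row becomes
    tight.\<close>
  have ker0: "e = 0\<^sub>v n" if e: "e \<in> carrier_vec n" "\<And>i. i \<in> ?K d \<Longrightarrow> a i \<bullet> e = 0" "p \<bullet> e = 0" for e
  proof (rule ccontr)
    assume "e \<noteq> 0\<^sub>v n"
    then obtain k where k: "k \<in> ?T" "a k \<bullet> e \<noteq> 0" using trivial_kernelD[OF tk e(1)] by blast
    obtain e' where e': "e' \<in> carrier_vec n" "\<And>i. i \<in> ?K d \<Longrightarrow> a i \<bullet> e' = 0" "p \<bullet> e' = 0" "a k \<bullet> e' > 0"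
    proof (cases "a k \<bullet> e > 0")
      case False
      then show ?thesis
        using e k p aT[OF k(1)] aK by (intro that[of "(-1) \<cdot>\<^sub>v e"]) auto
    qed (use e that in blast)
    obtain t j where t: "t > 0" "d + t \<cdot>\<^sub>v e' \<in> ?D" "j \<in> ?T" "a j \<bullet> e' > 0" "a j \<bullet> (d + t \<cdot>\<^sub>v e') = 0"
      using blocking_constraint[OF finT aT dD e'(1) _ k(1) e'(4)] e'(2) by (metis order_refl)
    obtain s where s: "s > 0" "d + s \<cdot>\<^sub>v ((-1) \<cdot>\<^sub>v e') \<in> ?D"
    proof (rule small_step[OF finT aT dD, of "(-1) \<cdot>\<^sub>v e'"])
      show "a i \<bullet> ((-1) \<cdot>\<^sub>v e') \<le> 0" if "i \<in> ?K d" for i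
        using e'(1,2) that aK[OF that] by simp
    qed (use e' in auto)
    \<comment> \<open>Both \<open>d + t * e'\<close> and \<open>d - s * e'\<close> are feasible
      directions and \<open>y\<close> vanishes at \<open>d\<close>, so \<open>y\<close> is constant
      along \<open>e'\<close>.\<close>
    have "t * (y \<bullet> e') \<le> 0" using yD[OF t(2)] scalar_prod_line[OF y dc e'(1), of t] yd by simp
    moreover have "s * (y \<bullet> e') \<ge> 0"
      using yD[OF s(2)] scalar_prod_line[OF y dc, of "(-1) \<cdot>\<^sub>v e'" s] yd e'(1) y by simp
    ultimately have ye: "y \<bullet> e' = 0" using t(1) s(1) by (simp add: mult_le_0_iff zero_le_mult_iff)
    have "d + t \<cdot>\<^sub>v e' \<in> G"
      using t(2) pd yd ye e'(3) scalar_prod_line[OF y dc e'(1), of t] scalar_prod_line[OF p dc e'(1), of t]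
      by (simp add: G_def)
    then have "card (?K (d + t \<cdot>\<^sub>v e')) \<le> card (?K d)" by (rule dmax)
    moreover have "?K d \<subset> ?K (d + t \<cdot>\<^sub>v e')"
    proof -
      have "i \<in> ?K (d + t \<cdot>\<^sub>v e')" if "i \<in> ?K d" for i
        using that e'(2)[OF that] scalar_prod_line[OF aK[OF that] dc e'(1), of t]
        by (auto simp: tight_set_def[of a ?T])
      moreover have "j \<in> ?K (d + t \<cdot>\<^sub>v e')" "j \<notin> ?K d"
        using t e'(2) by (auto simp: tight_set_def[of a ?T])
      ultimately show ?thesis by blast
    qed
    then have "card (?K d) < card (?K (d + t \<cdot>\<^sub>v e'))"
      using finT by (intro psubset_card_mono) (auto simp: tight_set_def[of a ?T])
    ultimately show False by simp
  qed
  have ker: "e = (p \<bullet> e / (p \<bullet> d)) \<cdot>\<^sub>v d"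
    if e: "e \<in> carrier_vec n" "\<And>i. i \<in> ?K d \<Longrightarrow> a i \<bullet> e = 0" for e
  proof -
    let ?s = "p \<bullet> e / (p \<bullet> d)"
    have "e + (- ?s) \<cdot>\<^sub>v d = 0\<^sub>v n"
    proof (rule ker0)
      show "e + (- ?s) \<cdot>\<^sub>v d \<in> carrier_vec n" using e dc by simp
      show "p \<bullet> (e + (- ?s) \<cdot>\<^sub>v d) = 0"
        unfolding scalar_prod_line[OF p e(1) dc] using pd by simp
      show "a i \<bullet> (e + (- ?s) \<cdot>\<^sub>v d) = 0" if "i \<in> ?K d" for i
        unfolding scalar_prod_line[OF aK[OF that] e(1) dc] using e(2)[OF that] that
        by (simp add: tight_set_def[of a ?T])
    qed
    then show ?thesis using e(1) dc by (auto simp: vec_eq_iff)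
  qed
  have "\<exists>k\<in>I. a k \<bullet> d > 0"
  proof (rule ccontr)
    assume "\<not> ?thesis"
    then have "a i \<bullet> d \<le> 0" if "i \<in> I" for i using that by force
    from unbounded_along_recession_direction[OF a vQ dc this p bd] pd show False by simp
  qed
  then obtain k where k: "k \<in> I" "a k \<bullet> d > 0" by blast
  obtain t j where t: "t > 0" "v + t \<cdot>\<^sub>v d \<in> ?Q" "j \<in> I" "a j \<bullet> d > 0" "a j \<bullet> (v + t \<cdot>\<^sub>v d) = \<beta> j"
    by (rule blocking_constraint[OF fin a vQ dc _ k]) (use dD in \<open>auto simp: halfspaces_def\<close>)
  define w where "w = v + t \<cdot>\<^sub>v d"
  have wc: "w \<in> carrier_vec n" using vc dc by (simp add: w_def)
  have wK: "i \<in> tight_set a I \<beta> w" if "i \<in> ?K d" for i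
    using that scalar_prod_line[OF aK[OF that] vc dc, of t] by (auto simp: w_def tight_set_def)
  have bw: "basic_point n a I \<beta> w"
    unfolding basic_point_def trivial_kernel_def
  proof (intro conjI ballI impI)
    show "w \<in> ?Q" using t by (simp add: w_def)
    fix e assume e: "e \<in> carrier_vec n" "\<forall>i\<in>tight_set a I \<beta> w. a i \<bullet> e = 0"
    have es: "e = (p \<bullet> e / (p \<bullet> d)) \<cdot>\<^sub>v d" using e wK by (intro ker) auto
    have "j \<in> tight_set a I \<beta> w" using t by (simp add: tight_set_def w_def)
    then have "a j \<bullet> ((p \<bullet> e / (p \<bullet> d)) \<cdot>\<^sub>v d) = 0" using e es by auto
    then have "(p \<bullet> e / (p \<bullet> d)) * (a j \<bullet> d) = 0" using a[OF t(3)] dc by simp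
    then have "p \<bullet> e / (p \<bullet> d) = 0" using t(4) by simp
    then show "e = 0\<^sub>v n" using es dc by auto
  qed
  have yw: "y \<bullet> w = y \<bullet> v" using scalar_prod_line[OF y vc dc, of t] yd by (simp add: w_def)
  have pw: "p \<bullet> v < p \<bullet> w" using scalar_prod_line[OF p vc dc, of t] pd t(1) by (simp add: w_def)
  have mw: "maximizer ?Q y w" using maxv yw bw by (auto simp: maximizer_def basic_point_def)
  have dn0: "d \<noteq> 0\<^sub>v n" using pd p by auto
  \<comment> \<open>Row \<open>l\<close> is tight at \<open>v\<close> and decreases along
    \<open>d\<close>, so it cuts off the line behind \<open>v\<close>; row \<open>j\<close> cuts it
    off beyond \<open>w\<close>.\<close>
  then obtain l where l: "l \<in> ?T" "a l \<bullet> d < 0"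
    using trivial_kernelD[OF tk dc] dD by (force simp: halfspaces_def)
  have KI: "?K d \<subseteq> I" using TI by (auto simp: tight_set_def[of a ?T])
  have Kv: "a i \<bullet> v = \<beta> i" if "i \<in> ?K d" for i using that by (auto simp: tight_set_def)
  define c where "c = vec n (\<lambda>j. \<Sum>i\<in>?K d. a i $ j)"
  have seg: "segment_vec v w = {x \<in> ?Q. \<forall>i\<in>?K d. a i \<bullet> x = \<beta> i}" (is "_ = ?R")
  proof (rule equalityI; rule subsetI)
    fix x assume "x \<in> segment_vec v w"
    then obtain s where s: "0 \<le> s" "s \<le> 1" and x: "x = (1 - s) \<cdot>\<^sub>v v + s \<cdot>\<^sub>v w"
      by (auto simp: segment_vec_def)
    have ip: "a i \<bullet> x = (1 - s) * (a i \<bullet> v) + s * (a i \<bullet> w)" if "i \<in> I" for i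
      using a[OF that] vc wc by (simp add: x scalar_prod_add_distrib[of _ n])
    have "a i \<bullet> x \<le> \<beta> i" if "i \<in> I" for i
    proof -
      have "a i \<bullet> v \<le> \<beta> i" "a i \<bullet> w \<le> \<beta> i" using vQ bw that by (auto simp: halfspaces_def basic_point_def)
      then have "(1 - s) * (a i \<bullet> v) + s * (a i \<bullet> w) \<le> (1 - s) * \<beta> i + s * \<beta> i"
        using s by (intro add_mono mult_left_mono) auto
      then show ?thesis using ip[OF that] by (simp add: algebra_simps)
    qed
    moreover have "a i \<bullet> x = \<beta> i" if "i \<in> ?K d" for i
      using ip[of i] that KI Kv[OF that] wK[OF that] by (auto simp: tight_set_def algebra_simps)
    ultimately show "x \<in> ?R" using vc wc by (auto simp: halfspaces_def x)
  next
    fix x assume "x \<in> ?R"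
    then have xQ: "x \<in> ?Q" and xK: "\<And>i. i \<in> ?K d \<Longrightarrow> a i \<bullet> x = \<beta> i" by auto
    have xc: "x \<in> carrier_vec n" using xQ by (rule halfspaces_carrier)
    obtain s where s: "x - v = s \<cdot>\<^sub>v d"
      using ker[of "x - v"] xc vc aK xK Kv by (auto simp: scalar_prod_minus_distrib[of _ n])
    then have x: "x = v + s \<cdot>\<^sub>v d" using xc vc dc by (auto simp: vec_eq_iff algebra_simps)
    have "a l \<bullet> v + s * (a l \<bullet> d) \<le> \<beta> l"
      using xQ subsetD[OF TI l(1)] scalar_prod_line[OF aT[OF l(1)] vc dc, of s]
      by (force simp: halfspaces_def x)
    moreover have "a l \<bullet> v = \<beta> l" using l(1) by (simp add: tight_set_def)
    ultimately have "s \<ge> 0" using l(2) by (simp add: mult_le_0_iff)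
    have "a j \<bullet> v + s * (a j \<bullet> d) \<le> a j \<bullet> v + t * (a j \<bullet> d)"
      using xQ t(3,5) scalar_prod_line[OF a[OF t(3)] vc dc] by (auto simp: halfspaces_def x)
    then have "s \<le> t" using t(4) by simp
    have "x = (1 - s / t) \<cdot>\<^sub>v v + (s / t) \<cdot>\<^sub>v w"
      using vc dc t(1) by (auto simp: x w_def vec_eq_iff algebra_simps)
    then show "x \<in> segment_vec v w"
      using \<open>s \<ge> 0\<close> \<open>s \<le> t\<close> t(1) unfolding segment_vec_def by (intro CollectI exI[of _ "s / t"]) auto
  qed
  have "edge n ?Q v w"
    unfolding edge_def
  proof (intro conjI bexI[of _ c] exI[of _ "sum \<beta> (?K d)"] ballI)
    show "v \<noteq> w" using pw by auto
    show "c \<bullet> x \<le> sum \<beta> (?K d)" if "x \<in> ?Q" for x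
      unfolding c_def by (rule sum_tight_rows_face(1)[OF fin a KI that])
    show "segment_vec v w = {x \<in> ?Q. c \<bullet> x = sum \<beta> (?K d)}"
    proof -
      have "c \<bullet> x = sum \<beta> (?K d) \<longleftrightarrow> (\<forall>i\<in>?K d. a i \<bullet> x = \<beta> i)" if "x \<in> ?Q" for x
        unfolding c_def by (rule sum_tight_rows_face(2)[OF fin a KI that])
      then show ?thesis unfolding seg by blast
    qed
  qed (simp add: c_def)
  then show ?thesis using that[of w] bw mw pw by blast
qed

text \<open>The sum of the tight rows of \<open>u\<close> is maximized at \<open>u\<close> only.
  Improving edges within the optimal face increase it, and there are finitely many basic
  points.\<close>

lemma maximizers_connected:
  fixes a :: "nat \<Rightarrow> real vec" and \<beta> :: "nat \<Rightarrow> real"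
  assumes fin: "finite I" and a: "\<And>i. i \<in> I \<Longrightarrow> a i \<in> carrier_vec n" and y: "y \<in> carrier_vec n"
  defines "Q \<equiv> halfspaces n a I \<beta>"
  defines "R \<equiv> {(v, w). edge n Q v w \<and> basic_point n a I \<beta> v \<and> basic_point n a I \<beta> w \<and>
    maximizer Q y v \<and> maximizer Q y w}"
  assumes v: "basic_point n a I \<beta> v" "maximizer Q y v"
    and u: "basic_point n a I \<beta> u" "maximizer Q y u"
  shows "(v, u) \<in> R\<^sup>*"
proof -
  define p where "p = vec n (\<lambda>j. \<Sum>i\<in>tight_set a I \<beta> u. a i $ j)"
  have T: "tight_set a I \<beta> u \<subseteq> I" by (auto simp: tight_set_def)
  have uQ: "u \<in> Q" using u by (simp add: maximizer_def)
  have pu: "p \<bullet> u = sum \<beta> (tight_set a I \<beta> u)"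
    unfolding p_def using sum_tight_rows_face(2)[OF fin a T] uQ by (auto simp: Q_def tight_set_def)
  have ple: "p \<bullet> x \<le> p \<bullet> u" if "x \<in> Q" for x
    using sum_tight_rows_face(1)[OF fin a T that[unfolded Q_def]] pu by (simp add: p_def)
  have peq: "x = u" if "x \<in> Q" "p \<bullet> x = p \<bullet> u" for x
  proof (rule basic_point_eqI[OF a u(1)])
    show "a i \<bullet> x = \<beta> i" if "i \<in> tight_set a I \<beta> u" for i
      using \<open>p \<bullet> x = p \<bullet> u\<close> sum_tight_rows_face(2)[OF fin a T \<open>x \<in> Q\<close>[unfolded Q_def]] pu that
      by (simp add: p_def)
  qed (use that in \<open>auto simp: Q_def halfspaces_carrier\<close>)
  have pc: "p \<in> carrier_vec n" by (simp add: p_def)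
  have finE: "finite {w. basic_point n a I \<beta> w}" by (rule finite_basic_points[OF fin a])
  show ?thesis using v
  proof (induction "card {w. basic_point n a I \<beta> w \<and> p \<bullet> v < p \<bullet> w}" arbitrary: v rule: less_induct)
    case less
    show ?case
    proof (cases "v = u")
      case False
      then have "p \<bullet> v < p \<bullet> u" using less.prems(2) ple[of v] peq[of v] by (auto simp: maximizer_def less_le)
      then obtain w where w: "basic_point n a I \<beta> w" "edge n Q v w" "maximizer Q y w" "p \<bullet> v < p \<bullet> w"
        using improving_edge[OF fin a less.prems(1) y _ pc, of "p \<bullet> u" u] less.prems u ple
        unfolding Q_def by metis
      have "{w'. basic_point n a I \<beta> w' \<and> p \<bullet> w < p \<bullet> w'} \<subset> {w'. basic_point n a I \<beta> w' \<and> p \<bullet> v < p \<bullet> w'}"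
        using w by auto
      then have "card {w'. basic_point n a I \<beta> w' \<and> p \<bullet> w < p \<bullet> w'} < card {w'. basic_point n a I \<beta> w' \<and> p \<bullet> v < p \<bullet> w'}"
        using finE by (intro psubset_card_mono) auto
      from less.hyps[OF this w(1,3)] have "(w, u) \<in> R\<^sup>*" .
      moreover have "(v, w) \<in> R" using w less.prems by (simp add: R_def)
      ultimately show ?thesis by (rule converse_rtrancl_into_rtrancl[rotated])
    qed simp
  qed
qed

section \<open>Regular triangulations of the normal fan\<close>

lemma trivial_kernel_iff_absdet:
  assumes B: "B \<subseteq> {0..<dim_row A}" "card B = dim_col A"
  shows "trivial_kernel (dim_col A) (row A) B \<longleftrightarrow> absdet A B \<noteq> 0"
proof -
  let ?n = "dim_col A" and ?c = "\<lambda>r. row A (pick B r)"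
  have bij: "bij_betw (pick B) {..<?n} B" using bij_betw_pick B finite_subset by blast
  have img: "B = pick B ` {..<?n}" using bij by (simp add: bij_betw_def)
  have "(\<forall>i\<in>B. row A i \<bullet> e = 0) \<longleftrightarrow> (\<forall>r<?n. ?c r \<bullet> e = 0)" for e
    by (subst img) auto
  moreover have "absdet A B = 0 \<longleftrightarrow> det (mat\<^sub>r ?n ?n ?c) = 0"
    by (simp add: absdet_def submatrix_rows[OF B])
  moreover have "det (mat\<^sub>r ?n ?n ?c) = 0 \<longleftrightarrow>
      (\<exists>x\<in>carrier_vec ?n. x \<noteq> 0\<^sub>v ?n \<and> (\<forall>r<?n. ?c r \<bullet> x = 0))"
    by (rule det_rows_eq_0_iff) simp
  ultimately show ?thesis by (auto simp: trivial_kernel_def)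
qed

lemma lin_indep_rows_iff_absdet:
  assumes B: "B \<subseteq> {0..<dim_row A}" "card B = dim_col A"
  shows "lin_indep_fam (dim_col A) (dim_col A) (row (submatrix A B UNIV)) \<longleftrightarrow> absdet A B \<noteq> 0"
proof -
  let ?n = "dim_col A"
  define M where "M = submatrix A B UNIV"
  have M: "M \<in> carrier_mat ?n ?n" by (simp add: M_def submatrix_rows[OF B])
  have row: "row M l $ j = M $$ (l, j)" if "l < ?n" "j < ?n" for l j using M that by simp
  have Mr: "mat\<^sub>r ?n ?n (row M) = M" using M by (intro eq_matI) auto
  have MT: "mat\<^sub>r ?n ?n (col M) = M\<^sup>T" using M by (intro eq_matI) auto
  have "lin_indep_fam ?n ?n (row M) \<longleftrightarrow> det M \<noteq> 0"
  proof
    assume li: "lin_indep_fam ?n ?n (row M)"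
    show "det M \<noteq> 0"
    proof
      assume "det M = 0"
      then have "det (mat\<^sub>r ?n ?n (col M)) = 0" using det_transpose[OF M] MT by simp
      then obtain x where x: "x \<in> carrier_vec ?n" "x \<noteq> 0\<^sub>v ?n" "\<forall>r<?n. col M r \<bullet> x = 0"
        using det_rows_eq_0_iff[of ?n "col M"] M by auto
      have "(\<Sum>l<?n. x $ l * row M l $ j) = 0" if "j < ?n" for j
      proof -
        have "col M j \<bullet> x = (\<Sum>l<?n. x $ l * row M l $ j)"
          using x(1) M that by (simp add: scalar_prod_def lessThan_atLeast0 mult.commute)
        then show ?thesis using x(3) that by simp
      qed
      then have "\<forall>l<?n. x $ l = 0" using li unfolding lin_indep_fam_def by blast
      then show False using x(1,2) by (auto simp: vec_eq_iff)
    qed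
  next
    assume d: "det M \<noteq> 0"
    show "lin_indep_fam ?n ?n (row M)"
      unfolding lin_indep_fam_def
    proof (intro allI impI)
      fix g l assume g: "\<forall>j<?n. (\<Sum>l<?n. g l * row M l $ j) = 0" and l: "l < ?n"
      have "det (mat\<^sub>r ?n ?n ((row M)(l := 0\<^sub>v ?n))) = g l * det (mat\<^sub>r ?n ?n (row M))"
        by (rule det_replace_row_combination[OF l]) (use g in auto)
      moreover have "det (mat\<^sub>r ?n ?n ((row M)(l := 0\<^sub>v ?n))) = 0"
        by (simp add: det_replace_row[OF l])
      ultimately show "g l = 0" using d Mr by simp
    qed
  qed
  then show ?thesis by (simp add: absdet_def M_def)
qed

lemma row_combination:
  fixes A :: "real mat"
  assumes B: "B \<subseteq> {0..<dim_row A}" "card B = dim_col A" "absdet A B \<noteq> 0"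
  obtains g where "\<And>j. j < dim_col A \<Longrightarrow> y $ j = (\<Sum>i\<in>B. g i * row A i $ j)"
proof -
  let ?n = "dim_col A" and ?c = "\<lambda>r. row A (pick B r)"
  have bij: "bij_betw (pick B) {..<?n} B" using bij_betw_pick B finite_subset by blast
  have "det (mat\<^sub>r ?n ?n ?c) \<noteq> 0" using B(3) by (simp add: absdet_def submatrix_rows[OF B(1,2)])
  then obtain \<mu> where \<mu>: "\<And>j. j < ?n \<Longrightarrow> y $ j = (\<Sum>r<?n. \<mu> r * ?c r $ j)"
    using cramer_rows[of ?n ?c y] by blast
  let ?h = "the_inv_into {..<?n} (pick B)"
  have "y $ j = (\<Sum>i\<in>B. \<mu> (?h i) * row A i $ j)" if "j < ?n" for j
    unfolding \<mu>[OF that] sum.reindex_bij_betw[OF bij, symmetric]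
    using bij by (intro sum.cong) (auto simp: bij_betw_def the_inv_into_f_f)
  then show ?thesis by (rule that)
qed

section \<open>Vertices as basic points\<close>

lemma polyhedron_eq_halfspaces:
  "polyhedron A b = halfspaces (dim_col A) (row A) {0..<dim_row A} (($) b)"
  by (auto simp: polyhedron_def halfspaces_def)

lemma tight_eq_tight_set: "tight A b v = tight_set (row A) {0..<dim_row A} (($) b) v"
  by (auto simp: tight_def tight_set_def)

lemma full_column_rank_trivial_kernel:
  assumes "full_column_rank A"
  shows "trivial_kernel (dim_col A) (row A) {0..<dim_row A}"
  unfolding trivial_kernel_def
proof (intro ballI impI)
  fix e assume e: "e \<in> carrier_vec (dim_col A)" "\<forall>i\<in>{0..<dim_row A}. row A i \<bullet> e = 0"
  have "(\<Sum>l<dim_col A. e $ l * col A l $ j) = 0" if "j < dim_row A" for j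
  proof -
    have "row A j \<bullet> e = (\<Sum>l<dim_col A. e $ l * col A l $ j)"
      using e(1) that by (simp add: scalar_prod_def lessThan_atLeast0 mult.commute)
    then show ?thesis using e(2) that by simp
  qed
  then have "\<forall>l<dim_col A. e $ l = 0"
    using assms unfolding full_column_rank_def lin_indep_fam_def by blast
  then show "e = 0\<^sub>v (dim_col A)" using e(1) by auto
qed

text \<open>A direction annihilated by all tight rows is feasible for a small step both ways. A
  functional exposing \<open>v\<close> alone must vanish on it, and uniqueness makes it zero.
  Conversely, the sum of the tight rows exposes a basic point.\<close>

lemma is_vertex_iff_basic_point:
  "is_vertex A b v \<longleftrightarrow> basic_point (dim_col A) (row A) {0..<dim_row A} (($) b) v"
proof
  let ?n = "dim_col A" and ?I = "{0..<dim_row A}"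
  let ?Q = "halfspaces ?n (row A) ?I (($) b)" and ?T = "tight_set (row A) ?I (($) b) v"
  assume "is_vertex A b v"
  then obtain c \<delta> where c: "c \<in> carrier_vec ?n" "\<And>x. x \<in> ?Q \<Longrightarrow> c \<bullet> x \<le> \<delta>"
      "{v} = {x \<in> ?Q. c \<bullet> x = \<delta>}"
    by (auto simp: is_vertex_def is_face_def polyhedron_eq_halfspaces)
  have vQ: "v \<in> ?Q" "c \<bullet> v = \<delta>" using c(3) by auto
  have vc: "v \<in> carrier_vec ?n" using vQ(1) by (rule halfspaces_carrier)
  have step: "c \<bullet> e \<le> 0 \<and> (c \<bullet> e = 0 \<longrightarrow> e = 0\<^sub>v ?n)"
    if e: "e \<in> carrier_vec ?n" "\<forall>i\<in>?T. row A i \<bullet> e = 0" for e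
  proof -
    obtain t where t: "t > 0" "v + t \<cdot>\<^sub>v e \<in> ?Q"
      by (rule small_step[OF _ _ vQ(1) e(1)]) (use e(2) in auto)
    have ip: "c \<bullet> (v + t \<cdot>\<^sub>v e) = \<delta> + t * (c \<bullet> e)"
      using scalar_prod_line[OF c(1) vc e(1)] vQ(2) by simp
    then have "c \<bullet> e \<le> 0" using c(2)[OF t(2)] t(1) by (simp add: mult_le_0_iff)
    moreover have "e = 0\<^sub>v ?n" if "c \<bullet> e = 0"
    proof -
      have "v + t \<cdot>\<^sub>v e \<in> {v}" unfolding c(3) using t(2) ip that by simp
      then show ?thesis using vc e(1) t(1) by (auto simp: vec_eq_iff)
    qed
    ultimately show ?thesis by blast
  qed
  have "e = 0\<^sub>v ?n" if e: "e \<in> carrier_vec ?n" "\<forall>i\<in>?T. row A i \<bullet> e = 0" for e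
  proof -
    have m: "(-1) \<cdot>\<^sub>v e \<in> carrier_vec ?n" "\<forall>i\<in>?T. row A i \<bullet> ((-1) \<cdot>\<^sub>v e) = 0"
      using e by auto
    have "c \<bullet> ((-1) \<cdot>\<^sub>v e) = - (c \<bullet> e)" using e(1) c(1) by simp
    then have "c \<bullet> e = 0" using step[OF e] step[OF m] by linarith
    then show ?thesis using step[OF e] by blast
  qed
  then show "basic_point ?n (row A) ?I (($) b) v"
    using vQ(1) by (simp add: basic_point_def trivial_kernel_def)
next
  let ?n = "dim_col A" and ?I = "{0..<dim_row A}"
  let ?Q = "halfspaces ?n (row A) ?I (($) b)" and ?T = "tight_set (row A) ?I (($) b) v"
  assume v: "basic_point ?n (row A) ?I (($) b) v"
  define c where "c = vec ?n (\<lambda>j. \<Sum>i\<in>?T. row A i $ j)"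
  have T: "?T \<subseteq> ?I" by (auto simp: tight_set_def)
  have r: "\<And>i. row A i \<in> carrier_vec ?n" by simp
  have eq: "c \<bullet> x = sum (($) b) ?T \<longleftrightarrow> (\<forall>i\<in>?T. row A i \<bullet> x = b $ i)" if "x \<in> ?Q" for x
    unfolding c_def by (rule sum_tight_rows_face(2)[OF _ r T that]) simp
  have "{v} = {x \<in> ?Q. c \<bullet> x = sum (($) b) ?T}"
  proof (rule equalityI; rule subsetI)
    fix x assume "x \<in> {x \<in> ?Q. c \<bullet> x = sum (($) b) ?T}"
    then have x: "x \<in> ?Q" "\<forall>i\<in>?T. row A i \<bullet> x = b $ i" using eq by auto
    have "x = v"
      by (rule basic_point_eqI[OF r v]) (use x in \<open>auto dest: halfspaces_carrier\<close>)
    then show "x \<in> {v}" by simp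
  next
    fix x assume "x \<in> {v}"
    then show "x \<in> {x \<in> ?Q. c \<bullet> x = sum (($) b) ?T}"
      using v eq[of v] by (auto simp: basic_point_def tight_set_def)
  qed
  moreover have "c \<bullet> x \<le> sum (($) b) ?T" if "x \<in> ?Q" for x
    unfolding c_def by (rule sum_tight_rows_face(1)[OF _ r T that]) simp
  ultimately show "is_vertex A b v"
    unfolding is_vertex_def is_face_def polyhedron_eq_halfspaces
    by (intro bexI[of _ c] exI[of _ "sum (($) b) ?T"]) (auto simp: c_def)
qed

section \<open>Generic liftings and separation of cells\<close>

lemma generic_right_hand_side:
  fixes a :: "nat \<Rightarrow> real vec"
  assumes a: "\<And>i. i < m \<Longrightarrow> a i \<in> carrier_vec n"
  obtains \<omega> :: "nat \<Rightarrow> real" where "\<And>i. \<omega> i > 0"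
    "\<And>J p. J \<subseteq> {0..<m} \<Longrightarrow> card J = Suc n \<Longrightarrow> p \<in> carrier_vec n \<Longrightarrow> \<exists>i\<in>J. a i \<bullet> p \<noteq> \<omega> i"
proof -
  define \<J> where "\<J> = {J. J \<subseteq> {0..<m} \<and> card J = Suc n}"
  have "\<forall>J\<in>\<J>. \<exists>\<mu>. (\<exists>i\<in>J. \<mu> i \<noteq> (0::real)) \<and> (\<forall>j<n. (\<Sum>i\<in>J. \<mu> i * a i $ j) = 0)"
  proof
    fix J assume "J \<in> \<J>"
    then have "finite J" "card J = Suc n" by (auto simp: \<J>_def intro: finite_subset)
    then show "\<exists>\<mu>. (\<exists>i\<in>J. \<mu> i \<noteq> (0::real)) \<and> (\<forall>j<n. (\<Sum>i\<in>J. \<mu> i * a i $ j) = 0)"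
      by (rule too_many_vectors_dependent[where a = a]) blast
  qed
  then obtain \<mu> where \<mu>: "\<And>J. J \<in> \<J> \<Longrightarrow> \<exists>i\<in>J. \<mu> J i \<noteq> (0::real)"
      "\<And>J j. J \<in> \<J> \<Longrightarrow> j < n \<Longrightarrow> (\<Sum>i\<in>J. \<mu> J i * a i $ j) = 0"
    by metis
  \<comment> \<open>The right-hand side will be the moment curve \<open>x ^ i\<close>. If all rows
    of \<open>J\<close> attained it at one point, their linear relation would annihilate it, making
    \<open>x\<close> a root of this nonzero polynomial.\<close>
  define q where "q = (\<lambda>J. \<Sum>i\<in>J. monom (\<mu> J i) i)"
  have q0: "q J \<noteq> 0" if J: "J \<in> \<J>" for J
  proof -
    obtain i where i: "i \<in> J" "\<mu> J i \<noteq> 0" using \<mu>(1)[OF J] by blast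
    have "finite J" using J by (auto simp: \<J>_def intro: finite_subset)
    then have "coeff (q J) i = \<mu> J i" using i by (simp add: q_def coeff_sum sum.delta)
    then show ?thesis using i by auto
  qed
  have "\<J> \<subseteq> Pow {0..<m}" by (auto simp: \<J>_def)
  then have "finite \<J>" by (rule finite_subset) simp
  then have "finite (\<Union>J\<in>\<J>. {x. poly (q J) x = 0})" using q0 poly_roots_finite by blast
  then obtain x where x: "x > 0" "x \<notin> (\<Union>J\<in>\<J>. {x. poly (q J) x = 0})"
    using infinite_Ioi[of "0::real"] by (metis finite_subset greaterThan_iff subsetI)
  show ?thesis
  proof (rule that[of "\<lambda>i. x ^ i"])
    show "x ^ i > 0" for i using x(1) by simp
    fix J and p :: "real vec" assume J: "J \<subseteq> {0..<m}" "card J = Suc n" and p: "p \<in> carrier_vec n"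
    have aJ: "a i \<in> carrier_vec n" if "i \<in> J" for i using a J(1) that by auto
    have JJ: "J \<in> \<J>" using J by (simp add: \<J>_def)
    show "\<exists>i\<in>J. a i \<bullet> p \<noteq> x ^ i"
    proof (rule ccontr)
      assume "\<not> ?thesis"
      then have eq: "a i \<bullet> p = x ^ i" if "i \<in> J" for i using that by blast
      have "poly (q J) x = (\<Sum>i\<in>J. \<mu> J i * (a i \<bullet> p))"
        by (simp add: q_def poly_sum poly_monom eq)
      also have "\<dots> = vec n (\<lambda>j. \<Sum>i\<in>J. \<mu> J i * a i $ j) \<bullet> p"
        by (rule sum_rows_scalar_prod[OF p aJ, symmetric])
      also have "vec n (\<lambda>j. \<Sum>i\<in>J. \<mu> J i * a i $ j) = 0\<^sub>v n"
        using \<mu>(2)[OF JJ] by auto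
      finally show False using x(2) JJ p by simp
    qed
  qed
qed

lemma row_cone_scalar_prod:
  fixes A :: "real mat"
  assumes c: "c \<in> carrier_vec (dim_col A)" and y: "y \<in> carrier_vec (dim_col A)"
    and eq: "\<And>j. j < dim_col A \<Longrightarrow> y $ j = (\<Sum>i\<in>I. g i * A $$ (i, j))"
    and I: "I \<subseteq> {0..<dim_row A}"
  shows "y \<bullet> c = (\<Sum>i\<in>I. g i * (row A i \<bullet> c))"
proof -
  have "y = vec (dim_col A) (\<lambda>j. \<Sum>i\<in>I. g i * row A i $ j)"
  proof (rule eq_vecI)
    fix j assume "j < dim_vec (vec (dim_col A) (\<lambda>j. \<Sum>i\<in>I. g i * row A i $ j))"
    then have j: "j < dim_col A" by simp
    have "A $$ (i, j) = row A i $ j" if "i \<in> I" for i using I that j by (simp add: subset_eq)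
    then show "y $ j = vec (dim_col A) (\<lambda>j. \<Sum>i\<in>I. g i * row A i $ j) $ j"
      using eq[OF j] j by simp
  qed (use y in simp)
  then show ?thesis using sum_rows_scalar_prod[OF c, of I "row A" g] by simp
qed

text \<open>\<open>c\<close> weakly separates the cones and vanishes on a generator from
  \<open>B\<close> only if that one is shared. A point of the first cone where \<open>c\<close>
  vanishes thus uses shared generators alone, so the intersection is the face cut out by
  \<open>c\<close>.\<close>

lemma cone_face_separation:
  assumes B: "B \<subseteq> {0..<dim_row A}" "B' \<subseteq> {0..<dim_row A}" and c: "c \<in> carrier_vec (dim_col A)"
    and neg: "\<And>i. i \<in> B \<Longrightarrow> row A i \<bullet> c \<le> 0" "\<And>i. i \<in> B \<Longrightarrow> row A i \<bullet> c = 0 \<Longrightarrow> i \<in> B'"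
    and pos: "\<And>i. i \<in> B' \<Longrightarrow> 0 \<le> row A i \<bullet> c"
  shows "cone_face (dim_col A) (row_cone A B) (row_cone A B \<inter> row_cone A B')"
proof -
  have fB: "finite B" "finite B'" using B finite_subset by blast+
  have le: "c \<bullet> y \<le> 0 \<and> (c \<bullet> y = 0 \<longrightarrow> y \<in> row_cone A B')" if yB: "y \<in> row_cone A B" for y
  proof -
    obtain g where y: "y \<in> carrier_vec (dim_col A)" and g: "\<forall>i\<in>B. 0 \<le> g i"
      "\<And>j. j < dim_col A \<Longrightarrow> y $ j = (\<Sum>i\<in>B. g i * A $$ (i, j))"
      using yB by (auto simp: row_cone_def)
    have yc: "y \<bullet> c = (\<Sum>i\<in>B. g i * (row A i \<bullet> c))" by (rule row_cone_scalar_prod[OF c y g(2) B(1)])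
    have cy: "c \<bullet> y = y \<bullet> c" by (rule comm_scalar_prod[OF c y])
    have t: "g i * (row A i \<bullet> c) \<le> 0" if "i \<in> B" for i
      using g(1) neg(1)[OF that] that by (simp add: mult_le_0_iff)
    have "c \<bullet> y \<le> 0" unfolding cy yc by (rule sum_nonpos) (rule t)
    moreover have "y \<in> row_cone A B'" if "c \<bullet> y = 0"
    proof -
      have "(\<Sum>i\<in>B. - (g i * (row A i \<bullet> c))) = 0" using that cy yc by (simp add: sum_negf)
      then have z: "g i = 0 \<or> row A i \<bullet> c = 0" if "i \<in> B" for i
        using sum_nonneg_eq_0_iff[OF fB(1), of "\<lambda>i. - (g i * (row A i \<bullet> c))"] t that by auto
      define g' where "g' = (\<lambda>i. if i \<in> B then g i else 0)"
      have "y $ j = (\<Sum>i\<in>B'. g' i * A $$ (i, j))" if "j < dim_col A" for j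
      proof -
        have "(\<Sum>i\<in>B. g i * A $$ (i, j)) = (\<Sum>i\<in>B \<inter> B'. g i * A $$ (i, j))"
          using fB z neg(2) by (intro sum.mono_neutral_right) auto
        also have "\<dots> = (\<Sum>i\<in>B'. g' i * A $$ (i, j))"
          using fB by (intro sum.mono_neutral_cong_left) (auto simp: g'_def)
        finally show ?thesis using g(2)[OF that] by simp
      qed
      then show ?thesis using y g(1) by (auto simp: row_cone_def g'_def intro!: exI[of _ g'])
    qed
    ultimately show ?thesis by blast
  qed
  have ge: "0 \<le> c \<bullet> y" if yB: "y \<in> row_cone A B'" for y
  proof -
    obtain g where y: "y \<in> carrier_vec (dim_col A)" and g: "\<forall>i\<in>B'. 0 \<le> g i"
      "\<And>j. j < dim_col A \<Longrightarrow> y $ j = (\<Sum>i\<in>B'. g i * A $$ (i, j))"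
      using yB by (auto simp: row_cone_def)
    have "y \<bullet> c = (\<Sum>i\<in>B'. g i * (row A i \<bullet> c))" by (rule row_cone_scalar_prod[OF c y g(2) B(2)])
    moreover have "c \<bullet> y = y \<bullet> c" by (rule comm_scalar_prod[OF c y])
    ultimately show ?thesis using g(1) pos by (auto intro!: sum_nonneg)
  qed
  show ?thesis
    unfolding cone_face_def using le ge c by (intro bexI[of _ c]) (auto intro: antisym)
qed

lemma small_perturbation_keeps_sign:
  fixes f g :: "nat \<Rightarrow> real"
  assumes "finite S"
  obtains \<epsilon> where "\<epsilon> > 0" "\<And>i. i \<in> S \<Longrightarrow> f i < 0 \<Longrightarrow> f i + \<epsilon> * g i < 0"
    "\<And>i. i \<in> S \<Longrightarrow> f i > 0 \<Longrightarrow> f i + \<epsilon> * g i > 0"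
proof -
  have "eventually (\<lambda>\<epsilon>. (f i < 0 \<longrightarrow> f i + \<epsilon> * g i < 0) \<and> (f i > 0 \<longrightarrow> f i + \<epsilon> * g i > 0)) (at_right 0)" for i
  proof -
    have lim: "((\<lambda>\<epsilon>. f i + \<epsilon> * g i) \<longlongrightarrow> f i + 0 * g i) (at_right 0)" by (intro tendsto_intros)
    show ?thesis
      using order_tendstoD(1)[OF lim, of 0] order_tendstoD(2)[OF lim, of 0]
      by (cases "f i" "0::real" rule: linorder_cases) (auto elim: eventually_mono)
  qed
  then have "eventually (\<lambda>\<epsilon>. \<forall>i\<in>S. (f i < 0 \<longrightarrow> f i + \<epsilon> * g i < 0) \<and> (f i > 0 \<longrightarrow> f i + \<epsilon> * g i > 0)) (at_right 0)"
    by (intro eventually_ball_finite assms) blast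
  moreover have "eventually (\<lambda>\<epsilon>::real. \<epsilon> > 0) (at_right 0)" by (rule eventually_at_right_less)
  ultimately have "eventually (\<lambda>\<epsilon>. \<epsilon> > 0 \<and> (\<forall>i\<in>S. (f i < 0 \<longrightarrow> f i + \<epsilon> * g i < 0) \<and> (f i > 0 \<longrightarrow> f i + \<epsilon> * g i > 0))) (at_right 0)"
    by eventually_elim simp
  then obtain \<epsilon> where "\<epsilon> > 0 \<and> (\<forall>i\<in>S. (f i < 0 \<longrightarrow> f i + \<epsilon> * g i < 0) \<and> (f i > 0 \<longrightarrow> f i + \<epsilon> * g i > 0))"
    using eventually_happens by force
  then show ?thesis using that by blast
qed

text \<open>The triangulation is the regular one induced by the lifting \<open>\<omega>\<close>, i.e. the normal fan of
  the polyhedron with right-hand side \<open>b + \<epsilon> * \<omega>\<close> for an infinitesimal \<open>\<epsilon>\<close>: the point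
  \<open>p\<close> below is the first-order displacement of the vertex \<open>v\<close>.\<close>

lemma triangulation_exists:
  assumes rank: "full_column_rank A"
  shows "\<exists>T. triangulation A b T"
proof -
  let ?n = "dim_col A" and ?I = "{0..<dim_row A}"
  have r: "\<And>i. row A i \<in> carrier_vec ?n" by simp
  obtain \<omega> where \<omega>: "\<And>i. \<omega> i > 0"
    and generic: "\<And>J p. J \<subseteq> ?I \<Longrightarrow> card J = Suc ?n \<Longrightarrow> p \<in> carrier_vec ?n \<Longrightarrow>
       \<exists>i\<in>J. row A i \<bullet> p \<noteq> \<omega> i"
    using generic_right_hand_side[of "dim_row A" "row A" ?n] r by metis
  let ?T = "\<lambda>v. tight_set (row A) (tight A b v) \<omega>"
  \<comment> \<open>Cells over \<open>v\<close> are the tight sets at the vertices \<open>p\<close>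
    of the local system; an objective in the normal cone of \<open>v\<close> lies in the cell of a
    \<open>p\<close> maximizing it.\<close>
  define cell where "cell = (\<lambda>v p B. is_vertex A b v \<and>
      basic_point ?n (row A) (tight A b v) \<omega> p \<and> B = ?T v p)"
  define T where "T = {B. \<exists>v p. cell v p B}"
  have tI: "tight A b v \<subseteq> ?I" for v by (auto simp: tight_def)
  have ft: "finite (tight A b v)" for v using tI finite_subset by blast
  have cellD: "B \<subseteq> tight A b v" "B \<subseteq> ?I" "card B = ?n" "absdet A B \<noteq> 0"
    if cell: "cell v p B" for v p B
  proof -
    have B: "B = ?T v p" and p: "p \<in> carrier_vec ?n" and tk: "trivial_kernel ?n (row A) B"
      using cell by (auto simp: cell_def basic_point_def dest: halfspaces_carrier)
    show Bt: "B \<subseteq> tight A b v" by (auto simp: B tight_set_def)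
    then show BI: "B \<subseteq> ?I" using tI by blast
    then have fB: "finite B" by (rule finite_subset) simp
    \<comment> \<open>The trivial kernel forces at least \<open>n\<close> rows and genericity of the
      lifting at most \<open>n\<close>: cells are simplicial however degenerate \<open>v\<close>
      is.\<close>
    have "\<not> card B < ?n"
    proof
      assume "card B < ?n"
      then obtain x where "x \<in> carrier_vec ?n" "x \<noteq> 0\<^sub>v ?n" "\<And>i. i \<in> B \<Longrightarrow> row A i \<bullet> x = 0"
        using underdetermined_kernel[OF fB, of ?n "row A"] r by metis
      then show False using trivial_kernelD[OF tk] by blast
    qed
    moreover have "\<not> Suc ?n \<le> card B"
    proof
      assume "Suc ?n \<le> card B"
      then obtain J where J: "J \<subseteq> B" "card J = Suc ?n" by (rule obtain_subset_with_card_n)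
      have "\<exists>i\<in>J. row A i \<bullet> p \<noteq> \<omega> i" using J BI p by (intro generic) auto
      then show False using J(1) by (auto simp: B tight_set_def)
    qed
    ultimately show card: "card B = ?n" by linarith
    show "absdet A B \<noteq> 0" using tk trivial_kernel_iff_absdet[OF BI card] by simp
  qed
  have face: "cone_face ?n (row_cone A B) (row_cone A B \<inter> row_cone A B')"
    if BT: "B \<in> T" "B' \<in> T" for B B'
  proof -
    obtain v p v' p' where c: "cell v p B" "cell v' p' B'" using BT by (auto simp: T_def)
    have car: "v \<in> carrier_vec ?n" "v' \<in> carrier_vec ?n" "p \<in> carrier_vec ?n" "p' \<in> carrier_vec ?n"
      using c by (auto simp: cell_def basic_point_def is_vertex_iff_basic_point dest: halfspaces_carrier)
    have le: "row A i \<bullet> v \<le> b $ i" "row A i \<bullet> v' \<le> b $ i" if "i \<in> ?I" for i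
      using c that by (auto simp: cell_def is_vertex_iff_basic_point basic_point_def halfspaces_def)
    have lp: "row A i \<bullet> p \<le> \<omega> i" if "i \<in> tight A b v" for i
      using c that by (auto simp: cell_def basic_point_def halfspaces_def)
    have lp': "row A i \<bullet> p' \<le> \<omega> i" if "i \<in> tight A b v'" for i
      using c that by (auto simp: cell_def basic_point_def halfspaces_def)
    have Beq: "i \<in> B \<longleftrightarrow> i \<in> tight A b v \<and> row A i \<bullet> p = \<omega> i"
      "i \<in> B' \<longleftrightarrow> i \<in> tight A b v' \<and> row A i \<bullet> p' = \<omega> i" for i
      using c by (auto simp: cell_def tight_set_def)
    obtain \<epsilon> where \<epsilon>: "\<epsilon> > 0"
      "\<And>i. i \<in> ?I \<Longrightarrow> row A i \<bullet> (v' - v) < 0 \<Longrightarrow> row A i \<bullet> (v' - v) + \<epsilon> * (row A i \<bullet> (p' - p)) < 0"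
      "\<And>i. i \<in> ?I \<Longrightarrow> row A i \<bullet> (v' - v) > 0 \<Longrightarrow> row A i \<bullet> (v' - v) + \<epsilon> * (row A i \<bullet> (p' - p)) > 0"
      by (rule small_perturbation_keeps_sign[of ?I "\<lambda>i. row A i \<bullet> (v' - v)" "\<lambda>i. row A i \<bullet> (p' - p)"]) auto
    \<comment> \<open>The difference of the displaced vertices \<open>v' + \<epsilon> * p'\<close>
      and \<open>v + \<epsilon> * p\<close>. A row tight at only one of \<open>v\<close>,
      \<open>v'\<close> gets its sign from \<open>v' - v\<close>; for rows tight at both, the
      first-order term decides.\<close>
    define d where "d = (v' - v) + \<epsilon> \<cdot>\<^sub>v (p' - p)"
    have ip: "row A i \<bullet> d = row A i \<bullet> (v' - v) + \<epsilon> * (row A i \<bullet> (p' - p))" for i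
      unfolding d_def using car by (intro scalar_prod_line[of _ ?n]) auto
    have dv: "row A i \<bullet> (v' - v) = row A i \<bullet> v' - row A i \<bullet> v"
      and dp: "row A i \<bullet> (p' - p) = row A i \<bullet> p' - row A i \<bullet> p" for i
      using car by (auto intro!: scalar_prod_minus_distrib[of _ ?n])
    have tv: "i \<in> tight A b u \<longleftrightarrow> i \<in> ?I \<and> row A i \<bullet> u = b $ i" for i u by (auto simp: tight_def)
    show ?thesis
    proof (rule cone_face_separation[of _ _ _ d])
      show "B \<subseteq> ?I" "B' \<subseteq> ?I" using cellD(2) c by auto
      show "d \<in> carrier_vec ?n" using car by (simp add: d_def)
      have key: "row A i \<bullet> d < 0 \<or> (row A i \<bullet> d \<le> 0 \<and> (row A i \<bullet> d = 0 \<longrightarrow> i \<in> B'))" if i: "i \<in> B" for i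
      proof -
        have i': "i \<in> ?I" "row A i \<bullet> v = b $ i" "row A i \<bullet> p = \<omega> i" using i Beq(1) tv by auto
        show ?thesis
        proof (cases "row A i \<bullet> v' = b $ i")
          case True
          then have "i \<in> tight A b v'" using i' tv by simp
          moreover have "row A i \<bullet> d = \<epsilon> * (row A i \<bullet> p' - \<omega> i)"
            using True i' by (simp add: ip dv dp)
          ultimately show ?thesis
            using lp'[of i] Beq(2)[of i] \<epsilon>(1) by (auto simp: mult_le_0_iff)
        next
          case False
          then have "row A i \<bullet> (v' - v) < 0" using le(2)[OF i'(1)] i' by (simp add: dv)
          then show ?thesis using \<epsilon>(2)[OF i'(1)] ip by simp
        qed
      qed
      show "row A i \<bullet> d \<le> 0" if "i \<in> B" for i using key[OF that] by linarith
      show "i \<in> B'" if "i \<in> B" "row A i \<bullet> d = 0" for i using key[OF that(1)] that(2) by simp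
      show "0 \<le> row A i \<bullet> d" if i: "i \<in> B'" for i
      proof -
        have i': "i \<in> ?I" "row A i \<bullet> v' = b $ i" "row A i \<bullet> p' = \<omega> i" using i Beq(2) tv by auto
        show ?thesis
        proof (cases "row A i \<bullet> v = b $ i")
          case True
          then have "i \<in> tight A b v" using i' tv by simp
          moreover have "row A i \<bullet> d = \<epsilon> * (\<omega> i - row A i \<bullet> p)"
            using True i' by (simp add: ip dv dp)
          ultimately show ?thesis using lp[of i] \<epsilon>(1) by simp
        next
          case False
          then have "row A i \<bullet> (v' - v) > 0" using le(1)[OF i'(1)] i' by (simp add: dv)
          then show ?thesis using \<epsilon>(3)[OF i'(1)] ip by simp
        qed
      qed
    qed
  qed
  have cover: "\<Union>{row_cone A B | B. B \<in> T \<and> B \<subseteq> tight A b v} = normal_cone A b v"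
    if v: "is_vertex A b v" for v
  proof (rule equalityI; rule subsetI)
    fix y assume "y \<in> \<Union>{row_cone A B | B. B \<in> T \<and> B \<subseteq> tight A b v}"
    then obtain B g where B: "B \<subseteq> tight A b v" and y: "y \<in> carrier_vec ?n" "\<forall>i\<in>B. 0 \<le> g i"
      "\<And>j. j < ?n \<Longrightarrow> y $ j = (\<Sum>i\<in>B. g i * A $$ (i, j))"
      by (auto simp: row_cone_def)
    have "y $ j = (\<Sum>i\<in>tight A b v. (if i \<in> B then g i else 0) * A $$ (i, j))" if "j < ?n" for j
      unfolding y(3)[OF that] by (rule sum.mono_neutral_cong_left) (use B ft in auto)
    then show "y \<in> normal_cone A b v"
      using y(1,2) unfolding normal_cone_def row_cone_def
      by (intro CollectI conjI exI[of _ "\<lambda>i. if i \<in> B then g i else 0"]) auto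
  next
    fix y assume "y \<in> normal_cone A b v"
    then obtain g where yc: "y \<in> carrier_vec ?n" and g: "\<forall>i\<in>tight A b v. 0 \<le> g i"
      "\<And>j. j < ?n \<Longrightarrow> y $ j = (\<Sum>i\<in>tight A b v. g i * A $$ (i, j))"
      by (auto simp: normal_cone_def row_cone_def)
    let ?Q = "halfspaces ?n (row A) (tight A b v) \<omega>"
    have full: "trivial_kernel ?n (row A) (tight A b v)"
      using v by (simp add: is_vertex_iff_basic_point basic_point_def tight_eq_tight_set)
    have "0\<^sub>v ?n \<in> ?Q" using \<omega> by (auto simp: halfspaces_def less_imp_le)
    then have ne: "?Q \<noteq> {}" by blast
    \<comment> \<open>Weak duality: the nonnegative coefficients of \<open>y\<close> bound it on the
      local system, where the origin is feasible because the lifting is positive.\<close>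
    have bd: "y \<bullet> z \<le> (\<Sum>i\<in>tight A b v. g i * \<omega> i)" if z: "z \<in> ?Q" for z
    proof -
      have "y \<bullet> z = (\<Sum>i\<in>tight A b v. g i * (row A i \<bullet> z))"
        by (rule row_cone_scalar_prod[OF halfspaces_carrier[OF z] yc g(2) tI])
      also have "\<dots> \<le> (\<Sum>i\<in>tight A b v. g i * \<omega> i)"
        using g(1) z by (intro sum_mono mult_left_mono) (auto simp: halfspaces_def)
      finally show ?thesis .
    qed
    obtain p where p: "basic_point ?n (row A) (tight A b v) \<omega> p" "maximizer ?Q y p"
      using exists_basic_maximizer[OF ft r full yc bd ne] by blast
    define B where "B = ?T v p"
    have cell: "cell v p B" using v p(1) by (simp add: cell_def B_def)
    note B = cellD[OF cell]
    have fB: "finite B" using B(2) by (rule finite_subset) simp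
    obtain h where h: "\<And>j. j < ?n \<Longrightarrow> y $ j = (\<Sum>i\<in>B. h i * row A i $ j)"
      by (rule row_combination[OF B(2-4), where y = y]) (rule that)
    have h': "y $ j = (\<Sum>i\<in>B. h i * A $$ (i, j))" if "j < ?n" for j
      using h[OF that] B(2) that by (simp add: subset_eq)
    have pQ: "p \<in> ?Q" and pc: "p \<in> carrier_vec ?n" and tk: "trivial_kernel ?n (row A) B"
      using p(1) by (auto simp: basic_point_def B_def dest: halfspaces_carrier)
    \<comment> \<open>Relaxing row \<open>k\<close> alone, with the other cell rows kept tight, is a
      feasible direction; optimality of \<open>p\<close> along it fixes the sign of the
      coefficient.\<close>
    have "h k \<ge> 0" if k: "k \<in> B" for k
    proof -
      have "card (B - {k}) < ?n" using B(3) k fB by (metis card_Diff1_less)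
      then obtain e0 where e0: "e0 \<in> carrier_vec ?n" "e0 \<noteq> 0\<^sub>v ?n" "\<And>i. i \<in> B - {k} \<Longrightarrow> row A i \<bullet> e0 = 0"
        using underdetermined_kernel[of "B - {k}" ?n "row A"] fB r by (metis finite_Diff)
      have "row A k \<bullet> e0 \<noteq> 0" using trivial_kernelD[OF tk e0(1)] e0(2,3) by blast
      then obtain e where e: "e \<in> carrier_vec ?n" "\<And>i. i \<in> B - {k} \<Longrightarrow> row A i \<bullet> e = 0" "row A k \<bullet> e < 0"
      proof (cases "row A k \<bullet> e0 < 0")
        case False
        then show ?thesis
          using e0 \<open>row A k \<bullet> e0 \<noteq> 0\<close> by (intro that[of "(-1) \<cdot>\<^sub>v e0"]) auto
      qed (use e0 that in blast)
      obtain t where t: "t > 0" "p + t \<cdot>\<^sub>v e \<in> ?Q"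
      proof (rule small_step[OF ft r pQ e(1)])
        show "row A i \<bullet> e \<le> 0" if "i \<in> tight_set (row A) (tight A b v) \<omega> p" for i
          using e(2)[of i] e(3) that by (cases "i = k") (auto simp: B_def)
      qed
      have "y \<bullet> p + t * (y \<bullet> e) \<le> y \<bullet> p"
        using p(2) t(2) scalar_prod_line[OF yc pc e(1), of t] by (auto simp: maximizer_def)
      then have "y \<bullet> e \<le> 0" using t(1) by (simp add: mult_le_0_iff)
      moreover have "y \<bullet> e = (\<Sum>i\<in>B. h i * (row A i \<bullet> e))"
        by (rule row_cone_scalar_prod[OF e(1) yc h' B(2)])
      moreover have "(\<Sum>i\<in>B. h i * (row A i \<bullet> e)) = h k * (row A k \<bullet> e)"
        using e(2) fB k by (subst sum.remove[of B k]) (auto intro!: sum.neutral)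
      ultimately show ?thesis using e(3) by (simp add: mult_le_0_iff)
    qed
    then have "y \<in> row_cone A B" using yc h' by (auto simp: row_cone_def)
    moreover have "B \<in> T" using cell by (auto simp: T_def)
    ultimately show "y \<in> \<Union>{row_cone A B | B. B \<in> T \<and> B \<subseteq> tight A b v}" using B(1) by blast
  qed
  have "triangulation A b T"
    unfolding triangulation_def
  proof (intro conjI ballI allI impI)
    fix B assume "B \<in> T"
    then obtain v p where c: "cell v p B" by (auto simp: T_def)
    note B = cellD[OF c]
    show "B \<subseteq> ?I" "card B = ?n" using B by auto
    show "lin_indep_fam ?n ?n (row (submatrix A B UNIV))"
      using lin_indep_rows_iff_absdet[OF B(2,3)] B(4) by simp
    show "\<exists>v. is_vertex A b v \<and> B \<subseteq> tight A b v" using c B(1) by (auto simp: cell_def)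
  next
    fix B B' assume "B \<in> T" "B' \<in> T"
    then show "cone_face ?n (row_cone A B) (row_cone A B \<inter> row_cone A B')"
      and "cone_face ?n (row_cone A B') (row_cone A B \<inter> row_cone A B')"
      using face[of B B'] face[of B' B] by (simp_all add: Int_commute)
  qed (rule cover)
  then show ?thesis by blast
qed

text \<open>As a triangulation exists and there are finitely many, the maximum is attained by some
  \<open>T\<close>, whose cells at each vertex inherit the bound.\<close>

lemma Delta_min_properties:
  assumes rank: "full_column_rank A" and v0: "is_vertex A b v0"
  shows "Delta_min A b > 0"
    and "is_vertex A b v \<Longrightarrow> \<exists>B. B \<subseteq> tight A b v \<and> card B = dim_col A \<and> Delta_min A b \<le> absdet A B"
proof -
  let ?S = "{Min (absdet A ` T) | T. triangulation A b T}"
  have sub: "T \<subseteq> Pow {0..<dim_row A}" if "triangulation A b T" for T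
    using that by (auto simp: triangulation_def)
  have "finite ((\<lambda>T. Min (absdet A ` T)) ` Pow (Pow {0..<dim_row A}))" by simp
  then have fin: "finite ?S" by (rule rev_finite_subset) (use sub in auto)
  have "?S \<noteq> {}" using triangulation_exists[OF rank] by blast
  from Max_in[OF fin this] obtain T where T: "triangulation A b T" "Delta_min A b = Min (absdet A ` T)"
    by (auto simp: Delta_min_def)
  have finT: "finite T" using sub[OF T(1)] by (rule finite_subset) simp
  \<comment> \<open>The zero vector lies in every normal cone, so some cell must cover it.\<close>
  have ex: "\<exists>B\<in>T. B \<subseteq> tight A b v" if "is_vertex A b v" for v
  proof -
    have "0\<^sub>v (dim_col A) \<in> normal_cone A b v"
      by (auto simp: normal_cone_def row_cone_def intro!: exI[of _ "\<lambda>_. 0"])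
    then show ?thesis using T(1) that unfolding triangulation_def by blast
  qed
  have pos: "absdet A B > 0" if "B \<in> T" for B
  proof -
    have "B \<subseteq> {0..<dim_row A}" "card B = dim_col A"
      "lin_indep_fam (dim_col A) (dim_col A) (row (submatrix A B UNIV))"
      using T(1) that by (auto simp: triangulation_def)
    then have "absdet A B \<noteq> 0" using lin_indep_rows_iff_absdet by blast
    then show ?thesis by (simp add: absdet_def)
  qed
  have "absdet A ` T \<noteq> {}" using ex[OF v0] by blast
  then show "Delta_min A b > 0" using Min_in[of "absdet A ` T"] finT pos T(2) by auto
  assume "is_vertex A b v"
  then obtain B where "B \<in> T" "B \<subseteq> tight A b v" using ex by blast
  moreover have "Delta_min A b \<le> absdet A B" using \<open>B \<in> T\<close> finT T(2) by simp
  moreover have "card B = dim_col A" using T(1) \<open>B \<in> T\<close> by (auto simp: triangulation_def)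
  ultimately show "\<exists>B. B \<subseteq> tight A b v \<and> card B = dim_col A \<and> Delta_min A b \<le> absdet A B" by blast
qed

section \<open>Counting the cones crossed by a random path\<close>

text \<open>Along the moment curve each hyperplane becomes a polynomial equation. Exponents start at
  1, so that \<open>c\<close> cannot cancel a coefficient of the normal; \<open>x\<close> between 0
  and 1 keeps all coordinates there.\<close>

lemma avoid_finitely_many_hyperplanes:
  fixes F :: "((nat \<Rightarrow> real) \<times> real) set"
  assumes F: "finite F" and nz: "\<And>f. f \<in> F \<Longrightarrow> \<exists>k<n. fst f k \<noteq> 0"
  shows "\<exists>\<xi>. (\<forall>k. 0 < \<xi> k \<and> \<xi> k < 1) \<and> (\<forall>(\<delta>, c)\<in>F. (\<Sum>k<n. \<xi> k * \<delta> k) \<noteq> c)"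
proof -
  define q where "q = (\<lambda>(\<delta>, c). (\<Sum>k<n. monom (\<delta> k) (Suc k)) - [:c::real:])"
  have q0: "q f \<noteq> 0" if f: "f \<in> F" for f
  proof -
    obtain \<delta> c where f': "f = (\<delta>, c)" by (cases f)
    obtain k where k: "k < n" "\<delta> k \<noteq> 0" using nz[OF f] f' by auto
    have "coeff (q f) (Suc k) = \<delta> k" using k(1) by (simp add: q_def f' coeff_sum)
    then show ?thesis using k by auto
  qed
  then have "finite (\<Union>f\<in>F. {x. poly (q f) x = 0})" using F poly_roots_finite by blast
  moreover have "infinite {0<..<1::real}" by (simp add: infinite_Ioo)
  ultimately have "\<not> {0<..<1} \<subseteq> (\<Union>f\<in>F. {x. poly (q f) x = 0})" using finite_subset by blast
  then obtain x where x: "0 < x" "x < 1" "x \<notin> (\<Union>f\<in>F. {x. poly (q f) x = 0})"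
    by (metis greaterThanLessThan_iff subsetI)
  show ?thesis
  proof (intro exI[of _ "\<lambda>k. x ^ Suc k"] conjI allI ballI)
    show "0 < x ^ Suc k" for k using x by simp
    show "x ^ Suc k < 1" for k by (rule power_Suc_less_one) (use x in auto)
    fix f assume "f \<in> F"
    moreover have "(\<Sum>k<n. x ^ Suc k * \<delta> k) \<noteq> c" if "(\<delta>, c) \<in> F" for \<delta> c
    proof
      assume "(\<Sum>k<n. x ^ Suc k * \<delta> k) = c"
      then have "poly (q (\<delta>, c)) x = 0" by (simp add: q_def poly_sum poly_monom mult.commute)
      then show False using x(3) that by blast
    qed
    ultimately show "case f of (\<delta>, c) \<Rightarrow> (\<Sum>k<n. x ^ Suc k * \<delta> k) \<noteq> c" by (cases f) auto
  qed
qed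

section \<open>Lattice boxes and fans of wide cones\<close>

definition pairing :: "nat \<Rightarrow> (nat \<Rightarrow> real) \<Rightarrow> (nat \<Rightarrow> real) \<Rightarrow> real" where
  "pairing n g x = (\<Sum>k<n. g k * x k)"

lemma pairing_add: "pairing n (\<lambda>k. f k + g k) x = pairing n f x + pairing n g x"
  by (simp add: pairing_def algebra_simps sum.distrib)

lemma pairing_scale: "pairing n (\<lambda>k. c * g k) x = c * pairing n g x"
  by (simp add: pairing_def algebra_simps sum_distrib_left)

lemma pairing_cong: "(\<And>k. k < n \<Longrightarrow> f k = g k) \<Longrightarrow> pairing n f x = pairing n g x"
  by (simp add: pairing_def)

text \<open>Half-open, so that \<open>grid n 0 (int M)\<close> has exactly \<open>M ^ n\<close>
  points; extensionality makes each lattice point one function.\<close>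

definition grid :: "nat \<Rightarrow> int \<Rightarrow> int \<Rightarrow> (nat \<Rightarrow> int) set" where
  "grid n l r = {..<n} \<rightarrow>\<^sub>E {l..<r}"

lemma finite_grid [simp]: "finite (grid n l r)"
  by (simp add: grid_def finite_PiE)

lemma card_grid: "card (grid n l r) = nat (r - l) ^ n"
  by (simp add: grid_def card_PiE)

text \<open>A finite point configuration \<open>\<beta> ` V\<close>; \<open>opt g v\<close> says that \<open>g\<close> lies in the
  normal cone of \<open>v\<close>. The lattice vector \<open>h v\<close> is the centre of a unit ball of
  the maximum norm inside that cone.\<close>

locale wide_fan =
  fixes n :: nat and V :: "'v set" and \<beta> :: "'v \<Rightarrow> nat \<Rightarrow> real" and h :: "'v \<Rightarrow> nat \<Rightarrow> int" and H :: nat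
  assumes n_pos: "n \<ge> 1" and H_pos: "H \<ge> 1" and finV: "finite V" and V_ne: "V \<noteq> {}"
    and \<beta>_inj: "\<And>v w. v \<in> V \<Longrightarrow> w \<in> V \<Longrightarrow> v \<noteq> w \<Longrightarrow> \<exists>k<n. \<beta> v k \<noteq> \<beta> w k"
    and h_bound: "\<And>v k. v \<in> V \<Longrightarrow> k < n \<Longrightarrow> \<bar>h v k\<bar> \<le> int H"
    and h_ball: "\<And>v w g. v \<in> V \<Longrightarrow> w \<in> V \<Longrightarrow> (\<And>k. k < n \<Longrightarrow> \<bar>g k - of_int (h v k)\<bar> \<le> 1) \<Longrightarrow>
      pairing n g (\<beta> w) \<le> pairing n g (\<beta> v)"
begin

definition opt :: "(nat \<Rightarrow> real) \<Rightarrow> 'v \<Rightarrow> bool" where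
  "opt g v \<longleftrightarrow> v \<in> V \<and> (\<forall>w\<in>V. pairing n g (\<beta> w) \<le> pairing n g (\<beta> v))"

lemma opt_cong: "(\<And>k. k < n \<Longrightarrow> f k = g k) \<Longrightarrow> opt f v \<longleftrightarrow> opt g v"
  using pairing_cong[of n f g] by (simp add: opt_def)

lemma opt_add: "opt f v \<Longrightarrow> opt g v \<Longrightarrow> opt (\<lambda>k. f k + g k) v"
  by (auto simp: opt_def pairing_add intro: add_mono)

lemma opt_scale: "opt g v \<Longrightarrow> c \<ge> 0 \<Longrightarrow> opt (\<lambda>k. c * g k) v"
  by (auto simp: opt_def pairing_scale intro: mult_left_mono)

lemma opt_scale_iff: "c > 0 \<Longrightarrow> opt (\<lambda>k. c * g k) v \<longleftrightarrow> opt g v"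
  by (auto simp: opt_def pairing_scale)

lemma opt_ball: "v \<in> V \<Longrightarrow> (\<And>k. k < n \<Longrightarrow> \<bar>g k - of_int (h v k)\<bar> \<le> 1) \<Longrightarrow> opt g v"
  using h_ball by (simp add: opt_def)

lemma opt_exists: "\<exists>v. opt g v"
proof -
  let ?P = "(\<lambda>v. pairing n g (\<beta> v)) ` V"
  have f: "finite ?P" "?P \<noteq> {}" using finV V_ne by auto
  obtain v where "v \<in> V" "pairing n g (\<beta> v) = Max ?P" using Max_in[OF f] by auto
  then show ?thesis using f by (auto simp: opt_def)
qed

lemma opt_V: "opt g v \<Longrightarrow> v \<in> V" by (simp add: opt_def)

text \<open>Cones that the segment enters or leaves; a cone containing the whole segment costs
  nothing.\<close>

definition crossed :: "(real \<Rightarrow> nat \<Rightarrow> real) \<Rightarrow> 'v set" where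
  "crossed s = {v. (\<exists>t\<in>{0..1}. opt (s t) v) \<and> (\<exists>t\<in>{0..1}. \<not> opt (s t) v)}"

definition visited :: "(real \<Rightarrow> nat \<Rightarrow> real) \<Rightarrow> 'v set" where
  "visited s = {v. \<exists>t\<in>{0..1}. opt (s t) v}"

lemma finite_crossed [simp]: "finite (crossed s)"
  by (rule finite_subset[OF _ finV]) (auto simp: crossed_def opt_V)

lemma finite_visited [simp]: "finite (visited s)"
  by (rule finite_subset[OF _ finV]) (auto simp: visited_def opt_V)

lemma reverse_unit_interval: "(\<exists>t\<in>{0..1::real}. P (1 - t)) \<longleftrightarrow> (\<exists>t\<in>{0..1}. P t)"
proof
  assume "\<exists>t\<in>{0..1}. P t"
  then obtain t where "t \<in> {0..1}" "P t" by blast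
  then show "\<exists>t\<in>{0..1}. P (1 - t)" by (intro bexI[of _ "1 - t"]) auto
next
  assume "\<exists>t\<in>{0..1}. P (1 - t)"
  then obtain t where "t \<in> {0..1}" "P (1 - t)" by blast
  then show "\<exists>t\<in>{0..1}. P t" by (intro bexI[of _ "1 - t"]) auto
qed

lemma crossed_reverse: "crossed (\<lambda>t. s (1 - t)) = crossed s"
  unfolding crossed_def
  by (simp add: reverse_unit_interval[of "\<lambda>t. opt (s t) _"] reverse_unit_interval[of "\<lambda>t. \<not> opt (s t) _"])

text \<open>If a segment of length at most 1 starting at \<open>X + b\<close> enters or leaves the cone of
  \<open>v\<close>, then \<open>X + b + h v\<close> lies in the cone and \<open>X + b - h v\<close> does not. Since each
  lattice point belongs to just one cone, the number of such pairs is at most the number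
  of lattice points within distance \<open>H\<close> of the boundary of the box.\<close>

lemma sum_crossed_le:
  fixes b :: "nat \<Rightarrow> real" and W :: "(nat \<Rightarrow> int) \<Rightarrow> nat \<Rightarrow> real"
  assumes M: "2 * H \<le> M"
    and untied: "\<And>z v w. z \<in> grid n (- int H) (int M + int H) \<Longrightarrow>
      opt (\<lambda>k. of_int (z k) + b k) v \<Longrightarrow> opt (\<lambda>k. of_int (z k) + b k) w \<Longrightarrow> v = w"
    and W: "\<And>X k. X \<in> grid n 0 (int M) \<Longrightarrow> k < n \<Longrightarrow> \<bar>W X k\<bar> \<le> 1"
  shows "(\<Sum>X\<in>grid n 0 (int M). card (crossed (\<lambda>t k. of_int (X k) + b k + t * W X k)))
      + (M - 2 * H) ^ n \<le> (M + 2 * H) ^ n"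
proof -
  let ?G = "grid n 0 (int M)"
  let ?big = "grid n (- int H) (int M + int H)" and ?small = "grid n (int H) (int M - int H)"
  let ?D = "\<lambda>X. crossed (\<lambda>t k. of_int (X k) + b k + t * W X k)"
  define up where "up = (\<lambda>X v k. of_int (X k + h v k) + b k)"
  define dn where "dn = (\<lambda>X v k. of_int (X k - h v k) + b k)"
  define P where "P = {(X, v). X \<in> ?G \<and> opt (up X v) v}"
  define N where "N = {(X, v). X \<in> ?G \<and> opt (dn X v) v}"
  have finP: "finite P" unfolding P_def
    by (rule finite_subset[of _ "?G \<times> V"]) (auto simp: finV opt_V)
  have near: "opt (\<lambda>k. of_int (h v k) + g k) v" if "v \<in> V" "\<And>k. k < n \<Longrightarrow> \<bar>g k\<bar> \<le> 1" for v g
    using that by (intro opt_ball) auto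
  have NP: "N \<subseteq> P"
  proof -
    have "opt (up X v) v" if "opt (dn X v) v" for X v
    proof -
      have "opt (\<lambda>k. of_int (h v k)) v" using near[of v "\<lambda>_. 0"] opt_V[OF that] by simp
      then have "opt (\<lambda>k. dn X v k + (of_int (h v k) + of_int (h v k))) v"
        by (intro opt_add that)
      then show ?thesis by (simp add: up_def dn_def algebra_simps)
    qed
    then show ?thesis by (auto simp: N_def P_def)
  qed
  have "Sigma ?G ?D \<subseteq> P - N"
  proof clarify
    fix X v assume X: "X \<in> ?G" and v: "v \<in> ?D X"
    obtain t where t: "t \<in> {0..1}" "opt (\<lambda>k. of_int (X k) + b k + t * W X k) v"
      using v by (auto simp: crossed_def)
    obtain t' where t': "t' \<in> {0..1}" "\<not> opt (\<lambda>k. of_int (X k) + b k + t' * W X k) v"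
      using v by (auto simp: crossed_def)
    have small: "\<bar>r * W X k\<bar> \<le> 1" if "r \<in> {0..1}" "k < n" for r k
      using W[OF X that(2)] that(1) by (auto simp: abs_mult intro: mult_le_one)
    have vV: "v \<in> V" using t(2) by (rule opt_V)
    \<comment> \<open>The unit ball absorbs the motion: \<open>X + b + h v\<close> is the segment
      point at time \<open>t\<close> plus a vector of the cone. Likewise the point at time
      \<open>t'\<close> is \<open>X + b - h v\<close> plus a vector of the cone.\<close>
    have "opt (\<lambda>k. of_int (h v k) + - (t * W X k)) v"
      using small[OF t(1)] by (intro near vV) auto
    from opt_add[OF t(2) this] have "opt (up X v) v" by (simp add: up_def algebra_simps)
    moreover have "\<not> opt (dn X v) v"
    proof
      assume d: "opt (dn X v) v"
      have "opt (\<lambda>k. of_int (h v k) + t' * W X k) v"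
        using small[OF t'(1)] by (intro near vV) auto
      from opt_add[OF d this] show False using t'(2) by (simp add: dn_def algebra_simps)
    qed
    ultimately show "(X, v) \<in> P - N" using X by (auto simp: P_def N_def)
  qed
  then have "card (Sigma ?G ?D) \<le> card (P - N)" using finP by (intro card_mono) auto
  also have "\<dots> = card P - card N" using NP finP by (intro card_Diff_subset) (auto intro: finite_subset)
  finally have "(\<Sum>X\<in>?G. card (?D X)) \<le> card P - card N" by simp
  moreover have "card N \<le> card P" using NP finP by (rule card_mono[rotated])
  moreover have "card P \<le> (M + 2 * H) ^ n"
  proof -
    \<comment> \<open>The forward shift lands in the enlarged box, where its cone is unique; so the
      image determines \<open>v\<close>, and with it \<open>X\<close>.\<close>
    let ?f = "\<lambda>(X, v). \<lambda>k\<in>{..<n}. X k + h v k"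
    have restr: "opt (\<lambda>k. of_int (restrict (\<lambda>k. X k + h v k) {..<n} k) + b k) v" if "(X, v) \<in> P" for X v
      using that opt_cong[of "up X v" "\<lambda>k. of_int (restrict (\<lambda>k. X k + h v k) {..<n} k) + b k" v]
      by (auto simp: P_def up_def)
    have big: "restrict (\<lambda>k. X k + h v k) {..<n} \<in> ?big" if "(X, v) \<in> P" for X v
      unfolding grid_def
    proof (rule restrict_PiE_iff[THEN iffD2], intro ballI)
      fix k assume k: "k \<in> {..<n}"
      have "X k \<in> {0..<int M}" using that k by (auto simp: P_def grid_def PiE_iff)
      moreover have "\<bar>h v k\<bar> \<le> int H" using that k by (intro h_bound) (auto simp: P_def opt_V)
      ultimately show "X k + h v k \<in> {- int H..<int M + int H}" by auto
    qed
    have "inj_on ?f P"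
    proof (rule inj_onI, clarify)
      fix X v Y w assume p: "(X, v) \<in> P" "(Y, w) \<in> P"
        and eq: "(\<lambda>k\<in>{..<n}. X k + h v k) = (\<lambda>k\<in>{..<n}. Y k + h w k)"
      have vw: "v = w" using untied[OF big[OF p(1)] restr[OF p(1)]] restr[OF p(2)] eq by simp
      have "X = Y"
      proof (rule PiE_ext[where k = "{..<n}" and s = "\<lambda>_. {0..<int M}"])
        show "X \<in> {..<n} \<rightarrow>\<^sub>E {0..<int M}" "Y \<in> {..<n} \<rightarrow>\<^sub>E {0..<int M}"
          using p by (auto simp: P_def grid_def)
        show "X k = Y k" if "k \<in> {..<n}" for k
          using fun_cong[OF eq, of k] vw that by simp
      qed
      then show "X = Y \<and> v = w" using vw by simp
    qed
    then have "card P \<le> card ?big" using big by (intro card_inj_on_le[of ?f]) auto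
    also have "\<dots> = (M + 2 * H) ^ n"
    proof -
      have "nat (int M + int H - (- int H)) = M + 2 * H" by arith
      then show ?thesis by (simp only: card_grid)
    qed
    finally show ?thesis .
  qed
  moreover have "(M - 2 * H) ^ n \<le> card N"
  proof -
    \<comment> \<open>Any cone containing a point of the inner box will do: adding its centre stays
      in the grid, and the backward shift returns to the point.\<close>
    define c where "c = (\<lambda>z. SOME v. opt (\<lambda>k. of_int (z k) + b k) v)"
    have c: "opt (\<lambda>k. of_int (z k) + b k) (c z)" for z
      unfolding c_def by (rule someI_ex) (rule opt_exists)
    let ?f = "\<lambda>z. (\<lambda>k\<in>{..<n}. z k + h (c z) k, c z)"
    have "inj_on ?f ?small"
    proof (rule inj_onI)
      fix z z' assume z: "z \<in> ?small" "z' \<in> ?small" and eq: "?f z = ?f z'"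
      show "z = z'"
      proof (rule PiE_ext[where k = "{..<n}" and s = "\<lambda>_. {int H..<int M - int H}"])
        show "z \<in> {..<n} \<rightarrow>\<^sub>E {int H..<int M - int H}" "z' \<in> {..<n} \<rightarrow>\<^sub>E {int H..<int M - int H}"
          using z by (auto simp: grid_def)
        have eq1: "(\<lambda>k\<in>{..<n}. z k + h (c z) k) = (\<lambda>k\<in>{..<n}. z' k + h (c z') k)" and eq2: "c z = c z'"
          using eq by auto
        show "z k = z' k" if "k \<in> {..<n}" for k
          using fun_cong[OF eq1, of k] eq2 that by simp
      qed
    qed
    moreover have "?f z \<in> N" if z: "z \<in> ?small" for z
    proof -
      have "(\<lambda>k\<in>{..<n}. z k + h (c z) k) \<in> ?G"
        unfolding grid_def
      proof (rule restrict_PiE_iff[THEN iffD2], intro ballI)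
        fix k assume k: "k \<in> {..<n}"
        have "z k \<in> {int H..<int M - int H}" using z k by (auto simp: grid_def PiE_iff)
        moreover have "\<bar>h (c z) k\<bar> \<le> int H" using k by (intro h_bound opt_V[OF c]) auto
        ultimately show "z k + h (c z) k \<in> {0..<int M}" by auto
      qed
      moreover have "opt (dn (\<lambda>k\<in>{..<n}. z k + h (c z) k) (c z)) (c z)"
        using c[of z] opt_cong[of "dn (\<lambda>k\<in>{..<n}. z k + h (c z) k) (c z)" "\<lambda>k. of_int (z k) + b k"]
        by (simp add: dn_def)
      ultimately show ?thesis by (simp add: N_def)
    qed
    ultimately have "card ?small \<le> card N"
      using finP NP by (intro card_inj_on_le[of ?f]) (auto intro: finite_subset)
    moreover have "card ?small = (M - 2 * H) ^ n"
    proof -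
      have "nat (int M - int H - int H) = M - 2 * H" by arith
      then show ?thesis by (simp only: card_grid)
    qed
    ultimately show ?thesis by simp
  qed
  ultimately show ?thesis by linarith
qed

text \<open>A cone visited but never crossed contains every segment it meets. Walking back through
  the joints, it contains the start, where \<open>u\<close> alone is optimal.\<close>

lemma card_visited_chain_le:
  assumes start: "\<And>v. opt (s 0 0) v \<Longrightarrow> v = u"
    and link: "\<And>j v. Suc j < J \<Longrightarrow> opt (s j 1) v \<longleftrightarrow> opt (s (Suc j) 0) v"
  shows "card (\<Union>j<J. visited (s j)) \<le> 1 + (\<Sum>j<J. card (crossed (s j)))"
proof -
  have "(\<Union>j<J. visited (s j)) \<subseteq> insert u (\<Union>j<J. crossed (s j))"
  proof
    fix v assume "v \<in> (\<Union>j<J. visited (s j))"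
    then obtain j where j: "j < J" "v \<in> visited (s j)" by blast
    show "v \<in> insert u (\<Union>j<J. crossed (s j))"
    proof (cases "v \<in> (\<Union>j<J. crossed (s j))")
      case False
      then have all: "opt (s i 0) v" if "i < J" "v \<in> visited (s i)" for i
        using that by (auto simp: crossed_def visited_def)
      have "i \<le> j \<Longrightarrow> opt (s (j - i) 0) v" for i
      proof (induction i)
        case 0
        then show ?case using all j by simp
      next
        case (Suc i)
        have e: "Suc (j - Suc i) = j - i" using Suc.prems by simp
        have "opt (s (j - i) 0) v" using Suc by simp
        then have "opt (s (j - Suc i) 1) v" using link[of "j - Suc i" v] j(1) e by simp
        then have "v \<in> visited (s (j - Suc i))" by (auto simp: visited_def intro!: bexI[of _ 1])
        then show ?case using all j(1) by simp
      qed
      from this[of j] have "v = u" using start by simp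
      then show ?thesis by simp
    qed simp
  qed
  then have "card (\<Union>j<J. visited (s j)) \<le> card (insert u (\<Union>j<J. crossed (s j)))"
    by (intro card_mono) auto
  also have "\<dots> \<le> 1 + card (\<Union>j<J. crossed (s j))" by (simp add: card_insert_if)
  also have "\<dots> \<le> 1 + (\<Sum>j<J. card (crossed (s j)))" using card_UN_le[of "{..<J}"] by simp
  finally show ?thesis .
qed

section \<open>From random grid points to a short path of objectives\<close>

lemma exists_generic_offset:
  fixes b :: "nat \<Rightarrow> nat \<Rightarrow> real"
  shows "\<exists>\<xi>. (\<forall>k. 0 < \<xi> k \<and> \<xi> k < 1) \<and> (\<forall>j<J. \<forall>z\<in>grid n l r. \<forall>v w.
      opt (\<lambda>k. of_int (z k) + (\<xi> k + b j k)) v \<longrightarrow> opt (\<lambda>k. of_int (z k) + (\<xi> k + b j k)) w \<longrightarrow> v = w)"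
proof -
  \<comment> \<open>A tie of \<open>v\<close> and \<open>w\<close> is one affine equation in the
    offset with normal \<open>\<beta> v - \<beta> w\<close>, nonzero by \<open>\<beta>_inj\<close>.
    One offset has to serve all \<open>J\<close> base points.\<close>
  define f where "f = (\<lambda>(j, z, v, w). (\<lambda>k. \<beta> v k - \<beta> w k,
      - (\<Sum>k<n. (of_int (z k) + b j k) * (\<beta> v k - \<beta> w k))))"
  define S where "S = {..<J} \<times> grid n l r \<times> {(v, w) \<in> V \<times> V. v \<noteq> w}"
  have "finite {(v, w) \<in> V \<times> V. v \<noteq> w}"
    by (rule finite_subset[of _ "V \<times> V"]) (auto simp: finV)
  then have fin: "finite (f ` S)" by (simp add: S_def)
  have nz: "\<exists>k<n. fst \<delta> k \<noteq> 0" if "\<delta> \<in> f ` S" for \<delta>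
    using that \<beta>_inj by (auto simp: f_def S_def)
  from avoid_finitely_many_hyperplanes[OF fin nz] obtain \<xi> where \<xi>: "\<And>k. 0 < \<xi> k" "\<And>k. \<xi> k < 1"
    and ne: "\<And>\<delta> c. (\<delta>, c) \<in> f ` S \<Longrightarrow> (\<Sum>k<n. \<xi> k * \<delta> k) \<noteq> c"
    by blast
  show ?thesis
  proof (intro exI[of _ \<xi>] conjI allI ballI impI)
    show "0 < \<xi> k" "\<xi> k < 1" for k by (rule \<xi>)+
  next
    fix j z v w
    assume j: "j < J" and z: "z \<in> grid n l r"
      and o: "opt (\<lambda>k. of_int (z k) + (\<xi> k + b j k)) v" "opt (\<lambda>k. of_int (z k) + (\<xi> k + b j k)) w"
    show "v = w"
    proof (rule ccontr)
      assume vw: "v \<noteq> w"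
      have "pairing n (\<lambda>k. of_int (z k) + (\<xi> k + b j k)) (\<beta> v)
          = pairing n (\<lambda>k. of_int (z k) + (\<xi> k + b j k)) (\<beta> w)"
        using o by (auto simp: opt_def intro: antisym)
      then have "(\<Sum>k<n. (of_int (z k) + (\<xi> k + b j k)) * (\<beta> v k - \<beta> w k)) = 0"
        by (simp add: pairing_def right_diff_distrib sum_subtractf)
      moreover have "(\<Sum>k<n. (of_int (z k) + (\<xi> k + b j k)) * (\<beta> v k - \<beta> w k))
          = (\<Sum>k<n. \<xi> k * (\<beta> v k - \<beta> w k)) + (\<Sum>k<n. (of_int (z k) + b j k) * (\<beta> v k - \<beta> w k))"
        unfolding sum.distrib[symmetric] by (intro sum.cong refl) (simp add: algebra_simps)
      ultimately have "(\<Sum>k<n. \<xi> k * (\<beta> v k - \<beta> w k))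
          = - (\<Sum>k<n. (of_int (z k) + b j k) * (\<beta> v k - \<beta> w k))"
        by linarith
      moreover have "f (j, z, v, w) \<in> f ` S"
        using j z vw o by (auto simp: S_def opt_V)
      then have "(\<Sum>k<n. \<xi> k * (\<beta> v k - \<beta> w k))
          \<noteq> - (\<Sum>k<n. (of_int (z k) + b j k) * (\<beta> v k - \<beta> w k))"
        using ne by (auto simp: f_def)
      ultimately show False by contradiction
    qed
  qed
qed

text \<open>With \<open>P = X + \<xi>\<close> for a random grid point \<open>X\<close>, the path runs from
  \<open>P + M h(u)\<close> along the points \<open>P + \<sigma> h(u)\<close>, where \<open>\<sigma>\<close> decreases geometrically from
  \<open>M\<close> to about \<open>M / H\<close>, then straight to \<open>P + \<sigma> h(v)\<close>, and back up to \<open>P + M h(v)\<close>. Cones being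
  invariant under scaling, a geometric step is replaced by the segment from \<open>P + \<sigma> h(u)\<close> to
  \<open>(1 + 1/M) P + \<sigma> h(u)\<close>, whose length is at most 1. Thus the outer legs cost only
  logarithmically many passes of \<open>M\<close> unit steps.\<close>

lemma shadow_path:
  assumes uV: "u \<in> V" and vV: "v \<in> V"
  obtains J :: nat and s :: "nat \<Rightarrow> real \<Rightarrow> nat \<Rightarrow> real"
  where "J \<ge> 1" "opt (s 0 0) u" "opt (s (J - 1) 1) v"
    "\<And>j w. Suc j < J \<Longrightarrow> opt (s j 1) w \<longleftrightarrow> opt (s (Suc j) 0) w"
    "real (card (\<Union>j<J. visited (s j))) \<le> 1 + 24 * real n * real H * (ln (real H) + 1)"
    "\<And>j. j < J \<Longrightarrow> \<exists>p d. \<forall>t k. s j t k = p k + t * d k"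
    "\<And>j t. j < J \<Longrightarrow> t \<in> {0..1} \<Longrightarrow> \<exists>x c c'. (\<forall>k<n. x k \<ge> 0) \<and> c \<ge> 0 \<and> c' \<ge> 0 \<and>
       (\<forall>k<n. s j t k = x k + c * of_int (h u k) + c' * of_int (h v k))"
proof -
  \<comment> \<open>A smaller box would raise the crossings per step, a larger one the number of
    steps; here \<open>M + 2 * H\<close> is \<open>M * (1 + 1 / n)\<close>.\<close>
  define M where "M = 2 * n * H"
  have M2: "M \<ge> 2" using n_pos H_pos by (simp add: M_def)
  have MH: "2 * H \<le> M" using n_pos by (simp add: M_def)
  have Mpos: "real M > 0" using M2 by simp
  define q where "q = 1 + 1 / real M"
  have q1: "q > 1" using Mpos by (simp add: q_def)
  \<comment> \<open>As \<open>ln q \<ge> 1 / (2 * M)\<close>, this many factors \<open>q\<close>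
    reach \<open>H\<close>, and the scale drops to at most \<open>M / H\<close>. The
    \<open>+ 1\<close> keeps the leg nonempty for \<open>H = 1\<close>.\<close>
  define J1 where "J1 = nat \<lceil>2 * real M * ln (real H)\<rceil> + 1"
  have lnH: "ln (real H) \<ge> 0" using H_pos by simp
  have J1_ge: "2 * real M * ln (real H) \<le> real J1" unfolding J1_def by linarith
  have J1_le: "real J1 \<le> 2 * real M * ln (real H) + 2"
  proof -
    have "0 \<le> 2 * real M * ln (real H)" using lnH by simp
    then show ?thesis unfolding J1_def by linarith
  qed
  define \<sigma> where "\<sigma> = (\<lambda>i::nat. real M / q ^ i)"
  have \<sigma>_Suc: "\<sigma> i = q * \<sigma> (Suc i)" for i using q1 by (simp add: \<sigma>_def)
  have \<sigma>_pos: "\<sigma> i > 0" for i using q1 Mpos by (simp add: \<sigma>_def)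
  have \<sigma>_J1: "\<sigma> J1 * real H \<le> real M"
  proof -
    have "ln (1 / q) \<le> 1 / q - 1" by (rule ln_le_minus_one) (use q1 in simp)
    then have "1 - 1 / q \<le> ln q" using q1 by (simp add: ln_div)
    moreover have "1 - 1 / q = 1 / (real M + 1)" using Mpos by (simp add: q_def field_simps)
    moreover have "1 / (2 * real M) \<le> 1 / (real M + 1)" using M2 by (intro divide_left_mono) auto
    ultimately have "1 / (2 * real M) \<le> ln q" by linarith
    then have "real J1 * (1 / (2 * real M)) \<le> real J1 * ln q" by (rule mult_left_mono) simp
    moreover have "ln (real H) \<le> real J1 * (1 / (2 * real M))" using J1_ge Mpos by (simp add: field_simps)
    ultimately have "ln (real H) \<le> ln (q ^ J1)" using q1 by (simp add: ln_realpow)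
    then have "real H \<le> q ^ J1" using q1 H_pos by simp
    then show ?thesis using q1 Mpos by (simp add: \<sigma>_def field_simps)
  qed
  \<comment> \<open>The ends of the middle leg differ by at most
    \<open>\<sigma> J1 * 2 * H \<le> 2 * M\<close> per coordinate, hence \<open>2 * M\<close> steps
    of length at most 1.\<close>
  define J where "J = 2 * J1 + 2 * M"
  define mid where "mid = (\<lambda>i k. \<sigma> J1 * (of_int (h u k) + real i / (2 * real M) * of_int (h v k - h u k)))"
  define b where "b = (\<lambda>j k. if j < J1 then \<sigma> j * of_int (h u k)
    else if j < J1 + 2 * M then mid (j - J1) k else \<sigma> (J - 1 - j) * of_int (h v k))"
  obtain \<xi> where \<xi>: "\<And>k. 0 < \<xi> k" "\<And>k. \<xi> k < 1"
    and untied: "\<And>j z v w. j < J \<Longrightarrow> z \<in> grid n (- int H) (int M + int H) \<Longrightarrow>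
      opt (\<lambda>k. of_int (z k) + (\<xi> k + b j k)) v \<Longrightarrow> opt (\<lambda>k. of_int (z k) + (\<xi> k + b j k)) w \<Longrightarrow> v = w"
    using exists_generic_offset[of J "- int H" "int M + int H" b] by blast
  let ?G = "grid n 0 (int M)"
  define P where "P = (\<lambda>X k. of_int (X k) + \<xi> k :: real)"
  have P01: "0 \<le> P X k" "P X k \<le> real M" if "X \<in> ?G" "k < n" for X k
  proof -
    have "X k \<in> {0..<int M}" using that by (auto simp: grid_def PiE_iff)
    then have "0 \<le> X k" "X k \<le> int M - 1" by auto
    then have "0 \<le> real_of_int (X k)" "real_of_int (X k) \<le> real M - 1" by linarith+
    then show "0 \<le> P X k" "P X k \<le> real M" using \<xi>[of k] by (simp_all add: P_def)
  qed
  define W where "W = (\<lambda>j X k. if J1 \<le> j \<and> j < J1 + 2 * M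
    then \<sigma> J1 / (2 * real M) * of_int (h v k - h u k) else P X k / real M)"
  have W1: "\<bar>W j X k\<bar> \<le> 1" if X: "X \<in> ?G" and k: "k < n" for j X k
  proof (cases "J1 \<le> j \<and> j < J1 + 2 * M")
    case True
    have "\<bar>h v k - h u k\<bar> \<le> 2 * int H" using h_bound[OF uV k] h_bound[OF vV k] by linarith
    then have "\<bar>real_of_int (h v k - h u k)\<bar> \<le> 2 * real H" by linarith
    then have "\<sigma> J1 * \<bar>real_of_int (h v k - h u k)\<bar> \<le> \<sigma> J1 * (2 * real H)"
      using \<sigma>_pos by (intro mult_left_mono) (auto intro: less_imp_le)
    also have "\<dots> \<le> 2 * real M" using \<sigma>_J1 by simp
    finally have "\<sigma> J1 * \<bar>real_of_int (h v k - h u k)\<bar> / (2 * real M) \<le> 1" using Mpos by simp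
    moreover have "\<bar>W j X k\<bar> = \<sigma> J1 * \<bar>real_of_int (h v k - h u k)\<bar> / (2 * real M)"
      using True \<sigma>_pos[of J1] Mpos by (simp add: W_def abs_mult)
    ultimately show ?thesis by simp
  next
    case False
    then show ?thesis using P01[OF X k] Mpos by (auto simp: W_def)
  qed
  \<comment> \<open>The last leg runs its segments backwards: the counting lemma needs as base the
    unstretched end, a grid point plus an offset independent of \<open>X\<close>.\<close>
  define seg where "seg = (\<lambda>X j t k. P X k + b j k + (if j < J1 + 2 * M then t else 1 - t) * W j X k)"
  have crossed_seg: "crossed (seg X j) = crossed (\<lambda>t k. of_int (X k) + (\<xi> k + b j k) + t * W j X k)" for X j
  proof -
    let ?s = "\<lambda>t k. of_int (X k) + (\<xi> k + b j k) + t * W j X k"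
    have "seg X j = (if j < J1 + 2 * M then ?s else (\<lambda>t. ?s (1 - t)))"
      by (auto simp: seg_def P_def fun_eq_iff)
    then show ?thesis using crossed_reverse[of ?s] by simp
  qed
  have one: "(\<Sum>X\<in>?G. card (crossed (seg X j))) \<le> (M + 2 * H) ^ n" if j: "j < J" for j
    using sum_crossed_le[OF MH, of "\<lambda>k. \<xi> k + b j k" "W j"] untied[OF j] W1 unfolding crossed_seg by fastforce
  have card_G: "card ?G = M ^ n" by (simp add: card_grid)
  have growth: "real (M + 2 * H) ^ n \<le> 3 * real M ^ n"
  proof -
    have "real (M + 2 * H) = real M * (1 + 1 / real n)"
      using n_pos by (simp add: M_def field_simps)
    moreover have "(1 + 1 / real n) ^ n \<le> (3::real)"
    proof -
      have "(1 + 1 / real n) ^ n \<le> exp (1 / real n) ^ n"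
        by (intro power_mono exp_ge_add_one_self) auto
      also have "\<dots> = exp 1" using n_pos by (simp flip: exp_of_nat_mult)
      finally show ?thesis using exp_le by linarith
    qed
    then have "real M ^ n * (1 + 1 / real n) ^ n \<le> real M ^ n * 3" by (intro mult_left_mono) auto
    ultimately show ?thesis by (simp only: power_mult_distrib mult.commute[of 3])
  qed
  \<comment> \<open>Averaging: each segment has at most \<open>3 * M ^ n\<close> crossings summed
    over the \<open>M ^ n\<close> grid points.\<close>
  have "\<exists>X\<in>?G. real (\<Sum>j<J. card (crossed (seg X j))) \<le> 3 * real J"
  proof (rule ccontr)
    assume "\<not> ?thesis"
    then have gt: "3 * real J < real (\<Sum>j<J. card (crossed (seg X j)))" if "X \<in> ?G" for X using that by force
    have "(\<lambda>k. if k < n then 0 else undefined) \<in> ?G" using M2 by (auto simp: grid_def PiE_iff extensional_def)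
    then have "(\<Sum>X\<in>?G. 3 * real J) < (\<Sum>X\<in>?G. real (\<Sum>j<J. card (crossed (seg X j))))"
      using gt by (intro sum_strict_mono) auto
    also have "\<dots> = (\<Sum>j<J. real (\<Sum>X\<in>?G. card (crossed (seg X j))))"
      by (simp add: sum.swap[of _ ?G])
    also have "\<dots> \<le> (\<Sum>j<J. 3 * real M ^ n)"
    proof (rule sum_mono)
      fix j assume "j \<in> {..<J}"
      then have "real (\<Sum>X\<in>?G. card (crossed (seg X j))) \<le> real ((M + 2 * H) ^ n)"
        using one[of j] by (intro of_nat_mono) simp
      then show "real (\<Sum>X\<in>?G. card (crossed (seg X j))) \<le> 3 * real M ^ n" using growth by simp
    qed
    finally show False by (simp add: card_G)
  qed
  then obtain X where X: "X \<in> ?G" and few: "real (\<Sum>j<J. card (crossed (seg X j))) \<le> 3 * real J" by blast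
  \<comment> \<open>The joints of the path. Segment ends equal them up to a factor 1 or
    \<open>q\<close>, which \<open>opt\<close> ignores; so consecutive segments link without having
    to meet.\<close>
  define node where "node = (\<lambda>j k. P X k + (if j \<le> J1 then \<sigma> j * of_int (h u k)
    else if j \<le> J1 + 2 * M then mid (j - J1) k else \<sigma> (J - j) * of_int (h v k)))"
  have mid_Suc: "mid (Suc i) k = mid i k + \<sigma> J1 / (2 * real M) * of_int (h v k - h u k)" for i k
  proof -
    have "s * (y + (1 + r) / m * d) = s * (y + r / m * d) + s / m * d" for s y r m d :: real
      by (simp add: add_divide_distrib algebra_simps)
    then show ?thesis unfolding mid_def of_nat_Suc .
  qed
  have mid_0: "mid 0 k = \<sigma> J1 * of_int (h u k)" for k by (simp add: mid_def)
  have mid_2M: "mid (2 * M) k = \<sigma> J1 * of_int (h v k)" for k using Mpos by (simp add: mid_def)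
  have PM: "P X k + P X k / real M = q * P X k" for k by (simp add: q_def algebra_simps)
  have seg_node: "(\<exists>c>0. \<forall>k. seg X j 0 k = c * node j k) \<and> (\<exists>c>0. \<forall>k. seg X j 1 k = c * node (Suc j) k)"
    if j: "j < J" for j
  proof -
    consider "j < J1" | "J1 \<le> j" "j < J1 + 2 * M" | "J1 + 2 * M \<le> j" by linarith
    then show ?thesis
    proof cases
      case 1
      have f0: "seg X j 0 k = 1 * node j k" for k using 1 by (simp add: seg_def b_def node_def)
      have f1: "seg X j 1 k = q * node (Suc j) k" for k
      proof -
        have "seg X j 1 k = (P X k + P X k / real M) + \<sigma> j * of_int (h u k)"
          using 1 by (simp add: seg_def b_def W_def)
        then show ?thesis using 1 unfolding PM \<sigma>_Suc[of j] by (simp add: node_def algebra_simps)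
      qed
      show ?thesis
        using f0 f1 q1 by (intro conjI[OF exI[of _ 1] exI[of _ q]]) auto
    next
      case 2
      have f0: "seg X j 0 k = 1 * node j k" for k
        using 2 mid_0[of k] by (auto simp: seg_def b_def node_def)
      have f1: "seg X j 1 k = 1 * node (Suc j) k" for k
        using 2 mid_Suc[of "j - J1" k] by (simp add: seg_def b_def W_def node_def Suc_diff_le)
      show ?thesis
        using f0 f1 by (intro conjI[OF exI[of _ 1] exI[of _ 1]]) auto
    next
      case 3
      define i where "i = J - 1 - j"
      have i: "J - j = Suc i" "J - Suc j = i" using j by (auto simp: i_def)
      have n0: "node j k = P X k + \<sigma> (Suc i) * of_int (h v k)" for k
      proof (cases "j = J1 + 2 * M")
        case True
        have "Suc i = J1" using True i(1) by (simp add: J_def)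
        moreover have "node j k = P X k + mid (2 * M) k" using True M2 by (simp add: node_def)
        ultimately show ?thesis by (simp only: mid_2M)
      next
        case False
        then show ?thesis using 3 i by (simp add: node_def)
      qed
      have n1: "node (Suc j) k = P X k + \<sigma> i * of_int (h v k)" for k using 3 i by (simp add: node_def)
      have f1: "seg X j 1 k = 1 * node (Suc j) k" for k
        using 3 by (simp add: n1 seg_def b_def i_def)
      have f0: "seg X j 0 k = q * node j k" for k
      proof -
        have "seg X j 0 k = (P X k + P X k / real M) + \<sigma> i * of_int (h v k)"
          using 3 by (simp add: seg_def b_def W_def i_def)
        then show ?thesis unfolding n0 PM \<sigma>_Suc[of i] by (simp add: algebra_simps)
      qed
      show ?thesis
        using f0 f1 q1 by (intro conjI[OF exI[of _ q] exI[of _ 1]]) auto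
    qed
  qed
  have opt_seg: "opt (seg X j 0) w \<longleftrightarrow> opt (node j) w" "opt (seg X j 1) w \<longleftrightarrow> opt (node (Suc j)) w"
    if j: "j < J" for j w
  proof -
    obtain c where c: "c > 0" "seg X j 0 = (\<lambda>k. c * node j k)" using seg_node[OF j] by (auto simp: fun_eq_iff)
    then show "opt (seg X j 0) w \<longleftrightarrow> opt (node j) w" using opt_scale_iff by simp
    obtain c where c: "c > 0" "seg X j 1 = (\<lambda>k. c * node (Suc j) k)" using seg_node[OF j] by (auto simp: fun_eq_iff)
    then show "opt (seg X j 1) w \<longleftrightarrow> opt (node (Suc j)) w" using opt_scale_iff by simp
  qed
  \<comment> \<open>\<open>P X k / M\<close> lies between 0 and 1, so it stays in the unit ball
    around the centre; scaling by \<open>M\<close> gives the outer end.\<close>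
  have ends: "opt (\<lambda>k. P X k + real M * of_int (h w k)) w" if "w \<in> V" for w
  proof -
    have "opt (\<lambda>k. of_int (h w k) + P X k / real M) w"
    proof (rule opt_ball[OF that])
      fix k assume "k < n"
      then show "\<bar>of_int (h w k) + P X k / real M - of_int (h w k)\<bar> \<le> 1" using P01[OF X, of k] Mpos by simp
    qed
    then have "opt (\<lambda>k. real M * (of_int (h w k) + P X k / real M)) w" using Mpos by (intro opt_scale) auto
    then show ?thesis using Mpos by (simp add: algebra_simps)
  qed
  have J1_pos: "J1 > 0" and J_pos: "J > 0" by (auto simp: J1_def J_def)
  have node_0: "node 0 = (\<lambda>k. P X k + real M * of_int (h u k))" using J1_pos by (auto simp: node_def \<sigma>_def)
  have node_J: "node J = (\<lambda>k. P X k + real M * of_int (h v k))"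
    using J1_pos by (auto simp: node_def \<sigma>_def J_def)
  show ?thesis
  proof (rule that[of J "seg X"])
    show "1 \<le> J" using J_pos by simp
    show s0: "opt (seg X 0 0) u" using opt_seg(1)[OF J_pos] ends[OF uV] node_0 by simp
    show "opt (seg X (J - 1) 1) v" using opt_seg(2)[of "J - 1" v] ends[OF vV] node_J J_pos by simp
    show link: "opt (seg X j 1) w \<longleftrightarrow> opt (seg X (Suc j) 0) w" if "Suc j < J" for j w
      using that opt_seg(2)[of j w] opt_seg(1)[of "Suc j" w] by simp
    have "X \<in> grid n (- int H) (int M + int H)"
    proof -
      have "{..<n} \<rightarrow>\<^sub>E {0..<int M} \<subseteq> {..<n} \<rightarrow>\<^sub>E {- int H..<int M + int H}" by (intro PiE_mono) auto
      then show ?thesis using X by (auto simp: grid_def)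
    qed
    then have "w = u" if "opt (seg X 0 0) w" for w
      using untied[OF J_pos, of X w u] that s0 J1_pos by (simp add: seg_def P_def add.assoc)
    then have "card (\<Union>j<J. visited (seg X j)) \<le> 1 + (\<Sum>j<J. card (crossed (seg X j)))"
      by (rule card_visited_chain_le) (use link in auto)
    then have "real (card (\<Union>j<J. visited (seg X j))) \<le> real (1 + (\<Sum>j<J. card (crossed (seg X j))))"
      by (rule of_nat_mono)
    also have "\<dots> \<le> 1 + 3 * real J" using few by simp
    \<comment> \<open>Three times \<open>4 * M * ln H + 4 + 2 * M\<close>, where
      \<open>4 \<le> 2 * M\<close>; then \<open>M = 2 * n * H\<close> turns 12 into 24.\<close>
    also have "\<dots> \<le> 1 + 24 * real n * real H * (ln (real H) + 1)"
    proof -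
      have "real J \<le> 4 * (real M * ln (real H)) + 4 + 2 * real M" using J1_le by (simp add: J_def)
      moreover have "4 \<le> 2 * real M" using M2 by simp
      ultimately have "3 * real J \<le> 12 * (real M * ln (real H)) + 12 * real M" by linarith
      then show ?thesis by (simp add: M_def algebra_simps)
    qed
    finally show "real (card (\<Union>j<J. visited (seg X j))) \<le> 1 + 24 * real n * real H * (ln (real H) + 1)" .
  next
    fix j assume "j < J"
    show "\<exists>p d. \<forall>t k. seg X j t k = p k + t * d k"
    proof (cases "j < J1 + 2 * M")
      case True
      then show ?thesis
        by (intro exI[of _ "\<lambda>k. P X k + b j k"] exI[of _ "W j X"]) (simp add: seg_def)
    next
      case False
      then show ?thesis
        by (intro exI[of _ "\<lambda>k. P X k + b j k + W j X k"] exI[of _ "\<lambda>k. - W j X k"])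
          (simp add: seg_def algebra_simps)
    qed
  next
    fix j t assume j: "j < J" and t: "t \<in> {0..1::real}"
    let ?hu = "\<lambda>k. real_of_int (h u k)" and ?hv = "\<lambda>k. real_of_int (h v k)"
    consider "j < J1" | "J1 \<le> j" "j < J1 + 2 * M" | "J1 + 2 * M \<le> j" by linarith
    then show "\<exists>x c c'. (\<forall>k<n. x k \<ge> 0) \<and> c \<ge> 0 \<and> c' \<ge> 0 \<and> (\<forall>k<n. seg X j t k = x k + c * ?hu k + c' * ?hv k)"
    proof cases
      case 1
      then show ?thesis
        using t P01[OF X] Mpos \<sigma>_pos[of j]
        by (intro exI[of _ "\<lambda>k. P X k + t * (P X k / real M)"] exI[of _ "\<sigma> j"] exI[of _ 0])
          (auto simp: seg_def b_def W_def intro!: add_nonneg_nonneg mult_nonneg_nonneg)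
    next
      case 2
      define r where "r = (real (j - J1) + t) / (2 * real M)"
      have "real (j - J1) + t \<le> 2 * real M"
      proof -
        have "real (j - J1) + 1 \<le> 2 * real M" using 2 by linarith
        then show ?thesis using t by simp
      qed
      then have r: "0 \<le> r" "r \<le> 1" using t Mpos by (auto simp: r_def)
      have "seg X j t k = P X k + (\<sigma> J1 * (1 - r)) * ?hu k + (\<sigma> J1 * r) * ?hv k" for k
      proof -
        have gen: "s * (y + r / m * d) + t * (s / m * d) = s * (y + (r + t) / m * d)" for s y r m d :: real
          by (simp add: add_divide_distrib algebra_simps)
        have "seg X j t k = P X k + (\<sigma> J1 * (?hu k + real (j - J1) / (2 * real M) * (?hv k - ?hu k))
            + t * (\<sigma> J1 / (2 * real M) * (?hv k - ?hu k)))"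
          using 2 by (simp add: seg_def b_def W_def mid_def)
        also have "\<dots> = P X k + \<sigma> J1 * (?hu k + r * (?hv k - ?hu k))"
          unfolding gen r_def ..
        finally show ?thesis by (simp add: algebra_simps)
      qed
      then show ?thesis
        using r P01[OF X] \<sigma>_pos[of J1]
        by (intro exI[of _ "P X"] exI[of _ "\<sigma> J1 * (1 - r)"] exI[of _ "\<sigma> J1 * r"]) auto
    next
      case 3
      then show ?thesis
        using t P01[OF X] Mpos \<sigma>_pos[of "J - 1 - j"]
        by (intro exI[of _ "\<lambda>k. P X k + (1 - t) * (P X k / real M)"] exI[of _ 0] exI[of _ "\<sigma> (J - 1 - j)"])
          (auto simp: seg_def b_def W_def intro!: add_nonneg_nonneg mult_nonneg_nonneg)
    qed
  qed
qed

end

section \<open>The diameter bound\<close>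

lemma graph_path_le_mono:
  assumes "graph_path_le A b u v k" "k \<le> k'"
  shows "graph_path_le A b u v k'"
proof -
  obtain ps where "ps \<noteq> []" "hd ps = u" "last ps = v" "\<forall>i < length ps. is_vertex A b (ps ! i)"
    "\<forall>i. Suc i < length ps \<longrightarrow> adjacent A b (ps ! i) (ps ! Suc i)" "real (length ps - 1) \<le> k"
    using assms(1) unfolding graph_path_le_def by blast
  then show ?thesis using assms(2) unfolding graph_path_le_def by (intro exI[of _ ps]) simp
qed

lemma rtrancl_distinct_path:
  assumes "(x, y) \<in> R\<^sup>*"
  shows "\<exists>ps. ps \<noteq> [] \<and> hd ps = x \<and> last ps = y \<and> distinct ps \<and> set ps \<subseteq> insert x (Range R) \<and>
    (\<forall>i. Suc i < length ps \<longrightarrow> (ps ! i, ps ! Suc i) \<in> R)"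
  using assms
proof (induction rule: rtrancl_induct)
  case base
  show ?case by (intro exI[of _ "[x]"]) simp
next
  case (step y z)
  then obtain ps where ps: "ps \<noteq> []" "hd ps = x" "last ps = y" "distinct ps" "set ps \<subseteq> insert x (Range R)"
    "\<And>i. Suc i < length ps \<Longrightarrow> (ps ! i, ps ! Suc i) \<in> R" by blast
  show ?case
  proof (cases "z \<in> set ps")
    case True
    \<comment> \<open>A revisited point closes a cycle; the path is cut back to its earlier
      visit.\<close>
    then obtain k where k: "k < length ps" "ps ! k = z" by (auto simp: in_set_conv_nth)
    let ?qs = "take (Suc k) ps"
    have "hd ?qs = x" using ps(1,2) by (simp add: hd_take)
    moreover have "last ?qs = z" using k by (simp add: take_Suc_conv_app_nth)
    moreover have "set ?qs \<subseteq> insert x (Range R)" using ps(5) set_take_subset by fastforce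
    moreover have "(?qs ! i, ?qs ! Suc i) \<in> R" if "Suc i < length ?qs" for i using that ps(6)[of i] by simp
    ultimately show ?thesis using ps(1,4) by (intro exI[of _ ?qs]) auto
  next
    case False
    let ?qs = "ps @ [z]"
    have "(?qs ! i, ?qs ! Suc i) \<in> R" if i: "Suc i < length ?qs" for i
    proof (cases "Suc i < length ps")
      case True
      then show ?thesis using ps(6)[of i] by (simp add: nth_append)
    next
      case False
      then have "Suc i = length ps" using i by simp
      then have "?qs ! i = y" "?qs ! Suc i = z"
        using ps(1,3) by (auto simp: nth_append last_conv_nth simp flip: \<open>Suc i = length ps\<close>)
      then show ?thesis using step(2) by simp
    qed
    then show ?thesis using ps False step(2) by (intro exI[of _ ?qs]) auto
  qed
qed

text \<open>A path in \<open>S\<close> without repetition has at most \<open>card S\<close> vertices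
  and one edge less, hence \<open>1 + k\<close>.\<close>

lemma graph_path_le_rtrancl:
  assumes uv: "(u, v) \<in> {(x, y). adjacent A b x y \<and> x \<in> S \<and> y \<in> S}\<^sup>*"
    and u: "is_vertex A b u" "u \<in> S" and S: "finite S" and k: "real (card S) \<le> 1 + k"
  shows "graph_path_le A b u v k"
proof -
  let ?R = "{(x, y). adjacent A b x y \<and> x \<in> S \<and> y \<in> S}"
  obtain ps where ps: "ps \<noteq> []" "hd ps = u" "last ps = v" "distinct ps" "set ps \<subseteq> insert u (Range ?R)"
    "\<And>i. Suc i < length ps \<Longrightarrow> (ps ! i, ps ! Suc i) \<in> ?R"
    using rtrancl_distinct_path[OF uv] by blast
  have "set ps \<subseteq> S" using ps(5) u(2) by auto
  then have "length ps \<le> card S" using card_mono[OF S] distinct_card[OF ps(4)] by metis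
  then have "real (length ps - 1) \<le> k" using k ps(1) by (cases ps) auto
  moreover have "is_vertex A b (ps ! i)" if "i < length ps" for i
  proof -
    have "ps ! i \<in> insert u (Range ?R)" using ps(5) nth_mem[OF that] by (rule subsetD)
    then show ?thesis using u(1) by (auto simp: adjacent_def)
  qed
  moreover have "adjacent A b (ps ! i) (ps ! Suc i)" if "Suc i < length ps" for i using ps(6)[OF that] by simp
  ultimately show ?thesis using ps(1-3) by (auto simp: graph_path_le_def intro!: exI[of _ ps])
qed

section \<open>The vertices of the polyhedron as a wide fan\<close>

text \<open>The rows \<open>\<sigma> 0, \<dots>, \<sigma> (n - 1)\<close> serve as coordinate vectors for objective functions.\<close>

locale vertex_fan =
  fixes A :: "real mat" and b :: "real vec" and \<sigma> :: "nat \<Rightarrow> nat" and h :: "real vec \<Rightarrow> nat \<Rightarrow> int" and H :: nat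
  assumes dim_pos: "dim_col A \<ge> 1" and rank: "full_column_rank A" and H_ge: "H \<ge> 1"
    and vertex_exists: "\<exists>w. is_vertex A b w"
    and \<sigma>: "\<And>k. k < dim_col A \<Longrightarrow> \<sigma> k < dim_row A"
    and \<sigma>_det: "det (mat\<^sub>r (dim_col A) (dim_col A) (\<lambda>k. row A (\<sigma> k))) \<noteq> 0"
    and h_le: "\<And>w k. is_vertex A b w \<Longrightarrow> k < dim_col A \<Longrightarrow> \<bar>h w k\<bar> \<le> int H"
    and h_max: "\<And>w g x. is_vertex A b w \<Longrightarrow> (\<And>k. k < dim_col A \<Longrightarrow> \<bar>g k - of_int (h w k)\<bar> \<le> 1) \<Longrightarrow>
      x \<in> polyhedron A b \<Longrightarrow>
      pairing (dim_col A) g (\<lambda>k. row A (\<sigma> k) \<bullet> x) \<le> pairing (dim_col A) g (\<lambda>k. row A (\<sigma> k) \<bullet> w)"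
begin

abbreviation "n \<equiv> dim_col A"
abbreviation "V \<equiv> {w. is_vertex A b w}"
abbreviation "\<beta> \<equiv> \<lambda>x k. row A (\<sigma> k) \<bullet> x"

lemma vertex_in_polyhedron: "is_vertex A b w \<Longrightarrow> w \<in> polyhedron A b"
  by (simp add: is_vertex_iff_basic_point basic_point_def polyhedron_eq_halfspaces)

lemma polyhedron_carrier: "x \<in> polyhedron A b \<Longrightarrow> x \<in> carrier_vec n"
  by (simp add: polyhedron_def)

lemma finite_vertices: "finite V"
  unfolding is_vertex_iff_basic_point by (rule finite_basic_points) auto

sublocale wide_fan n V \<beta> h H
proof
  show "1 \<le> n" by (rule dim_pos)
  show "1 \<le> H" by (rule H_ge)
  show "finite V" by (rule finite_vertices)
  show "V \<noteq> {}" using vertex_exists by blast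
  show "\<exists>k<n. \<beta> v k \<noteq> \<beta> w k" if "v \<in> V" "w \<in> V" "v \<noteq> w" for v w
  proof (rule ccontr)
    assume "\<not> ?thesis"
    then have eq: "\<forall>k<n. row A (\<sigma> k) \<bullet> v = row A (\<sigma> k) \<bullet> w" by blast
    have c: "v \<in> carrier_vec n" "w \<in> carrier_vec n"
      using that vertex_in_polyhedron polyhedron_carrier by auto
    have "v - w \<noteq> 0\<^sub>v n" using c \<open>v \<noteq> w\<close> by (auto simp: vec_eq_iff)
    moreover have "\<forall>k<n. row A (\<sigma> k) \<bullet> (v - w) = 0"
      using eq c by (auto simp: scalar_prod_minus_distrib[of _ n])
    ultimately have "det (mat\<^sub>r n n (\<lambda>k. row A (\<sigma> k))) = 0"
      using c by (subst det_rows_eq_0_iff) auto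
    then show False using \<sigma>_det by contradiction
  qed
  show "\<bar>h v k\<bar> \<le> int H" if "v \<in> V" "k < n" for v k using h_le that by simp
  show "pairing n g (\<beta> w) \<le> pairing n g (\<beta> v)"
    if "v \<in> V" "w \<in> V" "\<And>k. k < n \<Longrightarrow> \<bar>g k - of_int (h v k)\<bar> \<le> 1" for v w g
    using that h_max vertex_in_polyhedron by blast
qed

definition objective :: "(nat \<Rightarrow> real) \<Rightarrow> real vec" where
  "objective g = vec n (\<lambda>j. \<Sum>k<n. g k * row A (\<sigma> k) $ j)"

lemma objective_carrier [simp]: "objective g \<in> carrier_vec n"
  by (simp add: objective_def)

lemma objective_scalar_prod: "x \<in> carrier_vec n \<Longrightarrow> objective g \<bullet> x = pairing n g (\<beta> x)"
  unfolding objective_def pairing_def by (rule sum_rows_scalar_prod) auto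

text \<open>The condition under which optimality among the vertices, \<open>opt\<close>, means
  optimality on the whole polyhedron.\<close>

definition bounded_objective :: "(nat \<Rightarrow> real) \<Rightarrow> bool" where
  "bounded_objective g \<longleftrightarrow> (\<exists>C. \<forall>x\<in>polyhedron A b. pairing n g (\<beta> x) \<le> C)"

lemma opt_iff_maximizer:
  assumes g: "bounded_objective g"
  shows "opt g w \<longleftrightarrow> is_vertex A b w \<and> maximizer (polyhedron A b) (objective g) w"
proof -
  let ?P = "polyhedron A b" and ?I = "{0..<dim_row A}"
  obtain C where C: "\<And>x. x \<in> ?P \<Longrightarrow> pairing n g (\<beta> x) \<le> C" using g by (auto simp: bounded_objective_def)
  have ip: "objective g \<bullet> x = pairing n g (\<beta> x)" if "x \<in> ?P" for x
    using that by (intro objective_scalar_prod polyhedron_carrier)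
  have bd: "objective g \<bullet> z \<le> C" if "z \<in> halfspaces n (row A) ?I (($) b)" for z
    using that C ip by (simp add: polyhedron_eq_halfspaces)
  have ne: "halfspaces n (row A) ?I (($) b) \<noteq> {}"
    using vertex_exists vertex_in_polyhedron by (auto simp: polyhedron_eq_halfspaces)
  obtain w0 where w0: "is_vertex A b w0" "maximizer ?P (objective g) w0"
    using exists_basic_maximizer[OF _ _ full_column_rank_trivial_kernel[OF rank] objective_carrier bd ne]
    by (auto simp: is_vertex_iff_basic_point polyhedron_eq_halfspaces)
  have w0': "pairing n g (\<beta> x) \<le> pairing n g (\<beta> w0)" if "x \<in> ?P" for x
    using w0 that ip by (auto simp: maximizer_def)
  show ?thesis
  proof
    assume o: "opt g w"
    then have w: "is_vertex A b w" using opt_V by blast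
    have "pairing n g (\<beta> w0) \<le> pairing n g (\<beta> w)" using o w0(1) by (simp add: opt_def)
    then have "pairing n g (\<beta> x) \<le> pairing n g (\<beta> w)" if "x \<in> ?P" for x using w0'[OF that] by linarith
    then show "is_vertex A b w \<and> maximizer ?P (objective g) w"
      using w vertex_in_polyhedron[OF w] ip by (auto simp: maximizer_def)
  next
    assume "is_vertex A b w \<and> maximizer ?P (objective g) w"
    then show "opt g w" using ip vertex_in_polyhedron by (auto simp: opt_def maximizer_def)
  qed
qed

definition step_in :: "real vec set \<Rightarrow> (real vec \<times> real vec) set" where
  "step_in S = {(x, y). adjacent A b x y \<and> x \<in> S \<and> y \<in> S}"

lemma opt_connected:
  assumes g: "bounded_objective g" and w: "opt g v" "opt g w" and S: "\<And>w. opt g w \<Longrightarrow> w \<in> S"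
  shows "(v, w) \<in> (step_in S)\<^sup>*"
proof -
  let ?Q = "halfspaces n (row A) {0..<dim_row A} (($) b)"
  let ?R = "{(v, w). edge n ?Q v w \<and> basic_point n (row A) {0..<dim_row A} (($) b) v
    \<and> basic_point n (row A) {0..<dim_row A} (($) b) w
    \<and> maximizer ?Q (objective g) v \<and> maximizer ?Q (objective g) w}"
  have opt_iff: "opt g x \<longleftrightarrow> basic_point n (row A) {0..<dim_row A} (($) b) x \<and> maximizer ?Q (objective g) x" for x
    using opt_iff_maximizer[OF g, of x]
    unfolding is_vertex_iff_basic_point[of A b x] polyhedron_eq_halfspaces .
  have "(v, w) \<in> ?R\<^sup>*"
    by (rule maximizers_connected) (use w in \<open>auto simp: opt_iff\<close>)
  moreover have "?R \<subseteq> step_in S"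
  proof clarify
    fix x y assume e: "edge n ?Q x y"
      and x: "basic_point n (row A) {0..<dim_row A} (($) b) x" "maximizer ?Q (objective g) x"
      and y: "basic_point n (row A) {0..<dim_row A} (($) b) y" "maximizer ?Q (objective g) y"
    have "is_face A b (segment_vec x y)" "x \<noteq> y"
      using e unfolding is_face_def edge_def polyhedron_eq_halfspaces by blast+
    then have "adjacent A b x y"
      using x y by (simp add: adjacent_def is_vertex_iff_basic_point)
    moreover have "x \<in> S" "y \<in> S" using x y S opt_iff by auto
    ultimately show "(x, y) \<in> step_in S" by (simp add: step_in_def)
  qed
  ultimately show ?thesis using rtrancl_mono by blast
qed

text \<open>Objective values are affine in \<open>t\<close>, so optimality is an intersection of
  closed conditions.\<close>

lemma closed_opt_times:
  assumes s: "\<And>t k. s t k = p k + t * d k"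
  shows "closed {t::real. opt (s t) w}"
proof (cases "w \<in> V")
  case True
  have "s t = (\<lambda>k. p k + t * d k)" for t using s by (intro ext)
  then have "pairing n (s t) x = pairing n p x + t * pairing n d x" for t x
    by (simp add: pairing_add pairing_scale)
  then have "{t. opt (s t) w} = (\<Inter>w'\<in>V. {t. pairing n p (\<beta> w') + t * pairing n d (\<beta> w')
      \<le> pairing n p (\<beta> w) + t * pairing n d (\<beta> w)})"
    using True by (auto simp: opt_def)
  also have "closed \<dots>" by (intro closed_INT ballI closed_Collect_le continuous_intros)
  finally show ?thesis .
qed (simp add: opt_def)

text \<open>By connectedness of the unit interval: the times of the reachable and of the unreachable
  vertices would be two closed sets covering it, so they share a time. Both kinds are then optimal
  for one objective and joined within its optimal face.\<close>

lemma visited_connected: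
  assumes s: "\<And>t k. s t k = p k + t * d k" and bd: "\<And>t. t \<in> {0..1} \<Longrightarrow> bounded_objective (s t)"
    and S: "visited s \<subseteq> S" and w: "w1 \<in> visited s" "w2 \<in> visited s"
  shows "(w1, w2) \<in> (step_in S)\<^sup>*"
proof (rule ccontr)
  assume no: "(w1, w2) \<notin> (step_in S)\<^sup>*"
  define T where "T = (\<lambda>W. \<Union>w\<in>W. {t. opt (s t) w})"
  define R where "R = {w \<in> visited s. (w1, w) \<in> (step_in S)\<^sup>*}"
  have cl: "closed (T W)" if "W \<subseteq> visited s" for W
    unfolding T_def by (intro closed_UN ballI closed_opt_times[of s p d] s finite_subset[OF that]) auto
  have "closed (T R)" "closed (T (visited s - R))" by (auto intro!: cl simp: R_def)
  moreover have "{0..1} \<subseteq> T R \<union> T (visited s - R)"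
  proof
    fix t :: real assume t: "t \<in> {0..1}"
    obtain w where w: "opt (s t) w" using opt_exists by blast
    then have "w \<in> visited s" using t by (auto simp: visited_def)
    then show "t \<in> T R \<union> T (visited s - R)" using w by (auto simp: T_def)
  qed
  moreover have "T R \<inter> {0..1} \<noteq> {}" using w(1) by (auto simp: T_def R_def visited_def)
  moreover have "T (visited s - R) \<inter> {0..1} \<noteq> {}" using w(2) no by (auto simp: T_def R_def visited_def)
  ultimately have "T R \<inter> T (visited s - R) \<inter> {0..1} \<noteq> {}"
    using connected_Icc[of "0::real" 1] unfolding connected_closed by metis
  then obtain t where t01: "t \<in> T R" "t \<in> T (visited s - R)" "t \<in> {0..1}" by blast
  obtain v where v: "v \<in> R" "opt (s t) v" using t01(1) by (auto simp: T_def)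
  obtain w where w': "w \<in> visited s" "w \<notin> R" "opt (s t) w" using t01(2) by (auto simp: T_def)
  note t = t01(3) v(2) w'(3) and vw = v(1) w'(1,2)
  have "(v, w) \<in> (step_in S)\<^sup>*"
  proof (rule opt_connected[OF bd[OF t(1)] t(2,3)])
    fix x assume "opt (s t) x"
    then have "x \<in> visited s" using t(1) by (auto simp: visited_def)
    then show "x \<in> S" using S by blast
  qed
  moreover have "(w1, v) \<in> (step_in S)\<^sup>*" using vw(1) by (simp add: R_def)
  ultimately have "(w1, w) \<in> (step_in S)\<^sup>*" by (rule rtrancl_trans[rotated])
  then show False using vw(2,3) by (simp add: R_def)
qed

lemma short_path:
  assumes u: "is_vertex A b u" and v: "is_vertex A b v"
  shows "graph_path_le A b u v (24 * real n * real H * (ln (real H) + 1))"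
proof -
  obtain J s where J: "J \<ge> 1" and s0: "opt (s 0 0) u" and s1: "opt (s (J - 1) 1) v"
    and link: "\<And>j w. Suc j < J \<Longrightarrow> opt (s j 1) w \<longleftrightarrow> opt (s (Suc j) 0) w"
    and card: "real (card (\<Union>j<J. visited (s j))) \<le> 1 + 24 * real n * real H * (ln (real H) + 1)"
    and affine: "\<And>j. j < J \<Longrightarrow> \<exists>p d. \<forall>t k. s j t k = p k + t * d k"
    and comb: "\<And>j t. j < J \<Longrightarrow> t \<in> {0..1} \<Longrightarrow> \<exists>x c c'. (\<forall>k<n. x k \<ge> 0) \<and> c \<ge> 0 \<and> c' \<ge> 0 \<and>
       (\<forall>k<n. s j t k = x k + c * of_int (h u k) + c' * of_int (h v k))"
    using shadow_path[of u v] u v by auto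
  have bd: "bounded_objective (s j t)" if jt: "j < J" "t \<in> {0..1}" for j t
  proof -
    obtain x c c' where x: "\<forall>k<n. x k \<ge> 0" and c: "c \<ge> 0" "c' \<ge> 0"
      and eq: "\<forall>k<n. s j t k = x k + c * of_int (h u k) + c' * of_int (h v k)" using comb[OF jt] by blast
    let ?hu = "\<lambda>k. real_of_int (h u k)" and ?hv = "\<lambda>k. real_of_int (h v k)"
    \<comment> \<open>Coordinate rows with nonnegative weights are bounded by the right-hand sides,
      the centres by their values at \<open>u\<close> and \<open>v\<close>.\<close>
    have "pairing n (s j t) (\<beta> z) \<le> (\<Sum>k<n. x k * b $ \<sigma> k) + c * pairing n ?hu (\<beta> u) + c' * pairing n ?hv (\<beta> v)"
      if z: "z \<in> polyhedron A b" for z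
    proof -
      have "pairing n (s j t) (\<beta> z) = pairing n (\<lambda>k. x k + c * ?hu k + c' * ?hv k) (\<beta> z)"
        using eq by (intro pairing_cong) auto
      also have "\<dots> = pairing n x (\<beta> z) + c * pairing n ?hu (\<beta> z) + c' * pairing n ?hv (\<beta> z)"
        by (simp add: pairing_add pairing_scale)
      also have "pairing n x (\<beta> z) \<le> (\<Sum>k<n. x k * b $ \<sigma> k)"
        unfolding pairing_def using x z \<sigma> by (intro sum_mono mult_left_mono) (auto simp: polyhedron_def)
      also have "pairing n ?hu (\<beta> z) \<le> pairing n ?hu (\<beta> u)" using z by (intro h_max[OF u]) auto
      also have "pairing n ?hv (\<beta> z) \<le> pairing n ?hv (\<beta> v)" using z by (intro h_max[OF v]) auto
      finally show ?thesis using c by (simp add: mult_left_mono)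
    qed
    then show ?thesis unfolding bounded_objective_def by blast
  qed
  define S where "S = (\<Union>j<J. visited (s j))"
  have conn: "(w1, w2) \<in> (step_in S)\<^sup>*" if j: "j < J" and w: "w1 \<in> visited (s j)" "w2 \<in> visited (s j)" for j w1 w2
  proof -
    obtain p d where "\<And>t k. s j t k = p k + t * d k" using affine[OF j] by blast
    then show ?thesis by (rule visited_connected) (use bd j w in \<open>auto simp: S_def\<close>)
  qed
  have uS: "u \<in> visited (s 0)" using s0 by (auto simp: visited_def intro!: bexI[of _ 0])
  \<comment> \<open>A vertex optimal at a joint is visited by both adjacent segments and passes
    reachability on.\<close>
  have reach: "j < J \<Longrightarrow> \<forall>w\<in>visited (s j). (u, w) \<in> (step_in S)\<^sup>*" for j
  proof (induction j)
    case 0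
    then show ?case using conn[of 0 u] uS by blast
  next
    case (Suc j)
    obtain w where w: "opt (s j 1) w" using opt_exists by blast
    then have "w \<in> visited (s j)" by (auto simp: visited_def intro!: bexI[of _ 1])
    then have uw: "(u, w) \<in> (step_in S)\<^sup>*" using Suc by simp
    have "opt (s (Suc j) 0) w" using link[OF Suc.prems] w by simp
    then have wv: "w \<in> visited (s (Suc j))" by (auto simp: visited_def intro!: bexI[of _ 0])
    show ?case
    proof
      fix w' assume "w' \<in> visited (s (Suc j))"
      then have "(w, w') \<in> (step_in S)\<^sup>*" using conn[OF Suc.prems wv] by blast
      then show "(u, w') \<in> (step_in S)\<^sup>*" using uw by (rule rtrancl_trans[rotated])
    qed
  qed
  have "v \<in> visited (s (J - 1))" using s1 by (auto simp: visited_def intro!: bexI[of _ 1])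
  then have "(u, v) \<in> (step_in S)\<^sup>*" using reach[of "J - 1"] J by simp
  moreover have "finite S" by (simp add: S_def)
  moreover have "u \<in> S" using uS J by (auto simp: S_def intro!: bexI[of _ 0])
  ultimately show ?thesis
    using card u unfolding step_in_def by (intro graph_path_le_rtrancl[of u v A b S]) (simp_all add: S_def)
qed

end

section \<open>Centres of the normal cones and the final constant\<close>

lemma cramer_bound:
  fixes A :: "real mat"
  defines "n \<equiv> dim_col A"
  assumes \<sigma>: "\<And>k. k < n \<Longrightarrow> \<sigma> k < dim_row A" and f: "\<And>k. k < n \<Longrightarrow> f k < dim_row A"
    and D: "0 < D" "D \<le> \<bar>det (mat\<^sub>r n n (\<lambda>r. row A (f r)))\<bar>" and Delta: "0 \<le> Delta A"
    and g: "\<And>k. k < n \<Longrightarrow> \<bar>g k\<bar> \<le> c"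
  shows "\<exists>\<mu>. (\<forall>j<n. (\<Sum>k<n. g k * row A (\<sigma> k) $ j) = (\<Sum>r<n. \<mu> r * row A (f r) $ j)) \<and>
    (\<forall>r<n. \<bar>\<mu> r\<bar> \<le> real n * c * (Delta A / D))"
proof -
  define a where "a = (\<lambda>r. row A (f r))"
  define y where "y = vec n (\<lambda>j. \<Sum>k<n. g k * row A (\<sigma> k) $ j)"
  have d: "det (mat\<^sub>r n n a) \<noteq> 0" using D by (auto simp: a_def)
  from cramer_rows[OF d, where y = y] obtain \<mu> where \<mu>: "\<forall>j<n. y $ j = (\<Sum>r<n. \<mu> r * a r $ j)"
    "\<forall>r<n. \<mu> r * det (mat\<^sub>r n n a) = det (mat\<^sub>r n n (a(r := y)))"
    by (elim exE conjE)
  \<comment> \<open>Cramer's numerator expands into \<open>n\<close> determinants of rows of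
    \<open>A\<close>, each at most \<open>Delta A\<close> in absolute value; the denominator is at
    least \<open>D\<close>.\<close>
  have "\<bar>\<mu> r\<bar> \<le> real n * c * (Delta A / D)" if r: "r < n" for r
  proof -
    have "det (mat\<^sub>r n n (a(r := y))) = (\<Sum>k<n. g k * det (mat\<^sub>r n n (a(r := row A (\<sigma> k)))))"
      by (rule det_replace_row_sum[OF r]) (simp add: y_def)
    also have "\<bar>\<dots>\<bar> \<le> (\<Sum>k<n. \<bar>g k * det (mat\<^sub>r n n (a(r := row A (\<sigma> k))))\<bar>)" by (rule sum_abs)
    also have "\<dots> \<le> (\<Sum>k<n. c * Delta A)"
    proof (rule sum_mono)
      fix k assume k: "k \<in> {..<n}"
      have e: "a(r := row A (\<sigma> k)) = (\<lambda>i. row A ((f(r := \<sigma> k)) i))" by (auto simp: a_def)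
      have "\<bar>det (mat\<^sub>r n n (a(r := row A (\<sigma> k))))\<bar> \<le> Delta A"
        unfolding e n_def by (rule det_rows_le_Delta) (use k \<sigma> f Delta in \<open>auto simp: n_def\<close>)
      moreover have "\<bar>g k\<bar> \<le> c" using g k by simp
      ultimately show "\<bar>g k * det (mat\<^sub>r n n (a(r := row A (\<sigma> k))))\<bar> \<le> c * Delta A"
        unfolding abs_mult by (intro mult_mono) auto
    qed
    finally have le: "\<bar>\<mu> r\<bar> * \<bar>det (mat\<^sub>r n n a)\<bar> \<le> real n * (c * Delta A)"
      using \<mu>(2) r by (simp flip: abs_mult)
    have "\<bar>\<mu> r\<bar> * D \<le> \<bar>\<mu> r\<bar> * \<bar>det (mat\<^sub>r n n a)\<bar>"
      using D(2) by (intro mult_left_mono) (auto simp: a_def)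
    then have "\<bar>\<mu> r\<bar> * D \<le> real n * c * Delta A" using le by (simp add: mult.assoc)
    then show ?thesis using D(1) by (simp add: field_simps)
  qed
  moreover have "(\<Sum>k<n. g k * row A (\<sigma> k) $ j) = (\<Sum>r<n. \<mu> r * row A (f r) $ j)" if "j < n" for j
    using \<mu>(1) that by (simp add: y_def a_def)
  ultimately show ?thesis by blast
qed

text \<open>The centre is the sum of the generators of a simplicial subcone, scaled by
  \<open>R\<close> and rounded to the lattice. The deviation changes each generator coefficient by
  at most \<open>R\<close>, so none becomes negative, and the generators are tight at
  \<open>w\<close>.\<close>

lemma exists_wide_centre:
  fixes A :: "real mat" and b :: "real vec"
  defines "n \<equiv> dim_col A"
  assumes \<sigma>: "\<And>k. k < n \<Longrightarrow> \<sigma> k < dim_row A"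
    and \<sigma>_det: "\<bar>det (mat\<^sub>r n n (\<lambda>k. row A (\<sigma> k)))\<bar> = Delta A"
    and B: "B \<subseteq> tight A b w" "card B = n" "D \<le> absdet A B" and D: "0 < D"
  shows "\<exists>h. (\<forall>k<n. \<bar>h k\<bar> \<le> \<lceil>2 * real n ^ 2 * (Delta A / D)\<rceil> + 1) \<and>
    (\<forall>g. (\<forall>k<n. \<bar>g k - of_int (h k)\<bar> \<le> 1) \<longrightarrow> (\<forall>x\<in>polyhedron A b. w \<in> carrier_vec n \<longrightarrow>
      pairing n g (\<lambda>k. row A (\<sigma> k) \<bullet> x) \<le> pairing n g (\<lambda>k. row A (\<sigma> k) \<bullet> w)))"
proof -
  define f where "f = pick B"
  have BI: "B \<subseteq> {0..<dim_row A}" using B(1) by (auto simp: tight_def)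
  have fB: "bij_betw f {..<n} B" unfolding f_def using BI B(2) finite_subset by (intro bij_betw_pick) blast+
  have fin: "f r \<in> tight A b w" if "r < n" for r using fB B(1) that by (auto simp: bij_betw_def)
  have f: "f r < dim_row A" "row A (f r) \<bullet> w = b $ f r" if "r < n" for r
    using fin[OF that] by (auto simp: tight_def)
  have Df: "D \<le> \<bar>det (mat\<^sub>r n n (\<lambda>r. row A (f r)))\<bar>"
    using B(3) absdet_eq_rows[OF fB[unfolded n_def] BI] by (simp add: n_def)
  have "absdet A B \<le> Delta A" by (rule absdet_le_Delta[OF BI]) (simp add: B(2) n_def)
  then have DD: "D \<le> Delta A" using B(3) by simp
  have Dpos: "0 < Delta A" using DD D by simp
  \<comment> \<open>In the rows of maximal determinant the Cramer bound has ratio 1, so a sum of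
    \<open>n\<close> rows has coordinates at most \<open>n\<close>.\<close>
  have "\<exists>\<zeta>. (\<forall>j<n. (\<Sum>r<n. 1 * row A (f r) $ j) = (\<Sum>k<n. \<zeta> k * row A (\<sigma> k) $ j)) \<and>
      (\<forall>k<n. \<bar>\<zeta> k\<bar> \<le> real n * 1 * (Delta A / Delta A))"
    unfolding n_def by (rule cramer_bound) (use f(1) \<sigma> \<sigma>_det Dpos in \<open>auto simp: n_def\<close>)
  then obtain \<zeta> where \<zeta>: "\<And>j. j < n \<Longrightarrow> (\<Sum>r<n. row A (f r) $ j) = (\<Sum>k<n. \<zeta> k * row A (\<sigma> k) $ j)"
    and \<zeta>_le: "\<And>k. k < n \<Longrightarrow> \<bar>\<zeta> k\<bar> \<le> real n" using Dpos by auto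
  \<comment> \<open>The 2 is rounding error 1 plus ball radius 1; the rest is the Cramer loss in
    passing to the generators in \<open>B\<close>.\<close>
  define R where "R = real n * 2 * (Delta A / D)"
  have R0: "R \<ge> 0" using Dpos D by (simp add: R_def)
  define h where "h = (\<lambda>k. \<lfloor>R * \<zeta> k\<rfloor>)"
  have "\<bar>h k\<bar> \<le> \<lceil>2 * real n ^ 2 * (Delta A / D)\<rceil> + 1" if "k < n" for k
  proof -
    have "\<bar>R * \<zeta> k\<bar> \<le> R * real n"
      unfolding abs_mult using \<zeta>_le[OF that] R0 by (intro mult_mono) auto
    also have "\<dots> = 2 * real n ^ 2 * (Delta A / D)" by (simp add: R_def power2_eq_square)
    finally show ?thesis unfolding h_def by linarith
  qed
  moreover have "pairing n g (\<lambda>k. row A (\<sigma> k) \<bullet> x) \<le> pairing n g (\<lambda>k. row A (\<sigma> k) \<bullet> w)"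
    if g: "\<forall>k<n. \<bar>g k - of_int (h k)\<bar> \<le> 1" and x: "x \<in> polyhedron A b" and wc: "w \<in> carrier_vec n" for g x
  proof -
    have "\<bar>g k - R * \<zeta> k\<bar> \<le> 2" if "k < n" for k
    proof -
      have "\<bar>g k - of_int (h k)\<bar> \<le> 1" using g that by simp
      then show ?thesis unfolding h_def by linarith
    qed
    then have "\<exists>\<mu>. (\<forall>j<n. (\<Sum>k<n. (g k - R * \<zeta> k) * row A (\<sigma> k) $ j) = (\<Sum>r<n. \<mu> r * row A (f r) $ j)) \<and>
        (\<forall>r<n. \<bar>\<mu> r\<bar> \<le> real n * 2 * (Delta A / D))"
      unfolding n_def by (intro cramer_bound) (use f(1) \<sigma> Df Dpos D in \<open>auto simp: n_def\<close>)
    then obtain \<mu> where \<mu>: "\<And>j. j < n \<Longrightarrow> (\<Sum>k<n. (g k - R * \<zeta> k) * row A (\<sigma> k) $ j) = (\<Sum>r<n. \<mu> r * row A (f r) $ j)"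
      and \<mu>_le: "\<And>r. r < n \<Longrightarrow> \<bar>\<mu> r\<bar> \<le> R" unfolding R_def by blast
    have coord: "(\<Sum>k<n. g k * row A (\<sigma> k) $ j) = (\<Sum>r<n. (\<mu> r + R) * row A (f r) $ j)" if "j < n" for j
    proof -
      have "(\<Sum>k<n. g k * row A (\<sigma> k) $ j) = (\<Sum>k<n. (g k - R * \<zeta> k) * row A (\<sigma> k) $ j)
          + R * (\<Sum>k<n. \<zeta> k * row A (\<sigma> k) $ j)"
        unfolding sum_distrib_left sum.distrib[symmetric] by (intro sum.cong refl) (simp add: algebra_simps)
      also have "\<dots> = (\<Sum>r<n. \<mu> r * row A (f r) $ j) + R * (\<Sum>r<n. row A (f r) $ j)"
        using \<mu> \<zeta> that by simp
      also have "\<dots> = (\<Sum>r<n. (\<mu> r + R) * row A (f r) $ j)"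
        unfolding sum_distrib_left sum.distrib[symmetric] by (intro sum.cong refl) (simp add: algebra_simps)
      finally show ?thesis .
    qed
    have ip: "pairing n g (\<lambda>k. row A (\<sigma> k) \<bullet> z) = (\<Sum>r<n. (\<mu> r + R) * (row A (f r) \<bullet> z))"
      if z: "z \<in> carrier_vec n" for z
    proof -
      have "pairing n g (\<lambda>k. row A (\<sigma> k) \<bullet> z) = vec n (\<lambda>j. \<Sum>k<n. g k * row A (\<sigma> k) $ j) \<bullet> z"
        unfolding pairing_def using z by (intro sum_rows_scalar_prod[symmetric]) (auto simp: n_def)
      also have "vec n (\<lambda>j. \<Sum>k<n. g k * row A (\<sigma> k) $ j) = vec n (\<lambda>j. \<Sum>r<n. (\<mu> r + R) * row A (f r) $ j)"
        using coord by auto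
      also have "\<dots> \<bullet> z = (\<Sum>r<n. (\<mu> r + R) * (row A (f r) \<bullet> z))"
        using z by (intro sum_rows_scalar_prod) (auto simp: n_def)
      finally show ?thesis .
    qed
    have xc: "x \<in> carrier_vec n" using x by (simp add: polyhedron_def n_def)
    have "(\<Sum>r<n. (\<mu> r + R) * (row A (f r) \<bullet> x)) \<le> (\<Sum>r<n. (\<mu> r + R) * (row A (f r) \<bullet> w))"
    proof (rule sum_mono, rule mult_left_mono)
      fix r assume "r \<in> {..<n}"
      then have r: "r < n" by simp
      show "row A (f r) \<bullet> x \<le> row A (f r) \<bullet> w" using f[OF r] x by (simp add: polyhedron_def)
      show "0 \<le> \<mu> r + R" using \<mu>_le[OF r] by linarith
    qed
    then show ?thesis using ip xc wc by simp
  qed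
  ultimately show ?thesis by blast
qed

lemma diameter_bound:
  fixes A :: "real mat" and b :: "real vec"
  defines "n \<equiv> dim_col A"
  assumes n2: "2 \<le> n" and rank: "full_column_rank A"
    and u: "is_vertex A b u" and v: "is_vertex A b v"
  shows "graph_path_le A b u v
    (576 * real n ^ 3 * (Delta A / Delta_min A b) * ln (real n * (Delta A / Delta_min A b)))"
proof -
  define D where "D = Delta_min A b"
  have D: "D > 0" unfolding D_def by (rule Delta_min_properties(1)[OF rank u])
  have simplex: "\<exists>B. B \<subseteq> tight A b w \<and> card B = n \<and> D \<le> absdet A B" if "is_vertex A b w" for w
    using Delta_min_properties(2)[OF rank u that] by (simp add: D_def n_def)
  obtain B where B: "B \<subseteq> tight A b u" "card B = n" "D \<le> absdet A B" using simplex[OF u] by blast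
  have BI: "B \<subseteq> {0..<dim_row A}" using B(1) by (auto simp: tight_def)
  have "absdet A B \<le> Delta A" by (rule absdet_le_Delta[OF BI]) (simp add: B(2) n_def)
  then have DD: "D \<le> Delta A" using B(3) by simp
  let ?S = "{absdet A B | B. B \<subseteq> {0..<dim_row A} \<and> card B = dim_col A}"
  have "finite (absdet A ` Pow {0..<dim_row A})" by simp
  then have "finite ?S" by (rule rev_finite_subset) auto
  moreover have "?S \<noteq> {}" using BI B(2) by (auto simp: n_def)
  ultimately have "Delta A \<in> ?S" unfolding Delta_def by (rule Max_in)
  then obtain B0 where B0: "Delta A = absdet A B0" "B0 \<subseteq> {0..<dim_row A}" "card B0 = n" by (auto simp: n_def)
  define \<sigma> where "\<sigma> = pick B0"
  have \<sigma>B: "bij_betw \<sigma> {..<n} B0" unfolding \<sigma>_def using B0(2,3) finite_subset by (intro bij_betw_pick) blast+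
  have \<sigma>: "\<sigma> k < dim_row A" if "k < n" for k using \<sigma>B B0(2) that by (auto simp: bij_betw_def)
  have \<sigma>_det: "\<bar>det (mat\<^sub>r n n (\<lambda>k. row A (\<sigma> k)))\<bar> = Delta A"
    using absdet_eq_rows[OF \<sigma>B[unfolded n_def] B0(2)] B0(1) by (simp add: n_def)
  define \<rho> where "\<rho> = Delta A / D"
  have \<rho>1: "\<rho> \<ge> 1" using D DD by (simp add: \<rho>_def)
  define H where "H = nat (\<lceil>2 * real n ^ 2 * \<rho>\<rceil> + 1)"
  have sq: "4 \<le> real n ^ 2"
  proof -
    have "2 ^ 2 \<le> real n ^ 2" using n2 by (intro power_mono) auto
    then show ?thesis by simp
  qed
  have nr: "1 \<le> real n ^ 2 * \<rho>" using sq \<rho>1 mult_mono[of 1 "real n ^ 2" 1 \<rho>] by simp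
  have Hint: "int H = \<lceil>2 * real n ^ 2 * \<rho>\<rceil> + 1"
  proof -
    have "0 \<le> 2 * real n ^ 2 * \<rho>" using \<rho>1 by simp
    then have "0 \<le> \<lceil>2 * real n ^ 2 * \<rho>\<rceil> + 1" by linarith
    then show ?thesis by (simp add: H_def)
  qed
  have H1: "H \<ge> 1" using Hint nr by linarith
  have H_le: "real H \<le> 4 * real n ^ 2 * \<rho>"
  proof -
    have "real_of_int (int H) \<le> 2 * real n ^ 2 * \<rho> + 2" unfolding Hint by linarith
    then show ?thesis using nr by simp
  qed
  define P where "P = (\<lambda>w h. (\<forall>k<n. \<bar>h k\<bar> \<le> int H) \<and>
    (\<forall>g. (\<forall>k<n. \<bar>g k - of_int (h k)\<bar> \<le> 1) \<longrightarrow> (\<forall>x\<in>polyhedron A b. w \<in> carrier_vec n \<longrightarrow>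
      pairing n g (\<lambda>k. row A (\<sigma> k) \<bullet> x) \<le> pairing n g (\<lambda>k. row A (\<sigma> k) \<bullet> w))))"
  have "\<exists>h. P w h" if w: "is_vertex A b w" for w
  proof -
    obtain B where "B \<subseteq> tight A b w" "card B = n" "D \<le> absdet A B" using simplex[OF w] by blast
    then show ?thesis
      unfolding P_def Hint \<rho>_def using exists_wide_centre[of A \<sigma> B b w D] \<sigma> \<sigma>_det D
      by (simp add: n_def)
  qed
  then obtain h where h: "\<And>w. is_vertex A b w \<Longrightarrow> P w (h w)" by metis
  interpret vertex_fan A b \<sigma> h H
  proof
    show "1 \<le> dim_col A" using n2 by (simp add: n_def)
    show "full_column_rank A" by (rule rank)
    show "1 \<le> H" by (rule H1)
    show "\<exists>w. is_vertex A b w" using u by blast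
    show "\<sigma> k < dim_row A" if "k < dim_col A" for k using \<sigma> that by (simp add: n_def)
    show "det (mat\<^sub>r (dim_col A) (dim_col A) (\<lambda>k. row A (\<sigma> k))) \<noteq> 0"
      using \<sigma>_det D DD by (auto simp: n_def)
    show "\<bar>h w k\<bar> \<le> int H" if "is_vertex A b w" "k < dim_col A" for w k
      using h[OF that(1)] that(2) by (simp add: P_def n_def)
    show "pairing (dim_col A) g (\<lambda>k. row A (\<sigma> k) \<bullet> x) \<le> pairing (dim_col A) g (\<lambda>k. row A (\<sigma> k) \<bullet> w)"
      if "is_vertex A b w" "\<And>k. k < dim_col A \<Longrightarrow> \<bar>g k - of_int (h w k)\<bar> \<le> 1" "x \<in> polyhedron A b" for w g x
    proof -
      have "w \<in> carrier_vec n"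
        using that(1) by (auto simp: is_vertex_iff_basic_point basic_point_def n_def dest: halfspaces_carrier)
      then show ?thesis using h[OF that(1)] that(2,3) by (simp add: P_def n_def)
    qed
  qed
  let ?L = "ln (real n * \<rho>)"
  have n\<rho>: "2 \<le> real n * \<rho>" using n2 \<rho>1 mult_mono[of 2 "real n" 1 \<rho>] by simp
  \<comment> \<open>\<open>n \<ge> 2\<close> keeps the logarithm away from 0, so it can absorb the
    additive 1 of the path bound.\<close>
  have L: "1 \<le> 2 * ?L"
  proof -
    have "ln (1 / 2 :: real) \<le> 1 / 2 - 1" by (rule ln_le_minus_one) simp
    then have "1 / 2 \<le> ln (2::real)" by (simp add: ln_div)
    also have "\<dots> \<le> ?L" using n\<rho> by simp
    finally show ?thesis by simp
  qed
  have lnH: "ln (real H) \<le> 4 * ?L"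
  proof -
    have "real H \<le> real n ^ 2 * (real n ^ 2 * \<rho>)" using H_le sq nr mult_right_mono[of 4 "real n ^ 2" "real n ^ 2 * \<rho>"] by simp
    also have "\<dots> = real n ^ 4 * \<rho>" by (simp add: power2_eq_square power4_eq_xxxx)
    also have "\<dots> \<le> real n ^ 4 * \<rho> ^ 4"
      using \<rho>1 self_le_power[of \<rho> 4] by (intro mult_left_mono) auto
    also have "\<dots> = (real n * \<rho>) ^ 4" by (simp add: power_mult_distrib)
    finally have "real H \<le> (real n * \<rho>) ^ 4" .
    then have "ln (real H) \<le> ln ((real n * \<rho>) ^ 4)" by (rule ln_mono[rotated 2]) (use H1 n\<rho> in auto)
    then show ?thesis using n\<rho> by (simp add: ln_realpow)
  qed
  \<comment> \<open>The constant is \<open>24 * 4 * (4 + 2) = 576\<close>: a 4 from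
    \<open>H\<close>, a 4 from \<open>ln H\<close> and a 2 from the additive 1.\<close>
  have "24 * real n * real H * (ln (real H) + 1) \<le> 24 * real n * (4 * real n ^ 2 * \<rho>) * (4 * ?L + 2 * ?L)"
    using H_le lnH L H1 \<rho>1 by (intro mult_mono add_mono mult_left_mono) auto
  also have "\<dots> = 576 * real n ^ 3 * \<rho> * ?L" by (simp add: power2_eq_square power3_eq_cube)
  finally have "24 * real n * real H * (ln (real H) + 1) \<le> 576 * real n ^ 3 * \<rho> * ?L" .
  moreover have "graph_path_le A b u v (24 * real n * real H * (ln (real H) + 1))"
    using short_path[OF u v] by (simp add: n_def)
  ultimately show ?thesis unfolding \<rho>_def D_def by (rule graph_path_le_mono[rotated])
qed

text \<open>The constant is chosen before the matrix, which makes it absolute. For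
  \<open>n = 1\<close> a bounded interval with both rows of absolute value 1 has logarithm 0 but
  diameter 1, hence \<open>2 \<le> n\<close>.\<close>

theorem theorem2:
  "\<exists>C::real. C > 0 \<and>
    (\<forall>(A::real mat) (b::real vec).
       let n = dim_col A; m = dim_row A in
       2 \<le> n \<longrightarrow> b \<in> carrier_vec m \<longrightarrow>
       full_column_rank A \<longrightarrow>
       pointed A b \<longrightarrow>
       has_aff_dim n (polyhedron A b) n \<longrightarrow>
       (\<forall>i<m. facet_defining A b i) \<longrightarrow>
       (\<forall>u v. is_vertex A b u \<longrightarrow> is_vertex A b v \<longrightarrow>
          graph_path_le A b u v
            (C * real n ^ 3 * (Delta A / Delta_min A b) * ln (real n * (Delta A / Delta_min A b)))))"
  unfolding Let_def
proof (intro exI[of _ 576] conjI allI impI)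
  fix A :: "real mat" and b :: "real vec" and u v
  assume "2 \<le> dim_col A" "full_column_rank A" "is_vertex A b u" "is_vertex A b v"
  then show "graph_path_le A b u v (576 * real (dim_col A) ^ 3 * (Delta A / Delta_min A b)
      * ln (real (dim_col A) * (Delta A / Delta_min A b)))"
    by (rule diameter_bound)
qed simp

end
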